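(* $\mathrm{MC}^*(\cap,\cup,\overline{\phantom{c}},+,-)\in\mathrm{PSPACE}$.
   Context: For $k\ge1$ let $\mathbb N_\infty^k=\mathbb N^k\cup\{\infty\}$ (natural numbers include $0$). Addition on $\mathbb N^k$ is componentwise, and $\infty+m=m+\infty=\infty+\infty=\infty$ for $m\in\mathbb N^k$. Subtraction is partial: for $a,b\in\mathbb N^k$, $a-b$ is defined (componentwise) iff $a_i-b_i\in\mathbb N$ for all $i$; $\infty-m=\infty$ for $m\in\mathbb N^k$; $m-\infty$ and $\infty-\infty$ are undefined. For $A,B\subseteq\mathbb N_\infty^k$: $A\cap B$, $A\cup B$ usual, $A+B=\{a+b:a\in A,b\in B\}$, $A-B=\{a-b: a\in A,b\in B, a-b \text{ defined}\}$, $\overline A=\mathbb N_\infty^k\setminus A$. For $\emptyset\ne\mathcal O\subseteq\{\cup,\cap,\overline{\phantom{c}},+,-\}$, an $\mathcal O$-circuit over $\mathbb N_\infty^k$ is a finite acyclic directed multigraph $C=(V,E,g_C,\alpha)$ with gates of indegree $0,1,2$, a designated output gate $g_C$, input gates labeled by elements of $\mathbb N_\infty^k$, indegree-$1$ gates labeled $\overline{\phantom{c}}$ (only if $\overline{\phantom{c}}\in\mathcal O$), indegree-$2$ gates labeled by operations in $\mathcal O\setminus\{\overline{\phantom{c}}\}$; result sets $I(g)$ are defined inductively ($\{\alpha(g)\}$ for inputs, complement of the predecessor's set, or $I(g_1)\sigma I(g_2)$ with predecessors $g_1\le g_2$), and $I(C)=I(g_C)$. Circuits are encoded as bit strings listing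 gates in reverse topological order with labels and predecessor lists, numbers in binary. $\mathrm{MC}^*(\mathcal O)$ is the set of all $(C,b)$ such that for some $k\ge1$, $C$ is an $\mathcal O$-circuit over $\mathbb N_\infty^k$, $b\in\mathbb N_\infty^k$, and $b\in I(C)$. *)

theory Defs
  imports Main
begin

datatype ext = Fin "nat list" | Infty

definition univ :: "nat \<Rightarrow> ext set" where
  "univ k = {Fin v | v. length v = k} \<union> {Infty}"

fun ext_plus :: "ext \<Rightarrow> ext \<Rightarrow> ext" where
  "ext_plus (Fin a) (Fin b) = Fin (map2 (+) a b)"
| "ext_plus _ _ = Infty"

fun ext_minus :: "ext \<Rightarrow> ext \<Rightarrow> ext option" where
  "ext_minus (Fin a) (Fin b) =
     (if length a = length b \<and> (\<forall>i<length a. b ! i \<le> a ! i)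
      then Some (Fin (map2 (-) a b)) else None)"
| "ext_minus Infty (Fin b) = Some Infty"
| "ext_minus _ Infty = None"

definition set_plus :: "ext set \<Rightarrow> ext set \<Rightarrow> ext set" where
  "set_plus A B = {ext_plus a b | a b. a \<in> A \<and> b \<in> B}"

definition set_minus :: "ext set \<Rightarrow> ext set \<Rightarrow> ext set" where
  "set_minus A B = {c. \<exists>a\<in>A. \<exists>b\<in>B. ext_minus a b = Some c}"

datatype oper = OUn | OInt | OCompl | OPlus | OMinus
datatype bop = BUn | BInt | BPlus | BMinus

fun bop_oper :: "bop \<Rightarrow> oper" where
  "bop_oper BUn = OUn" | "bop_oper BInt = OInt"
| "bop_oper BPlus = OPlus" | "bop_oper BMinus = OMinus"

fun bop_sem :: "bop \<Rightarrow> ext set \<Rightarrow> ext set \<Rightarrow> ext set" where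
  "bop_sem BUn A B = A \<union> B"
| "bop_sem BInt A B = A \<inter> B"
| "bop_sem BPlus A B = set_plus A B"
| "bop_sem BMinus A B = set_minus A B"

text \<open>A gate: input gate with label, complement gate with its predecessor,
  or binary gate with operation and its (ordered) predecessors.
  A circuit is a list of gates in reverse topological order (predecessors of
  gate i have indices > i) together with the index of the output gate.\<close>
datatype gate = Inp ext | Neg nat | Bin bop nat nat

definition wf_circuit :: "oper set \<Rightarrow> nat \<Rightarrow> gate list \<Rightarrow> nat \<Rightarrow> bool" where
  "wf_circuit Ops k gs out \<longleftrightarrow> out < length gs \<and>
     (\<forall>i<length gs. case gs ! i of
        Inp a \<Rightarrow> a \<in> univ k
      | Neg j \<Rightarrow> OCompl \<in> Ops \<and> i < j \<and> j < length gs
      | Bin f j l \<Rightarrow> bop_oper f \<in> Ops \<and> i < j \<and> j < length gs \<and> i < l \<and> l < length gs)"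

function gval :: "nat \<Rightarrow> gate list \<Rightarrow> nat \<Rightarrow> ext set" where
  "gval k gs i =
     (if i < length gs then
        (case gs ! i of
           Inp a \<Rightarrow> {a}
         | Neg j \<Rightarrow> (if i < j then univ k - gval k gs j else {})
         | Bin f j l \<Rightarrow> (if i < j \<and> i < l then bop_sem f (gval k gs j) (gval k gs l) else {}))
      else {})"
  by pat_completeness auto
termination
  by (relation "measure (\<lambda>(k, gs, i). length gs - i)") auto

fun bin :: "nat \<Rightarrow> bool list" where
  "bin n = (if n = 0 then [] else (n mod 2 = 1) # bin (n div 2))"

text \<open>Self-delimiting code of a natural number: binary digits (LSB first),
  each prefixed by True, terminated by False False.\<close>
definition enc_nat :: "nat \<Rightarrow> bool list" where
  "enc_nat n = concat (map (\<lambda>x. [True, x]) (bin n)) @ [False, False]"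

fun tok_ext :: "ext \<Rightarrow> nat list" where
  "tok_ext Infty = [0]"
| "tok_ext (Fin v) = 1 # length v # v"

fun bop_code :: "bop \<Rightarrow> nat" where
  "bop_code BUn = 0" | "bop_code BInt = 1" | "bop_code BPlus = 2" | "bop_code BMinus = 3"

fun tok_gate :: "gate \<Rightarrow> nat list" where
  "tok_gate (Inp a) = 0 # tok_ext a"
| "tok_gate (Neg j) = [1, j]"
| "tok_gate (Bin f j l) = [2, bop_code f, j, l]"

definition enc_instance :: "gate list \<Rightarrow> nat \<Rightarrow> ext \<Rightarrow> bool list" where
  "enc_instance gs out b =
     concat (map enc_nat ([length gs, out] @ concat (map tok_gate gs) @ tok_ext b))"

definition MC :: "oper set \<Rightarrow> bool list set" where
  "MC Ops = {enc_instance gs out b | gs out b.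
             \<exists>k\<ge>1. wf_circuit Ops k gs out \<and> b \<in> univ k \<and> b \<in> gval k gs out}"

datatype dir = DL | DR | DS

text \<open>Single one-way-infinite tape; states 0..nq-1 (start 0), tape symbols
  0..ns-1 with 0 = blank, 1 = input bit False, 2 = input bit True.\<close>
record tm =
  nq :: nat
  ns :: nat
  delta :: "nat \<Rightarrow> nat \<Rightarrow> nat \<times> nat \<times> dir"
  qacc :: nat
  qrej :: nat

definition wf_tm :: "tm \<Rightarrow> bool" where
  "wf_tm M \<longleftrightarrow> 0 < nq M \<and> 3 \<le> ns M \<and> qacc M < nq M \<and> qrej M < nq M \<and>
     qacc M \<noteq> qrej M \<and>
     (\<forall>q<nq M. \<forall>s<ns M. case delta M q s of (q', s', d) \<Rightarrow> q' < nq M \<and> s' < ns M)"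

type_synonym config = "nat \<times> (nat \<Rightarrow> nat) \<times> nat"

definition tm_step :: "tm \<Rightarrow> config \<Rightarrow> config" where
  "tm_step M c = (case c of (q, t, h) \<Rightarrow>
     if q = qacc M \<or> q = qrej M then c
     else (case delta M q (t h) of (q', s', d) \<Rightarrow>
       (q', t(h := s'), (case d of DL \<Rightarrow> h - 1 | DR \<Rightarrow> h + 1 | DS \<Rightarrow> h))))"

definition tm_init :: "bool list \<Rightarrow> config" where
  "tm_init w = (0, (\<lambda>i. if i < length w then (if w ! i then 2 else 1) else 0), 0)"

definition tm_run :: "tm \<Rightarrow> bool list \<Rightarrow> nat \<Rightarrow> config" where
  "tm_run M w n = (tm_step M ^^ n) (tm_init w)"

definition cstate :: "config \<Rightarrow> nat" where "cstate c = fst c"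
definition chead :: "config \<Rightarrow> nat" where "chead c = snd (snd c)"

definition decides_in_space :: "tm \<Rightarrow> bool list set \<Rightarrow> (nat \<Rightarrow> nat) \<Rightarrow> bool" where
  "decides_in_space M L s \<longleftrightarrow>
     (\<forall>w. (\<exists>n. cstate (tm_run M w n) \<in> {qacc M, qrej M}) \<and>
          (\<forall>n. chead (tm_run M w n) < s (length w)) \<and>
          (w \<in> L \<longleftrightarrow> (\<exists>n. cstate (tm_run M w n) = qacc M)))"

definition PSPACE :: "bool list set set" where
  "PSPACE = {L. \<exists>M c d. wf_tm M \<and> decides_in_space M L (\<lambda>n. c * (n + 1) ^ d)}"

end

theory Submission
  imports Defs
begin

text \<open>
  A Turing machine with a binary track per register simulates while programs over natural numbers in
  space logarithmic in the register contents. Hence all functions built from the constant zero, successor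
  and recursion whose values stay below \<open>2 ^ poly n\<close>, with \<open>n\<close> the length of the inputs, are computable in
  polynomial space; this class contains the usual arithmetic, bounded sums and quantifiers, and, by
  depth-first search with the stack coded as a number, the evaluation of games of polynomial length
  with \<open>2 ^ poly n\<close> positions.

  Membership in the set of a gate is such a game: one player decomposes a claim \<open>x \<in> A + B\<close> or
  \<open>x \<in> A - B\<close> into two claims, the other one picks the claim to be defended next; complement exchanges the roles.
  For subtraction the claims would involve unbounded vectors. But entries above a threshold, which at
  worst doubles with every gate, can be truncated without changing membership in the set of any gate,
  so it suffices to consider vectors with entries below \<open>2 ^ (2 * n) + 1\<close> and to truncate sums.
  The input is parsed by searching for a coded instance whose encoding is the input.
\<close>


text \<open>Two obstacles shape the construction. The number of a word forgets its trailing False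
  bits, and with them its length. Programs therefore receive \<open>num (map Not w)\<close> as well;
  the sum of both numbers, \<open>2 ^ n - 1\<close>, is the parameter \<open>m\<close> from which
  all bounds are derived. Moreover, a power \<open>2 ^ a\<close> with a computable exponent can have
  exponential length and leave the class. So every exponent is capped by the length of another
  value, in the form \<open>min a (bit_len b)\<close>; this is why powers carry seemingly redundant
  minima such as \<open>min (bit_len m) (bit_len m)\<close>. Running time is never counted: loops of
  exponential length are free, so exhaustive search over circuits, positions and moves is
  affordable, and only the size of intermediate values needs proof. The threshold is a product of
  two factors \<open>2 ^ n\<close>: the labels in an instance of length \<open>n\<close> are below
  \<open>2 ^ n\<close>, and there are at most \<open>n\<close> gates to double it. One gap remains:
  if no vector occurs, the encoding does not bound the dimension \<open>k\<close>, and that case is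
  reduced to \<open>k = 1\<close>.\<close>

section \<open>Carry and borrow in binary notation\<close>

lemma bit_Suc_nat_cases:
  fixes x :: nat
  assumes "\<forall>i<j. bit x i" and "\<not> bit x j"
  shows "bit (Suc x) i \<longleftrightarrow> i = j \<or> j < i \<and> bit x i"
  using assms
proof (induction j arbitrary: x i)
  case 0
  then show ?case
    by (cases i) (auto simp: bit_0 bit_Suc elim: evenE)
next
  case (Suc j)
  have "odd x" using Suc.prems(1) by (auto simp: bit_0[symmetric])
  then obtain y where y: "x = Suc (2 * y)" by (elim oddE) auto
  have "\<forall>i<j. bit y i" "\<not> bit y j"
    using Suc.prems by (auto simp: y bit_Suc)
  from Suc.IH[OF this] show ?case
    by (cases i) (auto simp: y bit_0 bit_Suc)
qed

lemma bit_pred_nat_cases: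
  fixes x :: nat
  assumes "\<forall>i<j. \<not> bit x i" and "bit x j"
  shows "bit (x - 1) i \<longleftrightarrow> i < j \<or> j < i \<and> bit x i"
  using assms
proof (induction j arbitrary: x i)
  case 0
  then obtain y where y: "x = Suc (2 * y)" by (auto simp: bit_0 elim!: oddE)
  then show ?case
    by (cases i) (auto simp: y bit_0 bit_Suc)
next
  case (Suc j)
  have "even x" using Suc.prems(1)[rule_format, of 0] by (simp add: bit_0)
  then obtain y where y: "x = 2 * y" by (elim evenE) auto
  have yj: "\<forall>i<j. \<not> bit y i" "bit y j"
    using Suc.prems by (auto simp: y bit_Suc)
  then have "y \<noteq> 0" by (metis bit_0_eq bot_apply bot_bool_def)
  then have "x - 1 = Suc (2 * (y - 1))" by (simp add: y)
  with Suc.IH[OF yj] show ?case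
    by (cases i) (auto simp: y bit_0 bit_Suc)
qed

text \<open>Ones in all positions below \<open>j\<close> alone contribute \<open>2 ^ j - 1\<close>.
  This limits how far the carry of an increment travels on the tape.\<close>

lemma power_le_Suc_if_low_bits:
  fixes x :: nat
  assumes "\<forall>i<j. bit x i"
  shows "2 ^ j \<le> Suc x"
  using assms
proof (induction j arbitrary: x)
  case (Suc j)
  have "odd x" using Suc.prems(1) by (auto simp: bit_0[symmetric])
  then obtain y where y: "x = Suc (2 * y)" by (elim oddE) auto
  have "\<forall>i<j. bit y i"
    using Suc.prems by (auto simp: y bit_Suc)
  from Suc.IH[OF this] show ?case by (simp add: y)
qed simp

lemma ex_low_clear_bit: "\<exists>j. (\<forall>i<j. bit (x :: nat) i) \<and> \<not> bit x j"
proof -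
  have "\<not> bit x x" by (simp add: bit_nat_def)
  then show ?thesis using exists_least_iff[of "\<lambda>j. \<not> bit x j"] by blast
qed

lemma ex_low_set_bit: "x \<noteq> 0 \<Longrightarrow> \<exists>j. (\<forall>i<j. \<not> bit (x :: nat) i) \<and> bit x j"
  using exists_least_iff[of "\<lambda>j. bit x j"] by (metis bit_eq_iff bit_0_eq bot_apply bot_bool_def)

lemma less_power_if_no_high_bits:
  fixes x :: nat
  assumes "\<And>i. n \<le> i \<Longrightarrow> \<not> bit x i"
  shows "x < 2 ^ n"
proof -
  have "take_bit n x = x"
    using assms by (auto simp: bit_eq_iff bit_take_bit_iff) (meson not_le)
  then show ?thesis by (metis take_bit_nat_less_exp)
qed

section \<open>While programs\<close>

datatype com = Inc nat | Dec nat | Seq com com | While nat com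

type_synonym store = "nat \<Rightarrow> nat"

text \<open>A derivation certifies termination and space together: \<open>Inc\<close> applies only
  below \<open>b\<close>, so no increment takes a register beyond \<open>b\<close>.\<close>

inductive exec :: "nat \<Rightarrow> com \<Rightarrow> store \<Rightarrow> store \<Rightarrow> bool" for b where
  Inc: "s r < b \<Longrightarrow> exec b (Inc r) s (s(r := Suc (s r)))"
| Dec: "exec b (Dec r) s (s(r := s r - 1))"
| Seq: "exec b p s s1 \<Longrightarrow> exec b q s1 s2 \<Longrightarrow> exec b (Seq p q) s s2"
| WhileF: "s r = 0 \<Longrightarrow> exec b (While r p) s s"
| WhileT: "s r \<noteq> 0 \<Longrightarrow> exec b p s s1 \<Longrightarrow> exec b (While r p) s1 s2 \<Longrightarrow> exec b (While r p) s s2"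

fun regs :: "com \<Rightarrow> nat set" where
  "regs (Inc r) = {r}"
| "regs (Dec r) = {r}"
| "regs (Seq p q) = regs p \<union> regs q"
| "regs (While r p) = insert r (regs p)"

lemma finite_regs: "finite (regs p)"
  by (induction p) auto

section \<open>Compilation to Turing machines\<close>

datatype instr = MARK | INC nat | DEC nat | JZ nat nat | JMP nat

fun clen :: "com \<Rightarrow> nat" where
  "clen (Inc r) = 1"
| "clen (Dec r) = 1"
| "clen (Seq p q) = clen p + clen q"
| "clen (While r p) = clen p + 2"

text \<open>Jump targets are absolute, so the code depends on the address \<open>a\<close> at which
  it is placed.\<close>

fun compile :: "com \<Rightarrow> nat \<Rightarrow> instr list" where
  "compile (Inc r) a = [INC r]"
| "compile (Dec r) a = [DEC r]"
| "compile (Seq p q) a = compile p a @ compile q (a + clen p)"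
| "compile (While r p) a = JZ r (a + clen p + 2) # compile p (a + 1) @ [JMP a]"

lemma length_compile [simp]: "length (compile p a) = clen p"
  by (induction p arbitrary: a) auto

text \<open>Register \<open>r < m\<close> lives on a binary track: bit \<open>r\<close> of the symbol in cell \<open>i\<close> is bit \<open>i\<close>
  of the register. Bit \<open>m\<close> of a symbol keeps every rewritten cell different from the blank \<open>0\<close>,
  so that the first blank marks the end of all numbers; bit \<open>m + 1\<close> marks the leftmost cell.\<close>

definition put_bit :: "nat \<Rightarrow> nat \<Rightarrow> bool \<Rightarrow> nat \<Rightarrow> nat" where
  "put_bit m r v x = set_bit m ((if v then set_bit else unset_bit) r x)"

lemma bit_put_bit: "bit (put_bit m r v x) i \<longleftrightarrow> i = m \<or> (if i = r then v else bit x i)"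
  by (auto simp: put_bit_def bit_set_bit_iff bit_unset_bit_iff)

lemma put_bit_neq_0 [simp]: "put_bit m r v x \<noteq> 0"
  using bit_put_bit[of m r v x m] by (metis bit_0_eq bot_apply bot_bool_def)

lemma put_bit_less:
  assumes "x < 2 ^ (m + 2)" and "r < m"
  shows "put_bit m r v x < 2 ^ (m + 2)"
proof (rule less_power_if_no_high_bits)
  fix i assume i: "m + 2 \<le> i"
  have "\<not> bit x i"
    using assms(1) i by (metis bit_take_bit_iff leD take_bit_nat_eq_self_iff)
  then show "\<not> bit (put_bit m r v x) i"
    using i assms(2) by (auto simp: bit_put_bit)
qed

text \<open>State \<open>8 * pc + ph\<close>: phase 0 starts (or continues, moving right) the instruction at \<open>pc\<close>,
  phases 1 and 2 return to the left end and then go to \<open>pc + 1\<close> resp. the jump target,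
  phase 3 returns while propagating the borrow of a decrement.\<close>

fun action :: "nat \<Rightarrow> instr \<Rightarrow> nat \<Rightarrow> nat \<Rightarrow> nat \<Rightarrow> nat \<times> nat \<times> dir" where
  "action m MARK pc ph x = (8 * (pc + 1), set_bit (m + 1) (set_bit m x), DS)"
| "action m (JMP a) pc ph x = (8 * a, x, DS)"
| "action m (INC r) pc ph x =
    (if ph = 0 then
       if bit x r then (8 * pc, put_bit m r False x, DR) else (8 * pc + 1, put_bit m r True x, DS)
     else if bit x (m + 1) then (8 * (pc + 1), x, DS) else (8 * pc + 1, x, DL))"
| "action m (DEC r) pc ph x =
    (if ph = 0 then
       if x = 0 then (8 * pc + 1, x, DL)
       else if bit x r then
         if bit x (m + 1) then (8 * (pc + 1), put_bit m r False x, DS)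
         else (8 * pc + 3, put_bit m r False x, DL)
       else (8 * pc, x, DR)
     else if ph = 1 then
       if bit x (m + 1) then (8 * (pc + 1), x, DS) else (8 * pc + 1, x, DL)
     else
       if bit x (m + 1) then (8 * (pc + 1), put_bit m r True x, DS)
       else (8 * pc + 3, put_bit m r True x, DL))"
| "action m (JZ r a) pc ph x =
    (if ph = 0 then
       if x = 0 then (8 * pc + 2, x, DS)
       else if bit x r then (8 * pc + 1, x, DS)
       else (8 * pc, x, DR)
     else if ph = 1 then
       if bit x (m + 1) then (8 * (pc + 1), x, DS) else (8 * pc + 1, x, DL)
     else
       if bit x (m + 1) then (8 * a, x, DS) else (8 * pc + 2, x, DL))"

text \<open>Programs halt by leaving the code: address \<open>length P\<close> accepts and
  \<open>length P + 1\<close> rejects. Results of \<open>action\<close> outside the ranges are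
  replaced by 0, so that the machine is well-formed for every instruction list.\<close>

definition machine :: "nat \<Rightarrow> instr list \<Rightarrow> tm" where
  "machine m P = (let N = 8 * (length P + 2); S = 2 ^ (m + 2) in
     \<lparr>nq = N, ns = S,
      delta = (\<lambda>q x. case (if q < 8 * length P then action m (P ! (q div 8)) (q div 8) (q mod 8) x
                            else (0, 0, DS)) of
        (q', x', d) \<Rightarrow> (if q' < N then q' else 0, if x' < S then x' else 0, d)),
      qacc = 8 * length P, qrej = 8 * (length P + 1)\<rparr>)"

lemma wf_machine: "wf_tm (machine m P)"
proof -
  have "3 \<le> (2::nat) ^ (m + 2)" by (induction m) auto
  then show ?thesis
    by (auto simp: wf_tm_def machine_def Let_def split: prod.splits)
qed

fun move :: "dir \<Rightarrow> nat \<Rightarrow> nat" where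
  "move DL h = h - 1" | "move DR h = h + 1" | "move DS h = h"

lemma machine_step:
  assumes "pc < length P" "ph < 8" "t h = x" "action m (P ! pc) pc ph x = (q', x', d)"
    and "q' < 8 * (length P + 2)" "x' < 2 ^ (m + 2)"
  shows "tm_step (machine m P) (8 * pc + ph, t, h) = (q', t(h := x'), move d h)"
proof -
  have "8 * pc + ph < 8 * length P" "(8 * pc + ph) div 8 = pc" "(8 * pc + ph) mod 8 = ph"
    using assms(1,2) by auto
  then show ?thesis
    using assms(3-6) by (auto simp: tm_step_def machine_def Let_def split: dir.splits)
qed

section \<open>Runs with bounded head position\<close>

definition reach :: "tm \<Rightarrow> nat \<Rightarrow> config \<Rightarrow> config \<Rightarrow> bool" where
  "reach M B c c' \<longleftrightarrow> (\<exists>n. (tm_step M ^^ n) c = c' \<and> (\<forall>i\<le>n. chead ((tm_step M ^^ i) c) < B))"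

lemma reach_refl: "chead c < B \<Longrightarrow> reach M B c c"
  unfolding reach_def by (rule exI[of _ 0]) auto

lemma reach_trans:
  assumes "reach M B c c'" "reach M B c' c''"
  shows "reach M B c c''"
proof -
  obtain n where n: "(tm_step M ^^ n) c = c'" "\<forall>i\<le>n. chead ((tm_step M ^^ i) c) < B"
    using assms(1) by (auto simp: reach_def)
  obtain k where k: "(tm_step M ^^ k) c' = c''" "\<forall>i\<le>k. chead ((tm_step M ^^ i) c') < B"
    using assms(2) by (auto simp: reach_def)
  have add: "(tm_step M ^^ (i + n)) c = (tm_step M ^^ i) c'" for i
    using n(1) by (simp add: funpow_add)
  have "chead ((tm_step M ^^ i) c) < B" if "i \<le> k + n" for i
  proof (cases "i \<le> n")
    case False
    then have "(tm_step M ^^ i) c = (tm_step M ^^ (i - n)) c'" using add[of "i - n"] by simp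
    then show ?thesis using k(2) that False by auto
  qed (use n in auto)
  then show ?thesis unfolding reach_def using add[of k] k(1) by blast
qed

lemma reach_step:
  assumes "tm_step M c = c'" "chead c < B" "chead c' < B"
  shows "reach M B c c'"
  unfolding reach_def
  by (rule exI[of _ 1]) (use assms in \<open>auto simp: le_Suc_eq\<close>)

lemma chead_conv [simp]: "chead (q, t, h) = h"
  by (simp add: chead_def)

lemma reach_machine_step:
  assumes "pc < length P" "ph < 8" "t h = x" "action m (P ! pc) pc ph x = (q', x', d)"
    and "q' < 8 * (length P + 2)" "x' < 2 ^ (m + 2)" "h < B" "move d h < B"
  shows "reach (machine m P) B (8 * pc + ph, t, h) (q', t(h := x'), move d h)"
  using machine_step[of pc P ph t h x m q' x' d, OF assms(1-6)] assms(7,8) by (intro reach_step) auto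

text \<open>\<open>L\<close> is the length of the tape in use. Blank cells have only zero bits, so
  reaching the first blank proves that no register has a set bit further right.\<close>

definition represents :: "nat \<Rightarrow> nat \<Rightarrow> store \<Rightarrow> (nat \<Rightarrow> nat) \<Rightarrow> bool" where
  "represents m L s t \<longleftrightarrow> 0 < L \<and> (\<forall>i. t i < 2 ^ (m + 2)) \<and> (\<forall>i. t i \<noteq> 0 \<longleftrightarrow> i < L) \<and>
     (\<forall>i r. r < m \<longrightarrow> bit (t i) r = bit (s r) i) \<and> (\<forall>i. bit (t i) (m + 1) \<longleftrightarrow> i = 0)"

lemma return_phase:
  assumes pc: "pc < length P" "ph < 8" "h < B" "q' < 8 * (length P + 2)" "\<forall>i. t i < 2 ^ (m + 2)"
    and mark: "\<forall>i. bit (t i) (m + 1) \<longleftrightarrow> i = 0"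
    and act: "\<And>x. action m (P ! pc) pc ph x =
      (if bit x (m + 1) then (q', x, DS) else (8 * pc + ph, x, DL))"
  shows "reach (machine m P) B (8 * pc + ph, t, h) (q', t, 0)"
  using \<open>h < B\<close>
proof (induction h)
  case 0
  have a: "action m (P ! pc) pc ph (t 0) = (q', t 0, DS)" using mark by (simp add: act)
  show ?case
    using reach_machine_step[where t = t and h = 0, OF pc(1,2) refl a pc(4)] pc(5) 0 by auto
next
  case (Suc h)
  have a: "action m (P ! pc) pc ph (t (Suc h)) = (8 * pc + ph, t (Suc h), DL)"
    using mark by (simp add: act)
  have q: "8 * pc + ph < 8 * (length P + 2)" using pc by auto
  have "reach (machine m P) B (8 * pc + ph, t, Suc h) (8 * pc + ph, t, h)"
    using reach_machine_step[where t = t and h = "Suc h", OF pc(1,2) refl a q] pc(5) Suc by auto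
  then show ?case using Suc by (auto intro: reach_trans)
qed

lemma scan_phase:
  assumes pc: "pc < length P" "ph < 8" "j < B" "\<forall>i. t i < 2 ^ (m + 2)"
    and act: "\<And>i. i < j \<Longrightarrow> action m (P ! pc) pc ph (t i) = (8 * pc + ph, g (t i), DR)"
    and g: "\<And>i. i < j \<Longrightarrow> g (t i) < 2 ^ (m + 2)"
  shows "reach (machine m P) B (8 * pc + ph, t, 0)
           (8 * pc + ph, (\<lambda>i. if i < j then g (t i) else t i), j)"
proof -
  have "reach (machine m P) B (8 * pc + ph, t, 0)
           (8 * pc + ph, (\<lambda>i. if i < k then g (t i) else t i), k)" if "k \<le> j" for k
    using that
  proof (induction k)
    case 0
    then show ?case using pc by (auto intro: reach_refl)
  next
    case (Suc k)
    let ?t = "\<lambda>i. if i < k then g (t i) else t i"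
    have a: "action m (P ! pc) pc ph (?t k) = (8 * pc + ph, g (t k), DR)"
      using act[of k] Suc.prems by auto
    have q: "8 * pc + ph < 8 * (length P + 2)" using pc by auto
    have "reach (machine m P) B (8 * pc + ph, ?t, k) (8 * pc + ph, ?t(k := g (t k)), Suc k)"
      using reach_machine_step[where t = ?t and h = k, OF pc(1,2) refl a q] g[of k] Suc.prems pc by auto
    also have "?t(k := g (t k)) = (\<lambda>i. if i < Suc k then g (t i) else t i)"
      by auto
    finally show ?case using Suc by (auto intro: reach_trans)
  qed
  then show ?thesis by auto
qed


lemma represents_less: "represents m L s t \<Longrightarrow> t i < 2 ^ (m + 2)"
  and represents_nonblank: "represents m L s t \<Longrightarrow> t i \<noteq> 0 \<longleftrightarrow> i < L"
  and represents_bit: "represents m L s t \<Longrightarrow> r < m \<Longrightarrow> bit (t i) r = bit (s r) i"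
  and represents_mark: "represents m L s t \<Longrightarrow> bit (t i) (m + 1) \<longleftrightarrow> i = 0"
  by (auto simp: represents_def)

text \<open>\<open>A\<close> is the set of rewritten cells. It has to contain all cells from
  \<open>L\<close> up to \<open>L'\<close>, so that no blank remains inside the extended
  tape.\<close>

lemma represents_upd:
  assumes "represents m L s t" "r < m" "L \<le> L'" "\<And>i. L \<le> i \<Longrightarrow> i < L' \<Longrightarrow> i \<in> A" "\<And>i. i \<in> A \<Longrightarrow> i < L'"
    and "\<And>i. bit x i \<longleftrightarrow> (if i \<in> A then v i else bit (s r) i)"
  shows "represents m L' (s(r := x)) (\<lambda>i. if i \<in> A then put_bit m r (v i) (t i) else t i)"
  unfolding represents_def
proof (intro conjI allI impI, goal_cases)
  case 1
  then show ?case using assms(1,3) by (auto simp: represents_def)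
next
  case (2 i)
  then show ?case using assms(1,2) put_bit_less[of "t i" m r "v i"] by (auto simp: represents_def)
next
  case (3 i)
  then show ?case
  proof (cases "i \<in> A")
    case False
    then have "i < L' \<longleftrightarrow> i < L" using assms(3,4) by (meson not_less order_less_le_trans)
    then show ?thesis using False represents_nonblank[OF assms(1), of i] by simp
  qed (use assms(5) in simp)
next
  case (4 i r')
  then show ?case using represents_bit[OF assms(1)] assms(6) by (auto simp: bit_put_bit)
next
  case (5 i)
  then show ?case using represents_mark[OF assms(1), of i] assms(2) by (auto simp: bit_put_bit)
qed

lemma machine_INC:
  assumes rep: "represents m L s t" and L: "L \<le> S + 1" and pc: "pc < length P" "P ! pc = INC r"
    and r: "r < m" and bound: "s r < 2 ^ S"
  shows "\<exists>t' L'. represents m L' (s(r := Suc (s r))) t' \<and> L' \<le> S + 1 \<and>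
           reach (machine m P) (S + 2) (8 * pc, t, 0) (8 * (pc + 1), t', 0)"
proof -
  let ?M = "machine m P"
  obtain j where j: "\<forall>i<j. bit (s r) i" "\<not> bit (s r) j" using ex_low_clear_bit by blast
  \<comment> \<open>The carry stops within the available space: the ones below \<open>j\<close> give
    \<open>2 ^ j \<le> Suc (s r)\<close>, and \<open>s r < 2 ^ S\<close>.\<close>
  have "(2::nat) ^ j \<le> 2 ^ S" using power_le_Suc_if_low_bits[OF j(1)] bound by linarith
  then have jS: "j \<le> S" by simp
  let ?t1 = "\<lambda>i. if i < j then put_bit m r False (t i) else t i"
  let ?t2 = "\<lambda>i. if i \<in> {..j} then put_bit m r (i = j) (t i) else t i"
  have rep2: "represents m (max L (j + 1)) (s(r := Suc (s r))) ?t2"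
    using rep r by (rule represents_upd) (use bit_Suc_nat_cases[OF j] in auto)
  have s1: "reach ?M (S + 2) (8 * pc + 0, t, 0) (8 * pc + 0, ?t1, j)"
    by (rule scan_phase) (use pc jS represents_less[OF rep] represents_bit[OF rep r] j
        put_bit_less[OF represents_less[OF rep] r] in auto)
  have "reach ?M (S + 2) (8 * pc + 0, ?t1, j) (8 * pc + 1, ?t1(j := put_bit m r True (t j)), move DS j)"
    by (rule reach_machine_step) (use pc jS represents_bit[OF rep r] j
        put_bit_less[OF represents_less[OF rep] r] in auto)
  also have "?t1(j := put_bit m r True (t j)) = ?t2" by auto
  finally have s2: "reach ?M (S + 2) (8 * pc + 0, ?t1, j) (8 * pc + 1, ?t2, j)" by simp
  have s3: "reach ?M (S + 2) (8 * pc + 1, ?t2, j) (8 * (pc + 1), ?t2, 0)"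
    by (rule return_phase) (use pc jS represents_less[OF rep2] represents_mark[OF rep2] in auto)
  have "reach ?M (S + 2) (8 * pc, t, 0) (8 * (pc + 1), ?t2, 0)"
    using reach_trans[OF reach_trans[OF s1 s2] s3] by simp
  then show ?thesis using rep2 L jS by (intro exI[of _ ?t2] exI[of _ "max L (j + 1)"]) auto
qed

lemma machine_JZ:
  assumes rep: "represents m L s t" and L: "L \<le> S + 1" and pc: "pc < length P" "P ! pc = JZ r a"
    and r: "r < m" and a: "a < length P + 2"
  shows "reach (machine m P) (S + 2) (8 * pc, t, 0) (8 * (if s r = 0 then a else pc + 1), t, 0)"
proof -
  let ?M = "machine m P"
  have high: "\<not> bit (s r) i" if "L \<le> i" for i
    using represents_bit[OF rep r, of i] represents_nonblank[OF rep, of i] that by auto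
  show ?thesis
  proof (cases "s r = 0")
    case True
    have s1: "reach ?M (S + 2) (8 * pc + 0, t, 0) (8 * pc + 0, \<lambda>i. if i < L then t i else t i, L)"
      by (rule scan_phase) (use pc L represents_less[OF rep] represents_nonblank[OF rep]
          represents_bit[OF rep r] True in auto)
    have s2: "reach ?M (S + 2) (8 * pc + 0, t, L) (8 * pc + 2, t(L := t L), move DS L)"
      by (rule reach_machine_step)
        (use pc L represents_less[OF rep] represents_nonblank[OF rep] in auto)
    have s3: "reach ?M (S + 2) (8 * pc + 2, t, L) (8 * a, t, 0)"
      by (rule return_phase) (use pc L a represents_less[OF rep] represents_mark[OF rep] in auto)
    show ?thesis using reach_trans[OF reach_trans[of _ _ _ "(8 * pc, t, L)"] s3] s1 s2 True by simp
  next
    case False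
    obtain j where j: "\<forall>i<j. \<not> bit (s r) i" "bit (s r) j" using ex_low_set_bit[OF False] by blast
    have jL: "j < L" using high[of j] j by (meson not_less)
    have s1: "reach ?M (S + 2) (8 * pc + 0, t, 0) (8 * pc + 0, \<lambda>i. if i < j then t i else t i, j)"
      by (rule scan_phase) (use pc L jL represents_less[OF rep] represents_nonblank[OF rep]
          represents_bit[OF rep r] j in auto)
    have s2: "reach ?M (S + 2) (8 * pc + 0, t, j) (8 * pc + 1, t(j := t j), move DS j)"
      by (rule reach_machine_step)
        (use pc L jL represents_less[OF rep] represents_nonblank[OF rep] represents_bit[OF rep r] j in auto)
    have s3: "reach ?M (S + 2) (8 * pc + 1, t, j) (8 * (pc + 1), t, 0)"
      by (rule return_phase) (use pc L jL represents_less[OF rep] represents_mark[OF rep] in auto)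
    show ?thesis using reach_trans[OF reach_trans[of _ _ _ "(8 * pc, t, j)"] s3] s1 s2 False by simp
  qed
qed

lemma machine_DEC:
  assumes rep: "represents m L s t" and L: "L \<le> S + 1" and pc: "pc < length P" "P ! pc = DEC r"
    and r: "r < m"
  shows "\<exists>t' L'. represents m L' (s(r := s r - 1)) t' \<and> L' \<le> S + 1 \<and>
           reach (machine m P) (S + 2) (8 * pc, t, 0) (8 * (pc + 1), t', 0)"
proof (cases "s r = 0")
  case True
  let ?M = "machine m P"
  \<comment> \<open>Without a set bit on the track the scan runs into the first blank, and the
    register stays 0, as truncated subtraction demands.\<close>
  have s1: "reach ?M (S + 2) (8 * pc + 0, t, 0) (8 * pc + 0, \<lambda>i. if i < L then t i else t i, L)"
    by (rule scan_phase) (use pc L represents_less[OF rep] represents_nonblank[OF rep]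
        represents_bit[OF rep r] True in auto)
  have s2: "reach ?M (S + 2) (8 * pc + 0, t, L) (8 * pc + 1, t(L := t L), move DL L)"
    by (rule reach_machine_step)
      (use pc L represents_less[OF rep] represents_nonblank[OF rep] in auto)
  have s3: "reach ?M (S + 2) (8 * pc + 1, t, move DL L) (8 * (pc + 1), t, 0)"
    by (rule return_phase) (use pc L represents_less[OF rep] represents_mark[OF rep] in auto)
  have "reach ?M (S + 2) (8 * pc, t, 0) (8 * (pc + 1), t, 0)"
    using reach_trans[OF reach_trans[of _ _ _ "(8 * pc, t, L)"] s3] s1 s2 by simp
  moreover have "s(r := s r - 1) = s" using True by auto
  ultimately show ?thesis using rep L by auto
next
  case False
  let ?M = "machine m P"
  obtain j where j: "\<forall>i<j. \<not> bit (s r) i" "bit (s r) j" using ex_low_set_bit[OF False] by blast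
  have "t j \<noteq> 0" using represents_bit[OF rep r, of j] j by (metis bit_0_eq bot_apply bot_bool_def)
  then have jL: "j < L" using represents_nonblank[OF rep] by blast
  \<comment> \<open>\<open>?t k\<close> is the tape once the returning head has rewritten the cells
    from \<open>k\<close> to \<open>j\<close>: the lowest set bit, in cell \<open>j\<close>, is
    cleared and the zeros below it become ones.\<close>
  let ?t = "\<lambda>k i. if i \<in> {k..j} then put_bit m r (i < j) (t i) else t i"
  have rep2: "represents m L (s(r := s r - 1)) (?t 0)"
    using rep r by (rule represents_upd) (use bit_pred_nat_cases[OF j] jL in auto)
  note tm_less = represents_less[OF rep] put_bit_less[OF represents_less[OF rep] r]
  have s1: "reach ?M (S + 2) (8 * pc + 0, t, 0) (8 * pc + 0, \<lambda>i. if i < j then t i else t i, j)"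
    by (rule scan_phase) (use pc L jL represents_less[OF rep] represents_nonblank[OF rep]
        represents_bit[OF rep r] j in auto)
  have borrow: "reach ?M (S + 2) (8 * pc + 3, ?t (Suc k), k) (8 * (pc + 1), ?t 0, 0)" if "k < j" for k
    using that
  proof (induction k)
    case 0
    have "reach ?M (S + 2) (8 * pc + 3, ?t (Suc 0), 0)
        (8 * (pc + 1), (?t (Suc 0))(0 := put_bit m r True (t 0)), move DS 0)"
      by (rule reach_machine_step) (use pc 0 tm_less represents_mark[OF rep] in auto)
    also have "(?t (Suc 0))(0 := put_bit m r True (t 0)) = ?t 0" using 0 by (auto simp: fun_eq_iff)
    finally show ?case by simp
  next
    case (Suc k)
    have "reach ?M (S + 2) (8 * pc + 3, ?t (Suc (Suc k)), Suc k)
        (8 * pc + 3, (?t (Suc (Suc k)))(Suc k := put_bit m r True (t (Suc k))), move DL (Suc k))"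
      by (rule reach_machine_step) (use pc Suc L jL tm_less represents_mark[OF rep] in auto)
    also have "(?t (Suc (Suc k)))(Suc k := put_bit m r True (t (Suc k))) = ?t (Suc k)"
      using Suc by (auto simp: fun_eq_iff)
    finally show ?case using Suc reach_trans by simp
  qed
  have s2: "reach ?M (S + 2) (8 * pc + 0, t, j) (8 * (pc + 1), ?t 0, 0)"
  proof (cases j)
    case 0
    have "reach ?M (S + 2) (8 * pc + 0, t, 0) (8 * (pc + 1), t(0 := put_bit m r False (t 0)), move DS 0)"
      by (rule reach_machine_step)
        (use pc 0 tm_less represents_mark[OF rep] represents_nonblank[OF rep] jL
          represents_bit[OF rep r] j in auto)
    moreover have "t(0 := put_bit m r False (t 0)) = ?t 0" using 0 by (auto simp: fun_eq_iff)
    ultimately show ?thesis using 0 by simp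
  next
    case (Suc k)
    have "reach ?M (S + 2) (8 * pc + 0, t, j) (8 * pc + 3, t(j := put_bit m r False (t j)), move DL j)"
      by (rule reach_machine_step)
        (use pc Suc tm_less represents_mark[OF rep] represents_nonblank[OF rep] jL L
          represents_bit[OF rep r] j in auto)
    moreover have "t(j := put_bit m r False (t j)) = ?t (Suc k)" using Suc by (auto simp: fun_eq_iff)
    ultimately have "reach ?M (S + 2) (8 * pc + 0, t, j) (8 * pc + 3, ?t (Suc k), k)" using Suc by simp
    then show ?thesis using borrow[of k] Suc reach_trans by blast
  qed
  have "reach ?M (S + 2) (8 * pc, t, 0) (8 * (pc + 1), ?t 0, 0)"
    using reach_trans[of _ _ _ "(8 * pc, t, j)"] s1 s2 by simp
  then show ?thesis using rep2 L by blast
qed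

lemma machine_JMP:
  assumes rep: "represents m L s t" and pc: "pc < length P" "P ! pc = JMP a" and a: "a < length P + 2"
  shows "reach (machine m P) (S + 2) (8 * pc, t, 0) (8 * a, t, 0)"
proof -
  have "reach (machine m P) (S + 2) (8 * pc + 0, t, 0) (8 * a, t(0 := t 0), move DS 0)"
    by (rule reach_machine_step) (use assms represents_less[OF rep] in auto)
  then show ?thesis by simp
qed

section \<open>From executions of programs to runs of the machine\<close>

definition code_at :: "instr list \<Rightarrow> nat \<Rightarrow> instr list \<Rightarrow> bool" where
  "code_at P a Q \<longleftrightarrow> (\<exists>P1 P2. P = P1 @ Q @ P2 \<and> length P1 = a)"

lemma code_at_append: "code_at P a (Q1 @ Q2) \<longleftrightarrow> code_at P a Q1 \<and> code_at P (a + length Q1) Q2"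
proof
  assume "code_at P a (Q1 @ Q2)"
  then obtain P1 P2 where P: "P = P1 @ (Q1 @ Q2) @ P2" "length P1 = a" by (auto simp: code_at_def)
  have "P = P1 @ Q1 @ (Q2 @ P2)" "P = (P1 @ Q1) @ Q2 @ P2" "length (P1 @ Q1) = a + length Q1"
    using P by auto
  then show "code_at P a Q1 \<and> code_at P (a + length Q1) Q2"
    unfolding code_at_def using P(2) by blast
next
  assume "code_at P a Q1 \<and> code_at P (a + length Q1) Q2"
  then obtain P1 P2 R1 R2 where P: "P = P1 @ Q1 @ P2" "length P1 = a"
    "P = R1 @ Q2 @ R2" "length R1 = a + length Q1" unfolding code_at_def by blast
  then have "R1 = P1 @ Q1"
    by (metis append.assoc append_eq_append_conv length_append)
  then show "code_at P a (Q1 @ Q2)" using P unfolding code_at_def by auto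
qed

lemma code_at_Cons: "code_at P a (x # Q) \<longleftrightarrow> a < length P \<and> P ! a = x \<and> code_at P (a + 1) Q"
proof -
  have "code_at P a [x] \<longleftrightarrow> a < length P \<and> P ! a = x"
  proof
    assume "a < length P \<and> P ! a = x"
    then have "P = take a P @ [x] @ drop (Suc a) P" "length (take a P) = a"
      by (auto simp: id_take_nth_drop)
    then show "code_at P a [x]" unfolding code_at_def by blast
  qed (auto simp: code_at_def)
  then show ?thesis using code_at_append[of P a "[x]" Q] by simp
qed

lemma code_at_le: "code_at P a Q \<Longrightarrow> a + length Q \<le> length P"
  by (auto simp: code_at_def)

text \<open>Contents up to \<open>2 ^ S\<close> occupy at most \<open>S + 1\<close> cells, and
  looking for the first blank visits one cell more; hence the head bound
  \<open>S + 2\<close>.\<close>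

lemma machine_simulates_exec:
  assumes "exec (2 ^ S) p s s'" and "code_at P a (compile p a)" and "regs p \<subseteq> {..<m}"
    and "represents m L s t" and "L \<le> S + 1"
  shows "\<exists>t' L'. represents m L' s' t' \<and> L' \<le> S + 1 \<and>
           reach (machine m P) (S + 2) (8 * a, t, 0) (8 * (a + clen p), t', 0)"
  using assms
proof (induction arbitrary: a t L rule: exec.induct)
  case (Inc s r)
  then have "a < length P" "P ! a = INC r" "r < m" by (auto simp: code_at_Cons)
  then show ?case using machine_INC[of m L s t S a P r] Inc by (simp add: fun_upd_def)
next
  case (Dec r s)
  then have "a < length P" "P ! a = DEC r" "r < m" by (auto simp: code_at_Cons)
  then show ?case using machine_DEC[of m L s t S a P r] Dec by (simp add: fun_upd_def)
next
  case (Seq p s s1 q s2)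
  from Seq.prems obtain t1 L1 where 1: "represents m L1 s1 t1" "L1 \<le> S + 1"
    "reach (machine m P) (S + 2) (8 * a, t, 0) (8 * (a + clen p), t1, 0)"
    using Seq.IH(1)[of a L t] by (auto simp: code_at_append)
  from Seq.prems obtain t2 L2 where 2: "represents m L2 s2 t2" "L2 \<le> S + 1"
    "reach (machine m P) (S + 2) (8 * (a + clen p), t1, 0) (8 * (a + clen p + clen q), t2, 0)"
    using Seq.IH(2)[of "a + clen p" L1 t1] 1 by (auto simp: code_at_append)
  show ?case using 2(1,2) reach_trans[OF 1(3) 2(3)] by (auto simp: add.assoc)
next
  case (WhileF s r p)
  have "a + clen p + 2 < length P + 2"
    using code_at_le[OF WhileF.prems(1)] by simp
  then show ?case
    using machine_JZ[of m L s t S a P r "a + clen p + 2"] WhileF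
    by (intro exI[of _ t] exI[of _ L]) (auto simp: code_at_Cons add.assoc)
next
  case (WhileT s r p s1 s2)
  have le: "a + clen p + 2 < length P + 2" "a < length P + 2"
    using code_at_le[OF WhileT.prems(1)] by auto
  have code: "code_at P (a + 1) (compile p (a + 1))" "a + 1 + clen p < length P" "P ! (a + 1 + clen p) = JMP a"
    using WhileT.prems(1) by (auto simp: code_at_Cons code_at_append)
  have 0: "reach (machine m P) (S + 2) (8 * a, t, 0) (8 * (a + 1), t, 0)"
    using machine_JZ[of m L s t S a P r "a + clen p + 2"] WhileT le by (auto simp: code_at_Cons)
  obtain t1 L1 where 1: "represents m L1 s1 t1" "L1 \<le> S + 1"
    "reach (machine m P) (S + 2) (8 * (a + 1), t, 0) (8 * (a + 1 + clen p), t1, 0)"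
    using WhileT.IH(1)[of "a + 1" L t] WhileT.prems code by auto
  have 2: "reach (machine m P) (S + 2) (8 * (a + 1 + clen p), t1, 0) (8 * a, t1, 0)"
    using machine_JMP[OF 1(1) code(2,3) le(2)] .
  obtain t2 L2 where 3: "represents m L2 s2 t2" "L2 \<le> S + 1"
    "reach (machine m P) (S + 2) (8 * a, t1, 0) (8 * (a + clen (While r p)), t2, 0)"
    using WhileT.IH(2)[OF WhileT.prems(1,2) 1(1,2)] by auto
  show ?case
    using 3(1,2) reach_trans[OF 0 reach_trans[OF 1(3) reach_trans[OF 2 3(3)]]] by blast
qed

lemma exec_mono: "exec b p s s' \<Longrightarrow> b \<le> b' \<Longrightarrow> exec b' p s s'"
  by (induction rule: exec.induct) (auto intro: exec.intros exec.Dec[simplified])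

section \<open>Words as numbers, and PSPACE from bounded programs\<close>

definition num :: "bool list \<Rightarrow> nat" where
  "num w = horner_sum of_bool 2 w"

lemma bit_num: "bit (num w) i \<longleftrightarrow> i < length w \<and> w ! i"
  by (auto simp: num_def bit_horner_sum_bit_iff)

lemma num_Nil [simp]: "num [] = 0"
  and num_Cons [simp]: "num (x # w) = of_bool x + 2 * num w"
  by (simp_all add: num_def)

lemma num_append: "num (v @ w) = num v + 2 ^ length v * num w"
  by (simp add: num_def horner_sum_append)

lemma num_less: "num w < 2 ^ length w"
  by (simp add: num_def horner_sum_of_bool_2_less)

lemma num_inject: "length v = length w \<Longrightarrow> num v = num w \<Longrightarrow> v = w"
  by (auto simp: list_eq_iff_nth_eq) (metis bit_num)+

lemma num_map_Not: "num (map Not w) + num w + 1 = 2 ^ length w"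
  by (induction w) auto

definition input_store :: "bool list \<Rightarrow> store" where
  "input_store w r = (if r = 0 then num (map Not w) else if r = 1 then num w else 0)"

lemma halted: "cstate c \<in> {qacc M, qrej M} \<Longrightarrow> (tm_step M ^^ n) c = c"
  by (induction n) (auto simp: tm_step_def cstate_def split: prod.splits)

text \<open>A halted configuration is a fixed point of \<open>tm_step\<close>, so a single bounded
  run into the right halting state settles all later times.\<close>

lemma decides_in_space_if_reach:
  assumes "qacc M \<noteq> qrej M"
    and "\<And>w. \<exists>t. reach M (B (length w)) (tm_init w) (if w \<in> L then qacc M else qrej M, t, 0)"
    and "\<And>n. B n \<le> s n"
  shows "decides_in_space M L s"
  unfolding decides_in_space_def
proof (intro allI conjI)
  fix w
  obtain t where "reach M (B (length w)) (tm_init w) (if w \<in> L then qacc M else qrej M, t, 0)"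
    using assms(2) by blast
  then obtain N where N: "tm_run M w N = (if w \<in> L then qacc M else qrej M, t, 0)"
    and B: "\<And>i. i \<le> N \<Longrightarrow> chead (tm_run M w i) < B (length w)"
    by (auto simp: reach_def tm_run_def)
  have late: "tm_run M w n = tm_run M w N" if "N \<le> n" for n
  proof -
    have "tm_run M w n = (tm_step M ^^ (n - N)) (tm_run M w N)"
      using that by (simp add: tm_run_def flip: funpow_add[THEN fun_cong, simplified])
    then show ?thesis using N halted[of "tm_run M w N" M "n - N"] by (simp add: cstate_def)
  qed
  show "\<exists>n. cstate (tm_run M w n) \<in> {qacc M, qrej M}"
    using N by (intro exI[of _ N]) (auto simp: cstate_def)
  show "chead (tm_run M w n) < s (length w)" for n
    using B[of "min n N"] late[of n] assms(3)[of "length w"] by (cases "n \<le> N") (auto simp: min_def)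
  show "w \<in> L \<longleftrightarrow> (\<exists>n. cstate (tm_run M w n) = qacc M)"
  proof
    assume "\<exists>n. cstate (tm_run M w n) = qacc M"
    then obtain n where n: "cstate (tm_run M w n) = qacc M" by blast
    have "tm_run M w (max n N) = (tm_step M ^^ (max n N - n)) (tm_run M w n)"
      by (simp add: tm_run_def flip: funpow_add[THEN fun_cong, simplified])
    then have "cstate (tm_run M w N) = qacc M"
      using halted[of "tm_run M w n" M] n late[of "max n N"] by simp
    then show "w \<in> L" using N assms(1) by (auto simp: cstate_def split: if_splits)
  qed (use N in \<open>auto simp: cstate_def intro!: exI[of _ N]\<close>)
qed

lemma exec_imp_PSPACE:
  assumes "\<And>w. \<exists>s. exec (2 ^ (length w + 2) ^ c) p (input_store w) s \<and> (s r \<noteq> 0 \<longleftrightarrow> w \<in> L)"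
  shows "L \<in> PSPACE"
proof -
  define m where "m = Suc (Max (insert r (insert 1 (regs p))))"
  have fin: "finite (insert r (insert 1 (regs p)))" using finite_regs by simp
  have m: "regs p \<subseteq> {..<m}" "r < m" "1 < m"
    unfolding m_def using Max_ge[OF fin] by (force simp: less_Suc_eq_le)+
  \<comment> \<open>Address 0 writes the marks. The final test falls through to
    \<open>clen p + 2\<close>, which is \<open>length P\<close> and accepts, or jumps to
    \<open>clen p + 3\<close>, which rejects.\<close>
  define P where "P = MARK # compile p 1 @ [JZ r (clen p + 3)]"
  define M where "M = machine m P"
  have P: "length P = clen p + 2" "P ! 0 = MARK" "P ! (clen p + 1) = JZ r (clen p + 3)"
    "code_at P 1 (compile p 1)"
  proof -
    have "code_at P 0 P" by (auto simp: code_at_def)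
    then show "code_at P 1 (compile p 1)" "P ! (clen p + 1) = JZ r (clen p + 3)"
      by (auto simp: P_def code_at_Cons code_at_append)
  qed (auto simp: P_def)
  have "\<exists>t. reach M ((length w + 2) ^ Suc c + 2) (tm_init w)
          (if w \<in> L then qacc M else qrej M, t, 0)" for w
  proof -
    \<comment> \<open>The exponent is \<open>Suc c\<close> because the space has to cover the input
      even when \<open>c\<close> is 0.\<close>
    define S where "S = (length w + 2) ^ Suc c"
    have S: "length w < S"
    proof -
      have "length w + 2 \<le> (length w + 2) ^ Suc c" by (rule self_le_power) auto
      then show ?thesis by (simp add: S_def del: power_Suc)
    qed
    obtain s where s: "exec (2 ^ (length w + 2) ^ c) p (input_store w) s" "s r \<noteq> 0 \<longleftrightarrow> w \<in> L"
      using assms by blast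
    have ex: "exec (2 ^ S) p (input_store w) s"
      by (rule exec_mono[OF s(1)]) (simp add: S_def)
    define t0 where "t0 = fst (snd (tm_init w))"
    define t1 where "t1 = t0(0 := set_bit (m + 1) (set_bit m (t0 0)))"
    have init: "tm_init w = (8 * 0 + 0, t0, 0)" by (simp add: t0_def tm_init_def)
    have t0: "t0 i = (if i < length w then if w ! i then 2 else 1 else 0)" for i
      by (simp add: t0_def tm_init_def)
    have bit2: "bit (2::nat) i \<longleftrightarrow> i = 1" for i
      using bit_exp_iff[where 'a = nat, of 1 i] by auto
    have bit1: "bit (Suc 0) i \<longleftrightarrow> i = 0" for i
      by (simp add: bit_Suc_0_iff)
    have bt0: "bit (t0 i) j \<longleftrightarrow> i < length w \<and> (if w ! i then j = 1 else j = 0)" for i j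
      by (simp add: t0 bit2 bit1)
    have bt1: "bit (t1 i) j \<longleftrightarrow> bit (t0 i) j \<or> i = 0 \<and> (j = m \<or> j = m + 1)" for i j
      by (auto simp: t1_def bit_set_bit_iff)
    have t1_less: "t1 i < 2 ^ (m + 2)" for i
      by (rule less_power_if_no_high_bits) (use m in \<open>auto simp: bt1 bt0\<close>)
    \<comment> \<open>The marks make cell 0 nonblank even for the empty word, hence
      \<open>max 1\<close>.\<close>
    have rep1: "represents m (max 1 (length w)) (input_store w) t1"
      unfolding represents_def
    proof (intro conjI allI impI)
      fix i
      show "t1 i < 2 ^ (m + 2)" by fact
      show "t1 i \<noteq> 0 \<longleftrightarrow> i < max 1 (length w)"
      proof (cases "i = 0")
        case True
        then show ?thesis using bt1[of 0 m] by (metis bit_0_eq bot_apply bot_bool_def less_max_iff_disj zero_less_one)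
      qed (auto simp: t1_def t0)
      show "bit (t1 i) (m + 1) \<longleftrightarrow> i = 0" using m by (auto simp: bt1 bt0)
      fix r' assume "r' < m"
      then show "bit (t1 i) r' = bit (input_store w r') i"
        by (auto simp: bt1 bt0 input_store_def bit_num)
    qed simp
    have "max 1 (length w) \<le> S + 1" using S by simp
    from machine_simulates_exec[OF ex P(4) m(1) rep1 this]
    obtain t2 L2 where t2: "represents m L2 s t2" "L2 \<le> S + 1"
      "reach M (S + 2) (8 * 1, t1, 0) (8 * (1 + clen p), t2, 0)"
      unfolding M_def by blast
    have "reach M (S + 2) (8 * 0 + 0, t0, 0) (8 * 1, t0(0 := set_bit (m + 1) (set_bit m (t0 0))), move DS 0)"
      unfolding M_def by (rule reach_machine_step[OF _ _ refl]) (use P t1_less[of 0] in \<open>auto simp: t1_def\<close>)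
    then have r1: "reach M (S + 2) (tm_init w) (8 * 1, t1, 0)" by (simp add: init t1_def)
    have r3: "reach M (S + 2) (8 * (1 + clen p), t2, 0) (if w \<in> L then qacc M else qrej M, t2, 0)"
    proof -
      have "qacc M = 8 * (clen p + 2)" "qrej M = 8 * (clen p + 3)"
        by (simp_all add: M_def machine_def Let_def P)
      then show ?thesis
        using machine_JZ[OF t2(1,2), of "clen p + 1" P r "clen p + 3"] P m s(2) unfolding M_def
        by (auto simp: add.commute)
    qed
    show ?thesis using reach_trans[OF r1 reach_trans[OF t2(3) r3]] unfolding S_def by blast
  qed
  then have "decides_in_space M L (\<lambda>n. (2 ^ Suc c + 2) * (n + 1) ^ Suc c)"
  proof (rule decides_in_space_if_reach[rotated])
    fix n :: nat
    have "(n + 2) ^ Suc c \<le> (2 * (n + 1)) ^ Suc c" by (rule power_mono) auto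
    then have "(n + 2) ^ Suc c \<le> 2 ^ Suc c * (n + 1) ^ Suc c" by (simp only: power_mult_distrib)
    moreover have "1 \<le> (n + 1) ^ Suc c" by (rule one_le_power) simp
    ultimately have "(n + 2) ^ Suc c + 2 \<le> 2 ^ Suc c * (n + 1) ^ Suc c + 2 * (n + 1) ^ Suc c"
      by linarith
    then show "(n + 2) ^ Suc c + 2 \<le> (2 ^ Suc c + 2) * (n + 1) ^ Suc c"
      by (simp only: distrib_right)
  qed (simp add: M_def machine_def Let_def)
  then show ?thesis unfolding PSPACE_def using wf_machine M_def by blast
qed


section \<open>Functions computable in polynomial space\<close>

text \<open>The values have length polynomial in a common bound \<open>l\<close> on the lengths of
  the variables. The base \<open>l + 2\<close> is at least 2, so raising \<open>c\<close> absorbs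
  constant factors even for \<open>l = 0\<close>.\<close>

definition quasi_bounded :: "(store \<Rightarrow> nat) \<Rightarrow> bool" where
  "quasi_bounded f \<longleftrightarrow> (\<exists>c. \<forall>e l. (\<forall>i. e i \<le> 2 ^ l) \<longrightarrow> f e \<le> 2 ^ (l + 2) ^ c)"

lemma quasi_boundedE:
  assumes "quasi_bounded f"
  obtains c where "\<And>e l. \<forall>i. e i \<le> 2 ^ l \<Longrightarrow> f e \<le> 2 ^ (l + 2) ^ c"
  using assms unfolding quasi_bounded_def by blast

lemma exponent_mono: "c \<le> d \<Longrightarrow> (2::nat) ^ (l + 2) ^ c \<le> 2 ^ (l + 2) ^ d"
  by (intro power_increasing) auto

text \<open>Bounds compose: this is the exponent obtained when values of length
  \<open>(l + 2) ^ c\<close> are fed into a function with exponent \<open>d\<close>. The 2 in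
  \<open>c + 2\<close> pays for the inner \<open>+ 2\<close>, because \<open>(l + 2) ^ 2\<close> is
  at least 4.\<close>

lemma exponent_comp: "((l + 2) ^ c + 2) ^ d \<le> ((l::nat) + 2) ^ ((c + 2) * d)"
proof -
  have "(2::nat) ^ 2 \<le> (l + 2) ^ 2" by (rule power_mono) auto
  then have "(l + 2) ^ c * 4 \<le> (l + 2) ^ c * (l + 2) ^ 2" by (intro mult_le_mono2) simp
  moreover have "1 \<le> (l + 2) ^ c" by (rule one_le_power) simp
  ultimately have "(l + 2) ^ c + 2 \<le> (l + 2) ^ c * (l + 2) ^ 2" by linarith
  then have "(l + 2) ^ c + 2 \<le> (l + 2) ^ (c + 2)" by (simp only: power_add)
  then have "((l + 2) ^ c + 2) ^ d \<le> ((l + 2) ^ (c + 2)) ^ d" by (rule power_mono) simp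
  then show ?thesis by (simp only: power_mult)
qed

lemma exponent_ge: "2 ^ l \<le> (2::nat) ^ (l + 2) ^ Suc c"
proof -
  have "l + 2 \<le> (l + 2) ^ Suc c" by (rule self_le_power) auto
  then show ?thesis by (intro power_increasing) auto
qed

lemma quasi_bounded_mono: "quasi_bounded g \<Longrightarrow> (\<And>e. f e \<le> g e) \<Longrightarrow> quasi_bounded f"
  unfolding quasi_bounded_def by (meson order_trans)

lemma quasi_bounded_const: "quasi_bounded (\<lambda>e. k)"
proof -
  have "k \<le> 2 ^ (l + 2) ^ k" for l :: nat
  proof -
    have "k \<le> 2 ^ k" by (simp add: less_imp_le)
    also have "\<dots> \<le> (l + 2) ^ k" by (rule power_mono) auto
    also have "\<dots> \<le> 2 ^ (l + 2) ^ k" by (simp add: less_imp_le)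
    finally show ?thesis .
  qed
  then show ?thesis unfolding quasi_bounded_def by blast
qed

lemma quasi_bounded_var: "quasi_bounded (\<lambda>e. e n)"
  unfolding quasi_bounded_def
proof (intro exI[of _ "Suc 0"] allI impI)
  fix e :: store and l assume "\<forall>i. e i \<le> 2 ^ l"
  then show "e n \<le> 2 ^ (l + 2) ^ Suc 0" using exponent_ge[of l 0] by (meson order_trans)
qed

lemma quasi_bounded_mult:
  assumes "quasi_bounded f" "quasi_bounded g"
  shows "quasi_bounded (\<lambda>e. f e * g e)"
proof -
  obtain c where c: "\<And>e l. \<forall>i. e i \<le> 2 ^ l \<Longrightarrow> f e \<le> 2 ^ (l + 2) ^ c"
    by (rule quasi_boundedE[OF assms(1)]) blast
  obtain d where d: "\<And>e l. \<forall>i. e i \<le> 2 ^ l \<Longrightarrow> g e \<le> 2 ^ (l + 2) ^ d"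
    by (rule quasi_boundedE[OF assms(2)]) blast
  have "f e * g e \<le> 2 ^ (l + 2) ^ (max c d + 1)" if "\<forall>i. e i \<le> 2 ^ l" for e l
  proof -
    have fg: "f e \<le> 2 ^ (l + 2) ^ max c d" "g e \<le> 2 ^ (l + 2) ^ max c d"
      by (rule order_trans[OF c[OF that] exponent_mono], simp)
        (rule order_trans[OF d[OF that] exponent_mono], simp)
    then have "f e * g e \<le> 2 ^ (l + 2) ^ max c d * 2 ^ (l + 2) ^ max c d" by (rule mult_le_mono)
    also have "\<dots> = 2 ^ (2 * (l + 2) ^ max c d)" by (simp only: mult_2 power_add)
    also have "\<dots> \<le> 2 ^ (l + 2) ^ (max c d + 1)" by (intro power_increasing) auto
    finally show ?thesis .
  qed
  then show ?thesis unfolding quasi_bounded_def by blast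
qed

lemma quasi_bounded_add:
  assumes "quasi_bounded f" "quasi_bounded g"
  shows "quasi_bounded (\<lambda>e. f e + g e)"
proof -
  obtain c where c: "\<And>e l. \<forall>i. e i \<le> 2 ^ l \<Longrightarrow> f e \<le> 2 ^ (l + 2) ^ c"
    by (rule quasi_boundedE[OF assms(1)]) blast
  obtain d where d: "\<And>e l. \<forall>i. e i \<le> 2 ^ l \<Longrightarrow> g e \<le> 2 ^ (l + 2) ^ d"
    by (rule quasi_boundedE[OF assms(2)]) blast
  have "f e + g e \<le> 2 ^ (l + 2) ^ (max c d + 1)" if "\<forall>i. e i \<le> 2 ^ l" for e l
  proof -
    have fg: "f e \<le> 2 ^ (l + 2) ^ max c d" "g e \<le> 2 ^ (l + 2) ^ max c d"
      by (rule order_trans[OF c[OF that] exponent_mono], simp)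
        (rule order_trans[OF d[OF that] exponent_mono], simp)
    then have "f e + g e \<le> 2 ^ (l + 2) ^ max c d + 2 ^ (l + 2) ^ max c d" by (rule add_mono)
    also have "\<dots> = 2 ^ ((l + 2) ^ max c d + 1)" by (simp only: power_add mult_2_right power_one_right)
    also have "\<dots> \<le> 2 ^ (l + 2) ^ (max c d + 1)"
    proof (intro power_increasing)
      have "1 \<le> (l + 2) ^ max c d" by (rule one_le_power) simp
      then have "(l + 2) ^ max c d + 1 \<le> (l + 2) ^ max c d * 2" by simp
      also have "\<dots> \<le> (l + 2) ^ max c d * (l + 2)" by (intro mult_le_mono2) simp
      finally show "(l + 2) ^ max c d + 1 \<le> (l + 2) ^ (max c d + 1)"
        by (simp only: power_add power_one_right)
    qed simp
    finally show ?thesis .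
  qed
  then show ?thesis unfolding quasi_bounded_def by blast
qed

text \<open>Binding in de Bruijn style: \<open>h\<close> is judged in the environment
  \<open>case_nat (a e) e\<close>, where variable 0 is the bound value and the others are shifted.
  All later rules with binders have this form.\<close>

lemma quasi_bounded_let:
  assumes "quasi_bounded (\<lambda>e. h (e 0) (\<lambda>i. e (Suc i)))" "quasi_bounded a"
  shows "quasi_bounded (\<lambda>e. h (a e) e)"
proof -
  obtain c where c: "\<And>e l. \<forall>i. e i \<le> 2 ^ l \<Longrightarrow> h (e 0) (\<lambda>i. e (Suc i)) \<le> 2 ^ (l + 2) ^ c"
    by (rule quasi_boundedE[OF assms(1)]) blast
  obtain d where d: "\<And>e l. \<forall>i. e i \<le> 2 ^ l \<Longrightarrow> a e \<le> 2 ^ (l + 2) ^ d"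
    by (rule quasi_boundedE[OF assms(2)]) blast
  have "h (a e) e \<le> 2 ^ (l + 2) ^ ((Suc d + 2) * c)" if e: "\<forall>i. e i \<le> 2 ^ l" for e l
  proof -
    have "a e \<le> 2 ^ (l + 2) ^ Suc d" using d[OF e] exponent_mono[of d "Suc d" l] by linarith
    moreover have "e i \<le> 2 ^ (l + 2) ^ Suc d" for i using e exponent_ge[of l d] by (meson order_trans)
    ultimately have "case_nat (a e) e i \<le> 2 ^ (l + 2) ^ Suc d" for i by (cases i) auto
    then have "\<forall>i. case_nat (a e) e i \<le> 2 ^ (l + 2) ^ Suc d" by blast
    from c[OF this] have "h (a e) e \<le> 2 ^ ((l + 2) ^ Suc d + 2) ^ c" by simp
    also have "\<dots> \<le> 2 ^ (l + 2) ^ ((Suc d + 2) * c)"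
      by (intro power_increasing exponent_comp) simp
    finally show ?thesis .
  qed
  then show ?thesis unfolding quasi_bounded_def by blast
qed

lemma quasi_bounded_rename: "quasi_bounded f \<Longrightarrow> quasi_bounded (\<lambda>e. f (\<lambda>i. e (\<pi> i)))"
  unfolding quasi_bounded_def
proof (elim exE)
  fix c assume "\<forall>e l. (\<forall>i. e i \<le> 2 ^ l) \<longrightarrow> f e \<le> 2 ^ (l + 2) ^ c"
  then have "\<forall>e l. (\<forall>i. e i \<le> 2 ^ l) \<longrightarrow> f (\<lambda>i. e (\<pi> i)) \<le> 2 ^ (l + 2) ^ c" by simp
  then show "\<exists>c. \<forall>e l. (\<forall>i. e i \<le> 2 ^ l) \<longrightarrow> f (\<lambda>i. e (\<pi> i)) \<le> 2 ^ (l + 2) ^ c" ..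
qed

text \<open>The program may use the registers from \<open>m\<close> on, which it finds cleared and, except for the
  result in \<open>m\<close>, leaves cleared. Quantifying over the placement \<open>\<rho>\<close> of the variables
  makes renaming of variables trivial.\<close>

definition computes :: "(nat \<Rightarrow> nat) \<Rightarrow> nat \<Rightarrow> (store \<Rightarrow> nat) \<Rightarrow> com \<Rightarrow> nat \<Rightarrow> bool" where
  "computes \<rho> m f p c \<longleftrightarrow> (\<forall>s l. (\<forall>r<m. s r \<le> 2 ^ l) \<longrightarrow> (\<forall>r\<ge>m. s r = 0) \<longrightarrow>
     exec (2 ^ (l + 2) ^ c) p s (s(m := f (\<lambda>i. s (\<rho> i)))))"

definition PS :: "(store \<Rightarrow> nat) \<Rightarrow> bool" where
  "PS f \<longleftrightarrow> quasi_bounded f \<and> (\<forall>\<rho> m. (\<forall>i. \<rho> i < m) \<longrightarrow> (\<exists>p c. computes \<rho> m f p c))"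

lemma PS_bounded: "PS f \<Longrightarrow> quasi_bounded f"
  by (simp add: PS_def)

lemma PS_computes: "PS f \<Longrightarrow> \<forall>i. \<rho> i < m \<Longrightarrow> \<exists>p c. computes \<rho> m f p c"
  by (auto simp: PS_def)

lemma computesD:
  assumes "computes \<rho> m f p c" "\<And>r. r < m \<Longrightarrow> s r \<le> 2 ^ l" "\<And>r. m \<le> r \<Longrightarrow> s r = 0"
    and "s' = s(m := f (\<lambda>i. s (\<rho> i)))" "2 ^ (l + 2) ^ c \<le> b"
  shows "exec b p s s'"
  using assms exec_mono unfolding computes_def by blast

lemma PS_rename: "PS f \<Longrightarrow> PS (\<lambda>e. f (\<lambda>i. e (\<pi> i)))"
  unfolding PS_def computes_def using quasi_bounded_rename[of f \<pi>] by simp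

section \<open>Composition and bounded recursion\<close>

text \<open>Loops are verified by exhibiting the whole trace: \<open>st i\<close> is the store after
  \<open>i\<close> rounds.\<close>

lemma exec_While_chain:
  assumes "st 0 = s" "st n = s'" "st n r = 0"
    and "\<And>i. i < n \<Longrightarrow> st i r \<noteq> 0 \<and> exec b p (st i) (st (Suc i))"
  shows "exec b (While r p) s s'"
proof -
  have "exec b (While r p) (st (n - k)) (st n)" if "k \<le> n" for k
    using that
  proof (induction k)
    case (Suc k)
    then have "Suc (n - Suc k) = n - k" "n - Suc k < n" by simp_all
    then have step: "st (n - Suc k) r \<noteq> 0" "exec b p (st (n - Suc k)) (st (n - k))"
      using assms(4)[of "n - Suc k"] by simp_all
    show ?case by (rule exec.WhileT[OF step]) (use Suc in simp)
  qed (use assms(3) in \<open>auto intro: exec.WhileF\<close>)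
  from this[of n] show ?thesis using assms(1,2) by simp
qed

definition "clear r = While r (Dec r)"
definition "transfer x y = While x (Seq (Dec x) (Inc y))"

lemma exec_Inc: "s r < b \<Longrightarrow> s' = s(r := Suc (s r)) \<Longrightarrow> exec b (Inc r) s s'"
  by (simp add: exec.Inc)

lemma exec_Dec: "s' = s(r := s r - 1) \<Longrightarrow> exec b (Dec r) s s'"
  by (simp only: exec.Dec)

lemma exec_clear: "s' = s(r := 0) \<Longrightarrow> exec b (clear r) s s'"
  unfolding clear_def
  by (rule exec_While_chain[where st = "\<lambda>i. s(r := s r - i)" and n = "s r"])
    (auto intro!: exec_Dec)

lemma exec_transfer:
  assumes "x \<noteq> y" "s x + s y \<le> b" "s' = s(x := 0, y := s x + s y)"
  shows "exec b (transfer x y) s s'"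
  unfolding transfer_def
proof (rule exec_While_chain[where st = "\<lambda>i. s(x := s x - i, y := s y + i)" and n = "s x"])
  fix i assume i: "i < s x"
  let ?s = "\<lambda>i. s(x := s x - i, y := s y + i)"
  have "exec b (Dec x) (?s i) ((?s i)(x := s x - Suc i))"
    by (rule exec_Dec) (use assms in auto)
  moreover have "exec b (Inc y) ((?s i)(x := s x - Suc i)) (?s (Suc i))"
    by (rule exec_Inc) (use i assms in auto)
  ultimately show "?s i x \<noteq> 0 \<and> exec b (Seq (Dec x) (Inc y)) (?s i) (?s (Suc i))"
    using i assms by (auto intro: exec.Seq)
qed (use assms in auto)

lemma PS_zero: "PS (\<lambda>e. 0)"
proof -
  \<comment> \<open>The register \<open>m\<close> is found cleared, so \<open>Dec m\<close> acts as
    a skip.\<close>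
  have "computes \<rho> m (\<lambda>e. 0) (Dec m) 0" for \<rho> m
    unfolding computes_def by (auto intro!: exec_Dec)
  then show ?thesis using quasi_bounded_const[of 0] unfolding PS_def by blast
qed

lemma PS_Suc:
  assumes "PS f" shows "PS (\<lambda>e. Suc (f e))"
proof -
  have "quasi_bounded (\<lambda>e. f e + 1)"
    using assms by (intro quasi_bounded_add PS_bounded quasi_bounded_const)
  then have Q: "quasi_bounded (\<lambda>e. Suc (f e))" by simp
  have "\<exists>p c. computes \<rho> m (\<lambda>e. Suc (f e)) p c" if \<rho>: "\<forall>i. \<rho> i < m" for \<rho> m
  proof -
    obtain p c where p: "computes \<rho> m f p c" using PS_computes[OF assms \<rho>] by blast
    obtain d where d: "\<And>e l. \<forall>i. e i \<le> 2 ^ l \<Longrightarrow> Suc (f e) \<le> 2 ^ (l + 2) ^ d"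
      by (rule quasi_boundedE[OF Q]) blast
    have "computes \<rho> m (\<lambda>e. Suc (f e)) (Seq p (Inc m)) (max c d)"
      unfolding computes_def
    proof (intro allI impI)
      fix s :: store and l
      assume s: "\<forall>r<m. s r \<le> 2 ^ l" "\<forall>r\<ge>m. s r = 0"
      let ?b = "2 ^ (l + 2) ^ max c d"
      have "exec ?b p s (s(m := f (\<lambda>i. s (\<rho> i))))"
        by (rule computesD[OF p _ _ refl exponent_mono]) (use s in auto)
      moreover have "Suc (f (\<lambda>i. s (\<rho> i))) \<le> ?b"
        using s \<rho> order_trans[OF d[of "\<lambda>i. s (\<rho> i)" l] exponent_mono[of d "max c d" l]] by simp
      then have "exec ?b (Inc m) (s(m := f (\<lambda>i. s (\<rho> i)))) (s(m := Suc (f (\<lambda>i. s (\<rho> i)))))"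
        by (intro exec_Inc) auto
      ultimately show "exec ?b (Seq p (Inc m)) s (s(m := Suc (f (\<lambda>i. s (\<rho> i)))))"
        by (rule exec.Seq)
    qed
    then show ?thesis by blast
  qed
  then show ?thesis using Q by (simp add: PS_def)
qed

lemma PS_var: "PS (\<lambda>e. e n)"
proof -
  \<comment> \<open>Reading a register by counting destroys it. So its value is moved to
    \<open>m\<close> and \<open>m + 1\<close> simultaneously and then restored from
    \<open>m + 1\<close>.\<close>
  have "computes \<rho> m (\<lambda>e. e n)
      (Seq (While (\<rho> n) (Seq (Dec (\<rho> n)) (Seq (Inc m) (Inc (m + 1))))) (transfer (m + 1) (\<rho> n))) (Suc 0)"
    if \<rho>: "\<forall>i. \<rho> i < m" for \<rho> m
    unfolding computes_def
  proof (intro allI impI)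
    fix s :: store and l
    assume s: "\<forall>r<m. s r \<le> 2 ^ l" "\<forall>r\<ge>m. s r = 0"
    let ?x = "\<rho> n"
    let ?b = "(2::nat) ^ (l + 2) ^ Suc 0"
    let ?s = "\<lambda>i. s(?x := s ?x - i, m := i, m + 1 := i)"
    have x: "?x < m" "s ?x \<le> 2 ^ l" using \<rho> s by auto
    have b: "s ?x \<le> ?b" using x exponent_ge[of l 0] by linarith
    have 1: "exec ?b (While ?x (Seq (Dec ?x) (Seq (Inc m) (Inc (m + 1))))) s (?s (s ?x))"
    proof (rule exec_While_chain[where st = ?s and n = "s ?x"])
      fix i assume i: "i < s ?x"
      have "exec ?b (Dec ?x) (?s i) ((?s i)(?x := s ?x - Suc i))"
        by (rule exec_Dec) (use x in auto)
      moreover have "exec ?b (Inc m) ((?s i)(?x := s ?x - Suc i)) ((?s i)(?x := s ?x - Suc i, m := Suc i))"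
        by (rule exec_Inc) (use i x b in auto)
      moreover have "exec ?b (Inc (m + 1)) ((?s i)(?x := s ?x - Suc i, m := Suc i)) (?s (Suc i))"
        by (rule exec_Inc) (use i x b in auto)
      ultimately show "?s i ?x \<noteq> 0 \<and> exec ?b (Seq (Dec ?x) (Seq (Inc m) (Inc (m + 1)))) (?s i) (?s (Suc i))"
        using i x by (auto intro: exec.Seq)
    qed (use x s in auto)
    have 2: "exec ?b (transfer (m + 1) ?x) (?s (s ?x)) (s(m := s ?x))"
      by (rule exec_transfer) (use x s b in auto)
    from 1 2 show "exec ?b (Seq (While ?x (Seq (Dec ?x) (Seq (Inc m) (Inc (m + 1))))) (transfer (m + 1) ?x))
        s (s(m := s ?x))" by (rule exec.Seq)
  qed
  then show ?thesis using quasi_bounded_var unfolding PS_def by blast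
qed

lemma PS_let:
  assumes h: "PS (\<lambda>e. h (e 0) (\<lambda>i. e (Suc i)))" and a: "PS a"
  shows "PS (\<lambda>e. h (a e) e)"
proof -
  have Q: "quasi_bounded (\<lambda>e. h (a e) e)"
    by (rule quasi_bounded_let[OF PS_bounded PS_bounded]) fact+
  have "\<exists>p c. computes \<rho> m (\<lambda>e. h (a e) e) p c" if \<rho>: "\<forall>i. \<rho> i < m" for \<rho> m
  proof -
    let ?\<rho> = "case_nat m \<rho>"
    have \<rho>': "\<forall>i. ?\<rho> i < m + 1" using \<rho> by (auto split: nat.split intro: less_SucI)
    obtain p c where p: "computes \<rho> m a p c" using PS_computes[OF a \<rho>] by blast
    obtain q d where q: "computes ?\<rho> (m + 1) (\<lambda>e. h (e 0) (\<lambda>i. e (Suc i))) q d"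
      using PS_computes[OF h \<rho>'] by blast
    obtain c' where c': "\<And>e l. \<forall>i. e i \<le> 2 ^ l \<Longrightarrow> a e \<le> 2 ^ (l + 2) ^ c'"
      by (rule quasi_boundedE[OF PS_bounded[OF a]]) blast
    obtain d' where d': "\<And>e l. \<forall>i. e i \<le> 2 ^ l \<Longrightarrow> h (a e) e \<le> 2 ^ (l + 2) ^ d'"
      by (rule quasi_boundedE[OF Q]) blast
    \<comment> \<open>The three exponents cover the run of \<open>p\<close>, the run of
      \<open>q\<close> on a store that also holds the value of \<open>a\<close>, and the transfer of
      the result.\<close>
    define C where "C = Max {c, (Suc c' + 2) * d, d'}"
    have C: "c \<le> C" "(Suc c' + 2) * d \<le> C" "d' \<le> C" by (auto simp: C_def)
    have "computes \<rho> m (\<lambda>e. h (a e) e) (Seq p (Seq q (Seq (clear m) (transfer (m + 1) m)))) C"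
      unfolding computes_def
    proof (intro allI impI)
      fix s :: store and l
      assume s: "\<forall>r<m. s r \<le> 2 ^ l" "\<forall>r\<ge>m. s r = 0"
      let ?b = "(2::nat) ^ (l + 2) ^ C"
      let ?e = "\<lambda>i. s (\<rho> i)"
      have e: "\<forall>i. ?e i \<le> 2 ^ l" using s \<rho> by auto
      let ?s1 = "s(m := a ?e)"
      let ?s2 = "s(m := a ?e, m + 1 := h (a ?e) ?e)"
      have 1: "exec ?b p s ?s1"
        by (rule computesD[OF p _ _ refl exponent_mono[OF C(1)]]) (use s in auto)
      have l': "?s1 r \<le> 2 ^ (l + 2) ^ Suc c'" if "r < m + 1" for r
      proof (cases "r = m")
        case True
        then show ?thesis using order_trans[OF c'[of ?e l, OF e] exponent_mono[of c' "Suc c'" l]] by simp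
      next
        case False
        then have "?s1 r = s r" "r < m" using that by auto
        then show ?thesis using s(1) exponent_ge[of l c'] by (metis order_trans)
      qed
      have "(2::nat) ^ ((l + 2) ^ Suc c' + 2) ^ d \<le> 2 ^ (l + 2) ^ ((Suc c' + 2) * d)"
        by (intro power_increasing exponent_comp) simp
      also have "\<dots> \<le> ?b" by (intro exponent_mono C)
      finally have b: "(2::nat) ^ ((l + 2) ^ Suc c' + 2) ^ d \<le> ?b" .
      have \<rho>m: "\<rho> i \<noteq> m" for i using \<rho> by (metis less_irrefl)
      have 2: "exec ?b q ?s1 ?s2"
        by (rule computesD[OF q l' _ _ b]) (use s in \<open>auto simp: \<rho>m\<close>)
      have 3: "exec ?b (clear m) ?s2 (s(m + 1 := h (a ?e) ?e))"
        by (rule exec_clear) (use s in auto)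
      have "h (a ?e) ?e \<le> ?b" by (rule order_trans[OF d'[OF e] exponent_mono[OF C(3)]])
      then have 4: "exec ?b (transfer (m + 1) m) (s(m + 1 := h (a ?e) ?e)) (s(m := h (a ?e) ?e))"
        by (intro exec_transfer) (use s in auto)
      show "exec ?b (Seq p (Seq q (Seq (clear m) (transfer (m + 1) m)))) s (s(m := h (a ?e) ?e))"
        by (rule exec.Seq[OF 1 exec.Seq[OF 2 exec.Seq[OF 3 4]]])
    qed
    then show ?thesis by blast
  qed
  then show ?thesis using Q by (simp add: PS_def)
qed

text \<open>The number of rounds may be exponential; what could leave the class is an intermediate
  value. So a bound \<open>q\<close> on all of them is demanded, which itself need not come with a
  program.\<close>

lemma PS_rec:
  assumes N: "PS N" and a: "PS a" and g: "PS (\<lambda>e. g (e 0) (e 1) (\<lambda>i. e (Suc (Suc i))))"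
    and q: "quasi_bounded q" and le: "\<And>e i. i \<le> N e \<Longrightarrow> rec_nat (a e) (\<lambda>i x. g i x e) i \<le> q e"
  shows "PS (\<lambda>e. rec_nat (a e) (\<lambda>i x. g i x e) (N e))"
proof -
  let ?f = "\<lambda>e. rec_nat (a e) (\<lambda>i x. g i x e) (N e)"
  have Q: "quasi_bounded ?f"
    by (rule quasi_bounded_mono[OF q]) (simp add: le)
  have "\<exists>p c. computes \<rho> m ?f p c" if \<rho>: "\<forall>i. \<rho> i < m" for \<rho> m
  proof -
    let ?\<rho> = "case_nat m (case_nat (m + 1) \<rho>)"
    have \<rho>m: "\<rho> i \<noteq> m" "\<rho> i \<noteq> Suc m" "\<rho> i \<noteq> Suc (Suc m)" for i
      using \<rho>[rule_format, of i] by auto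
    have \<rho>3: "\<forall>i. \<rho> i < m + 3" using \<rho> by (auto intro: trans_less_add1)
    have \<rho>': "\<forall>i. ?\<rho> i < m + 3" using \<rho>3 by (auto split: nat.split)
    obtain pN cN where pN: "computes \<rho> (m + 3) N pN cN" using PS_computes[OF N \<rho>3] by blast
    obtain pa ca where pa: "computes \<rho> (m + 3) a pa ca" using PS_computes[OF a \<rho>3] by blast
    obtain pg cg where pg: "computes ?\<rho> (m + 3) (\<lambda>e. g (e 0) (e 1) (\<lambda>i. e (Suc (Suc i)))) pg cg"
      using PS_computes[OF g \<rho>'] by blast
    obtain dN where dN: "\<And>e l. \<forall>i. e i \<le> 2 ^ l \<Longrightarrow> N e \<le> 2 ^ (l + 2) ^ dN"
      by (rule quasi_boundedE[OF PS_bounded[OF N]]) blast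
    obtain dq where dq: "\<And>e l. \<forall>i. e i \<le> 2 ^ l \<Longrightarrow> q e \<le> 2 ^ (l + 2) ^ dq"
      by (rule quasi_boundedE[OF q]) blast
    define k where "k = Suc (max dN dq)"
    define C where "C = Max {cN, (k + 2) * ca, (k + 2) * cg, k}"
    have C: "cN \<le> C" "(k + 2) * ca \<le> C" "(k + 2) * cg \<le> C" "k \<le> C" by (auto simp: C_def)
    \<comment> \<open>Registers \<open>m\<close>, \<open>m + 1\<close> and \<open>m + 2\<close> hold
      the round number, the current value and the number of remaining rounds; subprograms work from
      \<open>m + 3\<close> on.\<close>
    define body where "body = Seq (Dec (m + 2)) (Seq pg (Seq (clear (m + 1)) (Seq (transfer (m + 3) (m + 1)) (Inc m))))"
    define prog where "prog = Seq pN (Seq (transfer (m + 3) (m + 2)) (Seq pa (Seq (transfer (m + 3) (m + 1))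
        (Seq (While (m + 2) body) (Seq (clear m) (transfer (m + 1) m))))))"
    have "computes \<rho> m ?f prog C"
      unfolding computes_def
    proof (intro allI impI)
      fix s :: store and l
      assume s: "\<forall>r<m. s r \<le> 2 ^ l" "\<forall>r\<ge>m. s r = 0"
      let ?b = "(2::nat) ^ (l + 2) ^ C"
      define L where "L = (l + 2) ^ k"
      define e where "e = (\<lambda>i. s (\<rho> i))"
      have e: "\<forall>i. e i \<le> 2 ^ l" using s \<rho> by (auto simp: e_def)
      define x where "x = rec_nat (a e) (\<lambda>i x. g i x e)"
      have s0: "s r = 0" if "m \<le> r" for r using s that by auto
      have NL: "N e \<le> 2 ^ L" unfolding L_def
        by (rule order_trans[OF dN[OF e] exponent_mono]) (simp add: k_def)
      have xL: "x i \<le> 2 ^ L" if "i \<le> N e" for i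
      proof -
        have "x i \<le> q e" unfolding x_def by (rule le[OF that])
        also have "\<dots> \<le> 2 ^ L" unfolding L_def
          by (rule order_trans[OF dq[OF e] exponent_mono]) (simp add: k_def)
        finally show ?thesis .
      qed
      have sL: "s r \<le> 2 ^ L" for r
      proof (cases "r < m")
        case True
        then have "s r \<le> 2 ^ l" using s by blast
        also have "\<dots> \<le> 2 ^ L" unfolding L_def k_def by (rule exponent_ge)
        finally show ?thesis .
      qed (simp add: s0)
      have Lb: "2 ^ L \<le> ?b" unfolding L_def by (rule exponent_mono[OF C(4)])
      have b: "(2::nat) ^ (L + 2) ^ d \<le> ?b" if "(k + 2) * d \<le> C" for d
      proof -
        have "(2::nat) ^ (L + 2) ^ d \<le> 2 ^ (l + 2) ^ ((k + 2) * d)"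
          unfolding L_def by (intro power_increasing exponent_comp) simp
        also have "\<dots> \<le> ?b" by (rule exponent_mono[OF that])
        finally show ?thesis .
      qed
      have sl: "s r \<le> 2 ^ l" for r using s s0 by (cases "r < m") auto
      let ?st = "\<lambda>i. s(m := i, m + 1 := x i, m + 2 := N e - i)"
      have 1: "exec ?b pN s (s(m + 3 := N e))"
        by (rule computesD[OF pN sl _ _ exponent_mono[OF C(1)]]) (simp_all add: s0 e_def)
      have 2: "exec ?b (transfer (m + 3) (m + 2)) (s(m + 3 := N e)) (s(m + 2 := N e))"
        by (rule exec_transfer) (use order_trans[OF NL Lb] in \<open>auto simp: s0\<close>)
      have 3: "exec ?b pa (s(m + 2 := N e)) (s(m + 2 := N e, m + 3 := x 0))"
        by (rule computesD[OF pa _ _ _ b[OF C(2)]]) (use NL in \<open>auto simp: s0 sL e_def x_def \<rho>m\<close>)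
      have 4: "exec ?b (transfer (m + 3) (m + 1)) (s(m + 2 := N e, m + 3 := x 0)) (?st 0)"
        by (rule exec_transfer) (use order_trans[OF xL[of 0] Lb] in \<open>auto simp: s0\<close>)
      have 5: "exec ?b (While (m + 2) body) (?st 0) (?st (N e))"
      proof (rule exec_While_chain[where st = ?st and n = "N e"])
        fix i assume i: "i < N e"
        let ?s = "s(m := i, m + 1 := x i, m + 2 := N e - Suc i)"
        have b1: "exec ?b (Dec (m + 2)) (?st i) ?s"
          by (rule exec_Dec) (use i in auto)
        have b2: "exec ?b pg ?s (?s(m + 3 := x (Suc i)))"
        proof (rule computesD[OF pg _ _ _ b[OF C(3)]])
          show "?s r \<le> 2 ^ L" for r using sL xL[of i] NL i by auto
          show "?s r = 0" if "m + 3 \<le> r" for r using that by (auto simp: s0)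
          show "?s(m + 3 := x (Suc i)) = ?s(m + 3 := g (?s (?\<rho> 0)) (?s (?\<rho> 1)) (\<lambda>j. ?s (?\<rho> (Suc (Suc j)))))"
            by (simp add: x_def \<rho>m e_def)
        qed
        have b3: "exec ?b (clear (m + 1)) (?s(m + 3 := x (Suc i))) (?s(m + 3 := x (Suc i), m + 1 := 0))"
          by (rule exec_clear) auto
        have b4: "exec ?b (transfer (m + 3) (m + 1)) (?s(m + 3 := x (Suc i), m + 1 := 0)) (?s(m + 1 := x (Suc i)))"
          by (rule exec_transfer) (use order_trans[OF xL[of "Suc i"] Lb] i in \<open>auto simp: s0\<close>)
        have b5: "exec ?b (Inc m) (?s(m + 1 := x (Suc i))) (?st (Suc i))"
          by (rule exec_Inc) (use order_trans[OF NL Lb] i in auto)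
        have "exec ?b body (?st i) (?st (Suc i))" unfolding body_def
          by (rule exec.Seq[OF b1 exec.Seq[OF b2 exec.Seq[OF b3 exec.Seq[OF b4 b5]]]])
        then show "?st i (m + 2) \<noteq> 0 \<and> exec ?b body (?st i) (?st (Suc i))" using i by simp
      qed auto
      have 6: "exec ?b (clear m) (?st (N e)) (s(m + 1 := x (N e)))"
        by (rule exec_clear) (auto simp: s0)
      have 7: "exec ?b (transfer (m + 1) m) (s(m + 1 := x (N e))) (s(m := x (N e)))"
        by (rule exec_transfer) (use order_trans[OF xL[of "N e"] Lb] in \<open>auto simp: s0\<close>)
      have "exec ?b prog s (s(m := x (N e)))" unfolding prog_def
        by (rule exec.Seq[OF 1 exec.Seq[OF 2 exec.Seq[OF 3 exec.Seq[OF 4 exec.Seq[OF 5 exec.Seq[OF 6 7]]]]]])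
      then show "exec ?b prog s (s(m := ?f (\<lambda>i. s (\<rho> i))))" by (simp add: x_def e_def)
    qed
    then show ?thesis by blast
  qed
  then show ?thesis using Q by (simp add: PS_def)
qed

lemma PS_subst:
  assumes "PS f" "\<And>i. i < k \<Longrightarrow> PS (g i)"
  shows "PS (\<lambda>e. f (\<lambda>i. if i < k then g i e else e (i - k)))"
  using assms(2)
proof (induction k arbitrary: g)
  case 0
  then show ?case using assms(1) by simp
next
  case (Suc k)
  \<comment> \<open>Argument number \<open>k\<close> is left as variable 0, with the other arguments
    shifted past it, and is afterwards bound by \<open>PS_let\<close>.\<close>
  have "PS (\<lambda>e. f (\<lambda>i. if i < k then g i (\<lambda>i. e (Suc i)) else e (i - k)))"
  proof (rule Suc.IH)
    fix i assume "i < k"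
    then show "PS (\<lambda>e. g i (\<lambda>j. e (Suc j)))"
      using PS_rename[of "g i" Suc] Suc.prems[of i] by simp
  qed
  also have "(\<lambda>e. f (\<lambda>i. if i < k then g i (\<lambda>i. e (Suc i)) else e (i - k))) =
    (\<lambda>e. f (\<lambda>i. if i < k then g i (\<lambda>i. e (Suc i)) else if i = k then e 0 else e (Suc (i - Suc k))))"
    by (rule ext, rule arg_cong[where f = f], rule ext) (auto simp: Suc_diff_Suc)
  finally have "PS (\<lambda>e. f (\<lambda>i. if i < k then g i e else if i = k then g k e else e (i - Suc k)))"
    by (rule PS_let[where a = "g k" and
        h = "\<lambda>x e. f (\<lambda>i. if i < k then g i e else if i = k then x else e (i - Suc k))"])
      (simp add: Suc.prems)
  also have "(\<lambda>e. f (\<lambda>i. if i < k then g i e else if i = k then g k e else e (i - Suc k))) =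
    (\<lambda>e. f (\<lambda>i. if i < Suc k then g i e else e (i - Suc k)))"
    by (rule ext, rule arg_cong[where f = f], rule ext) (auto simp: less_Suc_eq)
  finally show ?case .
qed

lemma PS_subst_list:
  assumes "PS f" "\<forall>g\<in>set gs. PS g"
  shows "PS (\<lambda>e. f (\<lambda>i. if i < length gs then (gs ! i) e else e (i - length gs)))"
  by (rule PS_subst[OF assms(1)]) (use assms(2) in simp)

lemma PS_comp1: "PS (\<lambda>e. f (e 0)) \<Longrightarrow> PS a \<Longrightarrow> PS (\<lambda>e. f (a e))"
  using PS_subst_list[of "\<lambda>e. f (e 0)" "[a]"] by simp

lemma PS_comp2:
  assumes "PS (\<lambda>e. f (e 0) (e 1))" "PS a" "PS b"
  shows "PS (\<lambda>e. f (a e) (b e))"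
  using PS_subst_list[OF assms(1), of "[a, b]"] assms(2-) by simp

lemma PS_comp3:
  assumes "PS (\<lambda>e. f (e 0) (e 1) (e 2))" "PS a" "PS b" "PS c"
  shows "PS (\<lambda>e. f (a e) (b e) (c e))"
  using PS_subst_list[OF assms(1), of "[a, b, c]"] assms(2-) by simp

lemma PS_comp4:
  assumes "PS (\<lambda>e. f (e 0) (e 1) (e 2) (e 3))" "PS a" "PS b" "PS c" "PS d"
  shows "PS (\<lambda>e. f (a e) (b e) (c e) (d e))"
  using PS_subst_list[OF assms(1), of "[a, b, c, d]"] assms(2-) by simp

lemma PS_comp5:
  assumes "PS (\<lambda>e. f (e 0) (e 1) (e 2) (e 3) (e 4))" "PS a" "PS b" "PS c" "PS d" "PS d'"
  shows "PS (\<lambda>e. f (a e) (b e) (c e) (d e) (d' e))"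
  using PS_subst_list[OF assms(1), of "[a, b, c, d, d']"] assms(2-) by simp

abbreviation PSb :: "(store \<Rightarrow> bool) \<Rightarrow> bool" where
  "PSb P \<equiv> PS (\<lambda>e. of_bool (P e))"

lemma PS_const: "PS (\<lambda>e. k)"
  by (induction k) (auto intro: PS_zero PS_Suc)

lemma PS_recI:
  assumes "PS N" "PS a" "PS (\<lambda>e. g (e 0) (e 1) (\<lambda>i. e (Suc (Suc i))))" "quasi_bounded q"
    and "\<And>e i. rec_nat (a e) (\<lambda>i x. g i x e) i = f i e" and "\<And>e i. i \<le> N e \<Longrightarrow> f i e \<le> q e"
  shows "PS (\<lambda>e. f (N e) e)"
proof -
  have "PS (\<lambda>e. rec_nat (a e) (\<lambda>i x. g i x e) (N e))"
    by (rule PS_rec[OF assms(1-4)]) (simp add: assms(5,6))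
  then show ?thesis by (simp add: assms(5))
qed

lemma rec_nat_eqI: "f 0 = a \<Longrightarrow> (\<And>i. f (Suc i) = g i (f i)) \<Longrightarrow> rec_nat a g n = f n"
  by (induction n) auto

section \<open>Arithmetic, logic and bounded quantifiers\<close>

lemma PS_add:
  assumes "PS a" "PS b" shows "PS (\<lambda>e. a e + b e)"
proof (rule PS_recI[where f = "\<lambda>i e. a e + i" and g = "\<lambda>i x e. Suc x" and a = a and N = b])
  show "PS (\<lambda>e. Suc (e 1))" by (intro PS_Suc PS_var)
  show "quasi_bounded (\<lambda>e. a e + b e)" using assms by (intro quasi_bounded_add PS_bounded)
qed (use assms in \<open>auto intro!: rec_nat_eqI\<close>)

lemma PS_mult:
  assumes "PS a" "PS b" shows "PS (\<lambda>e. a e * b e)"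
proof (rule PS_recI[where f = "\<lambda>i e. a e * i" and g = "\<lambda>i x e. x + a e" and
      a = "\<lambda>e. 0" and N = b])
  show "PS (\<lambda>e. e 1 + a (\<lambda>i. e (Suc (Suc i))))"
    by (intro PS_add PS_var PS_rename[OF assms(1), of "\<lambda>i. Suc (Suc i)"])
  show "quasi_bounded (\<lambda>e. a e * b e)" using assms by (intro quasi_bounded_mult PS_bounded)
qed (use assms in \<open>auto intro!: rec_nat_eqI PS_zero\<close>)

lemma PS_pred:
  assumes "PS a" shows "PS (\<lambda>e. a e - 1)"
proof (rule PS_recI[where f = "\<lambda>i e. i - 1" and g = "\<lambda>i x e. i" and a = "\<lambda>e. 0" and N = a])
  show "PS (\<lambda>e. e 0)" "PS (\<lambda>e. 0)" "PS a" by (intro PS_var PS_zero assms)+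
  show "quasi_bounded a" using assms by (rule PS_bounded)
qed (auto intro!: rec_nat_eqI)

lemma PS_diff:
  assumes "PS a" "PS b" shows "PS (\<lambda>e. a e - b e)"
proof (rule PS_recI[where f = "\<lambda>i e. a e - i" and g = "\<lambda>i x e. x - 1" and a = a and N = b])
  show "PS (\<lambda>e. e 1 - 1)" by (intro PS_pred PS_var)
  show "quasi_bounded a" using assms by (intro PS_bounded)
qed (use assms in \<open>auto intro!: rec_nat_eqI\<close>)

text \<open>A recursion with \<open>of_bool (P e)\<close> rounds: no round leaves \<open>b\<close>,
  one round replaces it by \<open>a\<close>.\<close>

lemma PS_if:
  assumes "PSb P" "PS a" "PS b" shows "PS (\<lambda>e. if P e then a e else b e)"
proof -
  have "PS (\<lambda>e. if of_bool (P e) = (0::nat) then b e else a e)"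
  proof (rule PS_recI[where f = "\<lambda>i e. if i = 0 then b e else a e" and g = "\<lambda>i x e. a e" and
        a = b and N = "\<lambda>e. of_bool (P e)"])
    show "PS (\<lambda>e. a (\<lambda>i. e (Suc (Suc i))))" by (rule PS_rename[OF assms(2)])
    show "quasi_bounded (\<lambda>e. a e + b e)" using assms by (intro quasi_bounded_add PS_bounded)
    show "rec_nat (b e) (\<lambda>i x. a e) i = (if i = 0 then b e else a e)" for e i
      by (cases i) simp_all
  qed (use assms in auto)
  moreover have "(if of_bool (P e) = (0::nat) then b e else a e) = (if P e then a e else b e)" for e
    by auto
  ultimately show ?thesis by simp
qed

lemma PS_not: "PSb P \<Longrightarrow> PSb (\<lambda>e. \<not> P e)"
proof -
  assume "PSb P"
  then have "PS (\<lambda>e. 1 - of_bool (P e))" by (intro PS_diff PS_const)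
  moreover have "1 - of_bool (P e) = (of_bool (\<not> P e) :: nat)" for e by simp
  ultimately show ?thesis by simp
qed

lemma PS_conj: "PSb P \<Longrightarrow> PSb Q \<Longrightarrow> PSb (\<lambda>e. P e \<and> Q e)"
  using PS_mult[of "\<lambda>e. of_bool (P e)" "\<lambda>e. of_bool (Q e)"] by (simp add: of_bool_conj)

lemma PS_disj: "PSb P \<Longrightarrow> PSb Q \<Longrightarrow> PSb (\<lambda>e. P e \<or> Q e)"
  using PS_not[OF PS_conj[OF PS_not PS_not], of P Q] by simp

lemma PS_imp: "PSb P \<Longrightarrow> PSb Q \<Longrightarrow> PSb (\<lambda>e. P e \<longrightarrow> Q e)"
  unfolding imp_conv_disj by (intro PS_disj PS_not)

lemma PS_pos:
  assumes "PS a" shows "PSb (\<lambda>e. 0 < a e)"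
proof -
  have "PS (\<lambda>e. 1 - (1 - a e))" by (intro PS_diff PS_const assms)
  moreover have "1 - (1 - a e) = of_bool (0 < a e)" for e by simp
  ultimately show ?thesis by simp
qed

lemma PS_less: "PS a \<Longrightarrow> PS b \<Longrightarrow> PSb (\<lambda>e. a e < b e)"
  using PS_pos[OF PS_diff, of b a] by simp

lemma PS_le: "PS a \<Longrightarrow> PS b \<Longrightarrow> PSb (\<lambda>e. a e \<le> b e)"
  using PS_not[OF PS_less, of b a] by (simp add: not_less)

lemma PS_eq: "PS a \<Longrightarrow> PS b \<Longrightarrow> PSb (\<lambda>e. a e = b e)"
  using PS_conj[OF PS_le PS_le, of a b b a] by (simp add: eq_iff)

lemma quasi_bounded_sum:
  assumes "quasi_bounded (\<lambda>e. g (e 0) (\<lambda>i. e (Suc i)))" "quasi_bounded N"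
  shows "quasi_bounded (\<lambda>e. \<Sum>i<N e. g i e)"
proof -
  obtain c where c: "\<And>e l. \<forall>i. e i \<le> 2 ^ l \<Longrightarrow> g (e 0) (\<lambda>i. e (Suc i)) \<le> 2 ^ (l + 2) ^ c"
    by (rule quasi_boundedE[OF assms(1)]) blast
  obtain d where d: "\<And>e l. \<forall>i. e i \<le> 2 ^ l \<Longrightarrow> N e \<le> 2 ^ (l + 2) ^ d"
    by (rule quasi_boundedE[OF assms(2)]) blast
  define C where "C = max (Suc d) ((Suc d + 2) * c)"
  have "(\<Sum>i<N e. g i e) \<le> 2 ^ (l + 2) ^ Suc C" if e: "\<forall>i. e i \<le> 2 ^ l" for e l
  proof -
    have N: "N e \<le> 2 ^ (l + 2) ^ Suc d"
      by (rule order_trans[OF d[OF e] exponent_mono]) simp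
    have g: "g i e \<le> 2 ^ (l + 2) ^ C" if "i < N e" for i
    proof -
      have "i \<le> 2 ^ (l + 2) ^ Suc d" using N that by linarith
      moreover have "e j \<le> 2 ^ (l + 2) ^ Suc d" for j using e exponent_ge[of l d] by (meson order_trans)
      ultimately have "\<forall>j. case_nat i e j \<le> 2 ^ (l + 2) ^ Suc d" by (auto split: nat.split)
      from c[OF this] have "g i e \<le> 2 ^ ((l + 2) ^ Suc d + 2) ^ c" by simp
      also have "\<dots> \<le> 2 ^ (l + 2) ^ ((Suc d + 2) * c)"
        by (intro power_increasing exponent_comp) simp
      also have "\<dots> \<le> 2 ^ (l + 2) ^ C" by (rule exponent_mono) (simp add: C_def)
      finally show ?thesis .
    qed
    have "(\<Sum>i<N e. g i e) \<le> N e * 2 ^ (l + 2) ^ C"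
      using sum_bounded_above[of "{..<N e}" "\<lambda>i. g i e" "2 ^ (l + 2) ^ C"] g by simp
    also have "\<dots> \<le> 2 ^ (l + 2) ^ C * 2 ^ (l + 2) ^ C"
      by (rule mult_le_mono1, rule order_trans[OF N exponent_mono]) (simp add: C_def)
    also have "\<dots> = 2 ^ (2 * (l + 2) ^ C)" by (simp only: mult_2 power_add)
    also have "\<dots> \<le> 2 ^ (l + 2) ^ Suc C" by (intro power_increasing) auto
    finally show ?thesis .
  qed
  then show ?thesis unfolding quasi_bounded_def by blast
qed

lemma PS_sum:
  assumes "PS N" "PS (\<lambda>e. g (e 0) (\<lambda>i. e (Suc i)))"
  shows "PS (\<lambda>e. \<Sum>i<N e. g i e)"
proof (rule PS_recI[where f = "\<lambda>i e. \<Sum>j<i. g j e" and g = "\<lambda>i x e. x + g i e" and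
      a = "\<lambda>e. 0" and N = N])
  \<comment> \<open>In the recursion step variable 1 is the partial sum; the renaming makes the
    summand skip it.\<close>
  have "PS (\<lambda>e. g (e 0) (\<lambda>i. e (Suc (Suc i))))"
    using PS_rename[OF assms(2), of "\<lambda>i. case i of 0 \<Rightarrow> 0 | Suc j \<Rightarrow> Suc (Suc j)"] by simp
  then show "PS (\<lambda>e. e 1 + g (e 0) (\<lambda>i. e (Suc (Suc i))))" by (intro PS_add PS_var)
  show "quasi_bounded (\<lambda>e. \<Sum>i<N e. g i e)"
    by (intro quasi_bounded_sum PS_bounded assms)
qed (use assms in \<open>auto intro!: rec_nat_eqI sum_mono2 PS_zero\<close>)

lemma PS_ex:
  assumes "PS N" "PSb (\<lambda>e. P (e 0) (\<lambda>i. e (Suc i)))"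
  shows "PSb (\<lambda>e. \<exists>i<N e. P i e)"
proof -
  have "PSb (\<lambda>e. 0 < (\<Sum>i<N e. of_bool (P i e) :: nat))"
    by (intro PS_pos PS_sum assms)
  moreover have "0 < (\<Sum>i<N e. of_bool (P i e) :: nat) \<longleftrightarrow> (\<exists>i<N e. P i e)" for e
    by (auto simp: sum_eq_0_iff simp flip: neq0_conv)
  ultimately show ?thesis by simp
qed

lemma PS_all:
  assumes "PS N" "PSb (\<lambda>e. P (e 0) (\<lambda>i. e (Suc i)))"
  shows "PSb (\<lambda>e. \<forall>i<N e. P i e)"
  using PS_not[OF PS_ex[OF assms(1), of "\<lambda>i e. \<not> P i e", OF PS_not[OF assms(2)]]] by simp

lemma PS_div: assumes "PS a" "PS b" shows "PS (\<lambda>e. a e div b e)"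
proof -
  \<comment> \<open>The quotient is the number of positive multiples of the divisor up to the
    dividend; the guard \<open>0 < e 1\<close> yields 0 for division by 0.\<close>
  have "PS (\<lambda>e. \<Sum>i<e 0. of_bool (0 < e 1 \<and> Suc i * e 1 \<le> e 0))"
    by (intro PS_sum PS_conj PS_pos PS_le PS_mult PS_Suc PS_var)
  moreover have "(\<Sum>i<x. of_bool (0 < y \<and> Suc i * y \<le> x)) = x div y" for x y :: nat
  proof (cases "y = 0")
    case False
    then have eq: "0 < y \<and> Suc i * y \<le> x \<longleftrightarrow> i < x div y" for i
      using less_eq_div_iff_mult_less_eq[of y "Suc i" x] by auto
    have "x div y \<le> x" by simp
    then have "{..<x} \<inter> {i. i < x div y} = {..<x div y}" by (auto intro: less_le_trans)
    then show ?thesis by (simp only: eq) simp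
  qed simp
  ultimately have "PS (\<lambda>e. e 0 div e 1)" by simp
  then show ?thesis using assms by (rule PS_comp2)
qed

lemma PS_mod: "PS a \<Longrightarrow> PS b \<Longrightarrow> PS (\<lambda>e. a e mod b e)"
  unfolding modulo_nat_def by (intro PS_diff PS_mult PS_div)

lemma PS_min: "PS a \<Longrightarrow> PS b \<Longrightarrow> PS (\<lambda>e. min (a e) (b e))"
  unfolding min_def by (intro PS_if PS_le)

section \<open>Binary length and powers with capped exponent\<close>

declare bin.simps [simp del]

definition bit_len :: "nat \<Rightarrow> nat" where
  "bit_len n = length (bin n)"

lemma bin_0 [simp]: "bin 0 = []"
  and bin_pos: "n \<noteq> 0 \<Longrightarrow> bin n = odd n # bin (n div 2)"
  by (subst bin.simps; simp add: odd_iff_mod_2_eq_one)+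

lemma power_le_iff_bit_len: "2 ^ i \<le> n \<longleftrightarrow> i < bit_len n"
proof (induction n arbitrary: i rule: less_induct)
  case (less n)
  show ?case
  proof (cases "n = 0")
    case False
    then have "bit_len n = Suc (bit_len (n div 2))" by (simp add: bit_len_def bin_pos)
    moreover have "2 ^ i' \<le> n div 2 \<longleftrightarrow> 2 ^ Suc i' \<le> n" for i'
      by (simp add: less_eq_div_iff_mult_less_eq mult.commute)
    ultimately show ?thesis
      using less.IH[of "n div 2"] False by (cases i) auto
  qed (simp add: bit_len_def)
qed

lemma less_power_bit_len: "n < 2 ^ bit_len n"
  using power_le_iff_bit_len[of "bit_len n" n] by (simp add: not_le[symmetric])

lemma bit_len_le: "n < 2 ^ i \<Longrightarrow> bit_len n \<le> i"
  using power_le_iff_bit_len[of i n] by (simp add: not_le[symmetric])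

lemma bit_len_le_self: "bit_len n \<le> n"
  using less_exp[of n] by (rule bit_len_le)

lemma power_bit_len_le: "2 ^ bit_len n \<le> 2 * n + 1"
proof (cases "bit_len n")
  case (Suc k)
  then have "2 ^ k \<le> n" using power_le_iff_bit_len[of k n] by simp
  then show ?thesis using Suc by simp
qed simp

lemma bit_len_mask: "bit_len (2 ^ n - 1) = n"
proof -
  have "i < bit_len (2 ^ n - 1) \<longleftrightarrow> i < n" for i
  proof -
    have "0 < (2::nat) ^ n" by simp
    then have "(2::nat) ^ i \<le> 2 ^ n - 1 \<longleftrightarrow> (2::nat) ^ i < 2 ^ n" by linarith
    then show ?thesis by (simp flip: power_le_iff_bit_len)
  qed
  then show ?thesis by (metis linorder_neqE_nat less_irrefl)
qed

text \<open>Doubling only while the value is at most \<open>b e\<close> realizes the cap without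
  knowing \<open>bit_len (b e)\<close>, and keeps all values below \<open>2 * b e + 2\<close>. The
  function \<open>bit_len\<close> is then obtained from these capped powers.\<close>

lemma PS_power2_min:
  assumes "PS a" "PS b" shows "PS (\<lambda>e. 2 ^ min (a e) (bit_len (b e)))"
proof (rule PS_recI[where f = "\<lambda>i e. 2 ^ min i (bit_len (b e))" and
      g = "\<lambda>i x e. if x \<le> b e then 2 * x else x" and a = "\<lambda>e. 1" and N = a])
  show "PS (\<lambda>e. if e 1 \<le> b (\<lambda>i. e (Suc (Suc i))) then 2 * e 1 else e 1)"
    by (intro PS_if PS_le PS_mult PS_const PS_var PS_rename[OF assms(2), of "\<lambda>i. Suc (Suc i)"])
  show "quasi_bounded (\<lambda>e. 2 * b e + 1)"
    using assms by (intro PS_bounded PS_add PS_mult PS_const)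
  fix e i
  show "rec_nat 1 (\<lambda>i x. if x \<le> b e then 2 * x else x) i = 2 ^ min i (bit_len (b e))"
    by (rule rec_nat_eqI) (auto simp: power_le_iff_bit_len min_def not_less_eq_eq le_Suc_eq)
  have "(2::nat) ^ min i (bit_len (b e)) \<le> 2 ^ bit_len (b e)" by (rule power_increasing) auto
  then show "2 ^ min i (bit_len (b e)) \<le> 2 * b e + 1"
    using power_bit_len_le[of "b e"] by linarith
qed (intro assms PS_const)+

lemma PS_bit_len:
  assumes "PS a" shows "PS (\<lambda>e. bit_len (a e))"
proof -
  \<comment> \<open>The length is the number of powers of two up to the argument. The cap is
    harmless because \<open>2 ^ bit_len n\<close> already exceeds \<open>n\<close>.\<close>
  have "PS (\<lambda>e. \<Sum>i<e 0. of_bool (2 ^ min i (bit_len (e 0)) \<le> e 0))"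
    by (intro PS_sum PS_le PS_power2_min PS_var)
  moreover have "(\<Sum>i<n. of_bool (2 ^ min i (bit_len n) \<le> n)) = bit_len n" for n
  proof -
    have "{..<n} \<inter> {i. 2 ^ min i (bit_len n) \<le> n} = {..<bit_len n}"
      using bit_len_le_self[of n] by (auto simp: power_le_iff_bit_len)
    then show ?thesis by simp
  qed
  ultimately have "PS (\<lambda>e. bit_len (e 0))" by simp
  then show ?thesis using assms by (rule PS_comp1)
qed

lemma PS_power_min:
  assumes "PS x" "PS a" "PS b" shows "PS (\<lambda>e. x e ^ min (a e) (bit_len (b e)))"
proof -
  \<comment> \<open>The base is \<open>e 0 + 1\<close> because powers increase with the exponent
    only for a positive base.\<close>
  have "quasi_bounded (\<lambda>e. (e 0 + 1) ^ bit_len (e 2))"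
    unfolding quasi_bounded_def
  proof (intro exI[of _ 2] allI impI)
    fix e :: store and l assume e: "\<forall>i. e i \<le> 2 ^ l"
    have "e 0 \<le> 2 ^ l" "e 2 \<le> 2 ^ l" using e by blast+
    moreover have "(1::nat) \<le> 2 ^ l" "(2::nat) ^ (l + 2) = 2 ^ l * 4" by (simp_all add: power_add)
    ultimately have "e 0 + 1 \<le> 2 ^ (l + 2)" "e 2 < 2 ^ (l + 2)" by linarith+
    note le = this
    have len: "bit_len (e 2) \<le> l + 2" using le(2) by (rule bit_len_le)
    have "(e 0 + 1) ^ bit_len (e 2) \<le> (2 ^ (l + 2)) ^ bit_len (e 2)"
      using le(1) by (rule power_mono) simp
    also have "(2 ^ (l + 2)) ^ bit_len (e 2) \<le> ((2::nat) ^ (l + 2)) ^ (l + 2)"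
      by (rule power_increasing[OF len one_le_power]) simp
    finally show "(e 0 + 1) ^ bit_len (e 2) \<le> 2 ^ (l + 2) ^ 2"
      by (simp only: power_mult[symmetric] power2_eq_square)
  qed
  then have "PS (\<lambda>e. e 0 ^ min (e 1) (bit_len (e 2)))"
  proof (rule PS_recI[where f = "\<lambda>i e. e 0 ^ i" and g = "\<lambda>i x e. x * e 0" and
        a = "\<lambda>e. 1" and N = "\<lambda>e. min (e 1) (bit_len (e 2))", rotated 3])
    show "PS (\<lambda>e. e 1 * e (Suc (Suc 0)))" by (intro PS_mult PS_var)
    show "rec_nat 1 (\<lambda>i x. x * e 0) i = e 0 ^ i" for e :: store and i
      by (rule rec_nat_eqI) simp_all
    fix e :: store and i assume "i \<le> min (e 1) (bit_len (e 2))"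
    then have "(e 0 + 1) ^ i \<le> (e 0 + 1) ^ bit_len (e 2)" by (intro power_increasing) auto
    moreover have "e 0 ^ i \<le> (e 0 + 1) ^ i" by (rule power_mono) auto
    ultimately show "e 0 ^ i \<le> (e 0 + 1) ^ bit_len (e 2)" by linarith
  qed (intro PS_min PS_bit_len PS_var PS_const)+
  then show ?thesis using assms by (rule PS_comp3)
qed

lemmas PS_intros = PS_var PS_Suc PS_add PS_mult PS_diff PS_div PS_mod PS_min PS_if PS_not PS_conj
  PS_disj PS_imp PS_less PS_le PS_eq PS_sum PS_ex PS_all PS_bit_len PS_power_min PS_const

lemma PS_imp_PSPACE:
  assumes "PSb (\<lambda>e. \<Phi> (e 0) (e 1))"
  shows "{w. \<Phi> (num (map Not w)) (num w)} \<in> PSPACE"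
proof -
  \<comment> \<open>A placement has to be total, so all variables other than 0 share register 1; the
    result appears in register 2.\<close>
  let ?\<rho> = "\<lambda>i. if i = 0 then 0 else 1 :: nat"
  have "\<forall>i. ?\<rho> i < 2" by simp
  from PS_computes[OF assms this]
  obtain p c where p: "computes ?\<rho> 2 (\<lambda>e. of_bool (\<Phi> (e 0) (e 1))) p c" by blast
  show ?thesis
  proof (rule exec_imp_PSPACE[where p = p and r = 2])
    fix w
    let ?s = "input_store w"
    have "exec (2 ^ (length w + 2) ^ c) p ?s (?s(2 := of_bool (\<Phi> (num (map Not w)) (num w))))"
      by (rule computesD[OF p])
        (use num_less[of w] num_less[of "map Not w"] in \<open>auto simp: input_store_def less_imp_le\<close>)
    then show "\<exists>s. exec (2 ^ (length w + 2) ^ c) p ?s s \<and>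
        (s 2 \<noteq> 0 \<longleftrightarrow> w \<in> {w. \<Phi> (num (map Not w)) (num w)})"
      by fastforce
  qed
qed

lemma PS_let2:
  assumes "PS (\<lambda>e. h (e 0) (e 1) (\<lambda>i. e (Suc (Suc i))))" "PS a" "PS b"
  shows "PS (\<lambda>e. h (a e) (b e) e)"
proof -
  have "PS (if i = 0 then a else b)" for i :: nat using assms by simp
  from PS_subst[OF assms(1), of 2 "\<lambda>i. if i = 0 then a else b", OF this] show ?thesis by simp
qed

section \<open>Alternating search\<close>

text \<open>One predicate serves both players: a position is won if some move leads to a position
  that is lost for the opponent. A player without moves loses, and exhausted depth counts as a
  loss.\<close>

fun win :: "nat \<Rightarrow> (nat \<Rightarrow> nat \<Rightarrow> bool) \<Rightarrow> nat \<Rightarrow> nat \<Rightarrow> bool" where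
  "win P R 0 p \<longleftrightarrow> False"
| "win P R (Suc d) p \<longleftrightarrow> (\<exists>c<P. R p c \<and> \<not> win P R d c)"

text \<open>Depth-first evaluation of \<^term>\<open>win\<close>. The stack holds a branch of the game tree, the
  second component is 0 when the top is to be evaluated, 1 or 2 when it has been found lost or won,
  and 3 when the top is a candidate for a move from the position below it.\<close>

fun dfs :: "nat \<Rightarrow> (nat \<Rightarrow> nat \<Rightarrow> bool) \<Rightarrow> nat \<Rightarrow> nat list \<times> nat \<Rightarrow> nat list \<times> nat" where
  "dfs P R D (ps, v) =
    (if v = 0 then if D < length ps then (ps, 1) else (0 # ps, 3)
     else case ps of
       c # p # qs \<Rightarrow>
         if v = 3 then if P \<le> c then (p # qs, 1) else if R p c then (ps, 0) else (Suc c # p # qs, 3)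
         else if v = 1 then (p # qs, 2) else (Suc c # p # qs, 3)
     | _ \<Rightarrow> (ps, v))"

fun dfs_time :: "nat \<Rightarrow> nat \<Rightarrow> nat" where
  "dfs_time P 0 = 1"
| "dfs_time P (Suc d) = P * (dfs_time P d + 2) + 2"

lemma funpow_stepI: "f x = y \<Longrightarrow> (f ^^ n) y = z \<Longrightarrow> (f ^^ Suc n) x = z"
  by (simp add: funpow_Suc_right del: funpow.simps)

lemma funpow_addI: "(f ^^ m) x = y \<Longrightarrow> (f ^^ n) y = z \<Longrightarrow> (f ^^ (m + n)) x = z"
  by (metis add.commute comp_apply funpow_add)

lemma dfs_eval:
  assumes "length qs + d = D"
  shows "\<exists>n\<le>dfs_time P d. (dfs P R D ^^ n) (p # qs, 0) = (p # qs, if win P R d p then 2 else 1)"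
  using assms
proof (induction d arbitrary: p qs)
  case 0
  then show ?case by (intro exI[of _ 1]) simp
next
  case (Suc d)
  let ?T = "dfs_time P d"
  \<comment> \<open>The invariant of trying candidates from \<open>c\<close> on. Each candidate
    costs an evaluation and at most two further steps, and the last step pops the exhausted
    candidate.\<close>
  have cand: "\<exists>n\<le>(P - c) * (?T + 2) + 1. (dfs P R D ^^ n) (c # p # qs, 3) =
      (p # qs, if \<exists>c'<P. c \<le> c' \<and> R p c' \<and> \<not> win P R d c' then 2 else 1)" if "c \<le> P" for c
    using that
  proof (induction "P - c" arbitrary: c)
    case 0
    then show ?case by (intro exI[of _ 1]) auto
  next
    case (Suc k)
    then have c: "c < P" "k = P - Suc c" "Suc c \<le> P" by auto
    have ex: "(\<exists>c'<P. c \<le> c' \<and> R p c' \<and> \<not> win P R d c') \<longleftrightarrow>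
        R p c \<and> \<not> win P R d c \<or> (\<exists>c'<P. Suc c \<le> c' \<and> R p c' \<and> \<not> win P R d c')"
      using c(1) by (auto simp: Suc_le_eq le_less)
    obtain n where n: "n \<le> k * (?T + 2) + 1" "(dfs P R D ^^ n) (Suc c # p # qs, 3) =
        (p # qs, if \<exists>c'<P. Suc c \<le> c' \<and> R p c' \<and> \<not> win P R d c' then 2 else 1)"
      using Suc.hyps(1)[OF c(2,3)] c(2) by blast
    have Pc: "(P - c) * (?T + 2) + 1 = k * (?T + 2) + 1 + (?T + 2)"
      using Suc.hyps(2) by (simp flip: Suc.hyps(2))
    consider "\<not> R p c" | "R p c" by blast
    then show ?case
    proof cases
      case 1
      then have "dfs P R D (c # p # qs, 3) = (Suc c # p # qs, 3)" using c by simp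
      from funpow_stepI[OF this n(2)] show ?thesis
        using 1 n(1) by (intro exI[of _ "Suc n"]) (simp only: ex Pc, simp)
    next
      case 2
      then have s1: "dfs P R D (c # p # qs, 3) = (c # p # qs, 0)" using c by simp
      obtain m where m: "m \<le> ?T" "(dfs P R D ^^ m) (c # p # qs, 0) =
          (c # p # qs, if win P R d c then 2 else 1)"
        using Suc.prems(1) \<open>length qs + Suc d = D\<close> Suc.IH(1)[of "p # qs" c] by auto
      show ?thesis
      proof (cases "win P R d c")
        case True
        then have "(dfs P R D ^^ m) (c # p # qs, 0) = (c # p # qs, 2)"
          "dfs P R D (c # p # qs, 2) = (Suc c # p # qs, 3)" using m by auto
        from funpow_stepI[OF s1 funpow_addI[OF this(1) funpow_stepI[OF this(2) n(2)]]]
        show ?thesis using True n(1) m(1) by (intro exI[of _ "Suc (m + Suc n)"]) (simp only: ex Pc, simp)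
      next
        case False
        then have "(dfs P R D ^^ m) (c # p # qs, 0) = (c # p # qs, 1)"
          "(dfs P R D ^^ 1) (c # p # qs, 1) = (p # qs, 2)" using m by auto
        from funpow_stepI[OF s1 funpow_addI[OF this]]
        show ?thesis using False 2 m(1) by (intro exI[of _ "Suc (m + 1)"]) (simp only: ex Pc, simp)
      qed
    qed
  qed
  obtain n where n: "n \<le> P * (?T + 2) + 1" "(dfs P R D ^^ n) (0 # p # qs, 3) =
      (p # qs, if win P R (Suc d) p then 2 else 1)"
    using cand[of 0] by auto
  have "dfs P R D (p # qs, 0) = (0 # p # qs, 3)" using Suc.prems by simp
  from funpow_stepI[OF this n(2)] show ?case
    using n(1) by (intro exI[of _ "Suc n"]) simp
qed

lemma dfs_time_le: "dfs_time P d \<le> (P + 4) ^ Suc d"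
proof (induction d)
  case (Suc d)
  have "P + 4 \<le> (P + 4) ^ Suc d" by (rule self_le_power) auto
  then have "2 * P + 2 \<le> 4 * (P + 4) ^ Suc d" by linarith
  moreover have "P * dfs_time P d \<le> P * (P + 4) ^ Suc d" using Suc.IH by (rule mult_le_mono2)
  moreover have "dfs_time P (Suc d) = P * dfs_time P d + (2 * P + 2)" by (simp add: algebra_simps)
  ultimately have "dfs_time P (Suc d) \<le> P * (P + 4) ^ Suc d + 4 * (P + 4) ^ Suc d" by linarith
  then show ?case by (simp only: power_Suc[of _ "Suc d"] distrib_right)
qed simp

text \<open>The answer is a fixed point of \<open>dfs\<close>, so iterating for any overestimate of
  the running time gives it. This allows a simple closed form as the number of rounds.\<close>

lemma dfs_final:
  assumes "(P + 4) ^ Suc D \<le> n"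
  shows "(dfs P R D ^^ n) ([p], 0) = ([p], if win P R D p then 2 else 1)"
proof -
  obtain m where m: "m \<le> dfs_time P D"
    "(dfs P R D ^^ m) ([p], 0) = ([p], if win P R D p then 2 else 1)"
    using dfs_eval[of "[]" D D P R p] by auto
  have fixed: "(dfs P R D ^^ k) ([p], if win P R D p then 2 else 1) = ([p], if win P R D p then 2 else 1)" for k
    by (induction k) (auto simp del: funpow.simps simp: funpow_Suc_right)
  have "n = m + (n - m)" using m(1) dfs_time_le[of P D] assms by linarith
  then show ?thesis using funpow_addI[OF m(2) fixed, of "n - m"] by simp
qed

section \<open>Stacks as numbers\<close>

text \<open>Only a candidate on top, in status 3, may reach \<open>P\<close>; this is why the digits
  of a stack code need base \<open>P + 1\<close>.\<close>

fun dfs_inv :: "nat \<Rightarrow> nat \<Rightarrow> nat list \<times> nat \<Rightarrow> bool" where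
  "dfs_inv P D ([], v) \<longleftrightarrow> False"
| "dfs_inv P D (c # qs, v) \<longleftrightarrow> c \<le> P \<and> (v \<noteq> 3 \<longrightarrow> c < P) \<and> (\<forall>q\<in>set qs. q < P) \<and> v < 4 \<and>
     (v = 3 \<longrightarrow> qs \<noteq> []) \<and> length qs \<le> D"

lemma dfs_inv_dfs:
  assumes "dfs_inv P D x" shows "dfs_inv P D (dfs P R D x)"
proof -
  obtain c qs v where x: "x = (c # qs, v)" using assms by (cases x; cases "fst x") auto
  show ?thesis using assms unfolding x by (cases qs) (auto split: if_splits)
qed

text \<open>The leading digit 1 keeps positions 0 at the bottom visible, so the height of the stack
  can be read off from the size of its code.\<close>

fun stack_code :: "nat \<Rightarrow> nat list \<Rightarrow> nat" where
  "stack_code B [] = 1"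
| "stack_code B (c # ps) = stack_code B ps * B + c"

lemma stack_code_bounds:
  assumes "\<forall>c\<in>set ps. c < B"
  shows "B ^ length ps \<le> stack_code B ps" "stack_code B ps < 2 * B ^ length ps"
proof -
  have "B ^ length ps \<le> stack_code B ps \<and> stack_code B ps < 2 * B ^ length ps"
    using assms
  proof (induction ps)
    case (Cons c ps)
    then have IH: "B ^ length ps \<le> stack_code B ps" "Suc (stack_code B ps) \<le> 2 * B ^ length ps" and "c < B"
      by auto
    have "B ^ length ps * B \<le> stack_code B ps * B" "Suc (stack_code B ps) * B \<le> 2 * B ^ length ps * B"
      using mult_le_mono1[OF IH(1), of B] mult_le_mono1[OF IH(2), of B] .
    then have "B * B ^ length ps \<le> stack_code B ps * B"
      "stack_code B ps * B + B \<le> 2 * (B * B ^ length ps)" by (simp_all add: mult_ac)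
    then have "B * B ^ length ps \<le> stack_code B ps * B + c"
      "stack_code B ps * B + c < 2 * (B * B ^ length ps)" using \<open>c < B\<close> by linarith+
    then show ?case by simp
  qed simp
  then show "B ^ length ps \<le> stack_code B ps" "stack_code B ps < 2 * B ^ length ps" by auto
qed

text \<open>Here \<open>x mod 4\<close> is the status and \<open>x div 4\<close> the stack. A full
  stack is recognized by the size of its code, a stack with a single position by a code below
  \<open>(P + 1) * (P + 1)\<close>, and \<open>x + 4\<close> advances the candidate on top.\<close>

definition dfs_code_step :: "nat \<Rightarrow> (nat \<Rightarrow> nat \<Rightarrow> bool) \<Rightarrow> nat \<Rightarrow> nat \<Rightarrow> nat" where
  "dfs_code_step P R D x =
    (if x mod 4 = 0 then if (P + 1) * (P + 1) ^ D \<le> x div 4 then x + 1 else 4 * (x div 4 * (P + 1)) + 3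
     else if x div 4 < (P + 1) * (P + 1) then x
     else if x mod 4 = 3 then
       if P \<le> x div 4 mod (P + 1) then 4 * (x div 4 div (P + 1)) + 1
       else if R (x div 4 div (P + 1) mod (P + 1)) (x div 4 mod (P + 1)) then 4 * (x div 4)
       else x + 4
     else if x mod 4 = 1 then 4 * (x div 4 div (P + 1)) + 2 else 4 * (x div 4 + 1) + 3)"

definition dfs_code :: "nat \<Rightarrow> nat list \<times> nat \<Rightarrow> nat" where
  "dfs_code P x = 4 * stack_code (P + 1) (fst x) + snd x"

lemma dfs_code_mod: "v < 4 \<Longrightarrow> dfs_code P (ps, v) mod 4 = v"
  by (simp add: dfs_code_def)

lemma dfs_code_dfs:
  assumes inv: "dfs_inv P D x" and "0 < P"
  shows "dfs_code P (dfs P R D x) = dfs_code_step P R D (dfs_code P x)"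
proof -
  obtain c qs v where x: "x = (c # qs, v)" using inv by (cases x; cases "fst x") auto
  let ?B = "P + 1"
  have i: "c \<le> P" "v \<noteq> 3 \<Longrightarrow> c < P" "\<forall>q\<in>set qs. q < ?B" "v < 4" "v = 3 \<Longrightarrow> qs \<noteq> []"
    using inv by (auto simp: x)
  have "\<forall>q\<in>set (c # qs). q < ?B" using i by auto
  note b = stack_code_bounds[OF this]
  define \<sigma> where "\<sigma> = stack_code ?B (c # qs)"
  have code: "dfs_code P x = 4 * \<sigma> + v" by (simp add: dfs_code_def x \<sigma>_def)
  have dm: "dfs_code P x div 4 = \<sigma>" "dfs_code P x mod 4 = v" using i(4) by (simp_all add: code)
  define \<tau> where "\<tau> = stack_code ?B qs"
  have s: "\<sigma> div ?B = \<tau>" "\<sigma> mod ?B = c"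
    using i(1) by (simp_all add: \<sigma>_def \<tau>_def del: add_Suc_right)
  \<comment> \<open>Codes of stacks of height \<open>h\<close> lie between \<open>?B ^ h\<close> and
    \<open>2 * ?B ^ h\<close>. Since \<open>0 < P\<close> gives \<open>2 \<le> ?B\<close>, different
    heights have disjoint ranges.\<close>
  have full: "?B * ?B ^ D \<le> \<sigma> \<longleftrightarrow> D < length (c # qs)"
  proof
    assume "D < length (c # qs)"
    then have "?B ^ Suc D \<le> ?B ^ length (c # qs)" by (intro power_increasing) auto
    then show "?B * ?B ^ D \<le> \<sigma>" using b(1) unfolding \<sigma>_def by simp
  next
    assume le: "?B * ?B ^ D \<le> \<sigma>"
    show "D < length (c # qs)"
    proof (rule ccontr)
      assume "\<not> ?thesis"
      then have "?B ^ Suc (length (c # qs)) \<le> ?B ^ Suc D" by (intro power_increasing) auto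
      moreover have "2 * ?B ^ length (c # qs) \<le> ?B * ?B ^ length (c # qs)"
        by (rule mult_le_mono1) (use \<open>0 < P\<close> in simp)
      ultimately show False using b(2) le unfolding \<sigma>_def by simp
    qed
  qed
  show ?thesis
  proof (cases qs)
    case Nil
    have "c < P + P * P" using i(1) \<open>0 < P\<close> by (intro le_less_trans[of c P]) auto
    then have "\<sigma> < ?B * ?B" by (simp add: \<sigma>_def Nil)
    then show ?thesis
      unfolding dfs_code_step_def dm full using i(5) Nil
      by (auto simp: x code dfs_code_def \<sigma>_def mult_ac)
  next
    case (Cons p rs)
    have "?B ^ length (c # qs) = ?B * ?B * ?B ^ length rs" by (simp add: Cons algebra_simps)
    then have "?B * ?B * ?B ^ length rs \<le> \<sigma>" using b(1) unfolding \<sigma>_def by (simp only:)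
    then have big: "\<not> \<sigma> < ?B * ?B"
      by (metis add_gr_0 leD le_trans mult.right_neutral mult_le_mono2 one_le_power zero_less_one less_one not_less)
    have p: "\<tau> mod ?B = p" using i(3) by (simp add: \<tau>_def Cons del: add_Suc_right)
    have d: "dfs_code P (c # p # rs, v') = 4 * \<sigma> + v'" "dfs_code P (p # rs, v') = 4 * \<tau> + v'"
      "dfs_code P (Suc c # p # rs, v') = 4 * (\<sigma> + 1) + v'"
      "dfs_code P (0 # c # p # rs, v') = 4 * (\<sigma> * ?B) + v'" for v'
      by (simp_all add: dfs_code_def \<sigma>_def \<tau>_def Cons)
    show ?thesis
      unfolding dfs_code_step_def dm full p s using big i d(2)[of 1] d(2)[of 2]
      by (auto simp: x code d(1,3,4) Cons)
  qed
qed

lemma dfs_code_less: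
  assumes "dfs_inv P D x" shows "dfs_code P x \<le> 8 * ((P + 1) * (P + 1) ^ D)"
proof -
  obtain c qs v where x: "x = (c # qs, v)" using assms by (cases x; cases "fst x") auto
  have "\<forall>q\<in>set (c # qs). q < P + 1" using assms by (auto simp: x)
  from stack_code_bounds(2)[OF this]
  have "Suc (stack_code (P + 1) (c # qs)) \<le> 2 * (P + 1) ^ length (c # qs)" by simp
  also have "\<dots> \<le> 2 * (P + 1) ^ Suc D"
    using assms by (intro mult_le_mono2 power_increasing) (auto simp: x)
  finally show ?thesis using assms by (simp add: x dfs_code_def)
qed

text \<open>The depth has the form \<open>bit_len (y e)\<close>, polynomial in the lengths of the
  variables, so stack codes are quasi-bounded. The exponential running time enters only as the
  number of rounds of a recursion.\<close>

lemma PS_win: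
  assumes P: "PS P" and y: "PS y" and p: "PS p" and R: "PSb (\<lambda>e. R (e 0) (e 1) (\<lambda>i. e (Suc (Suc i))))"
    and less: "\<And>e. p e < P e"
  shows "PSb (\<lambda>e. win (P e) (\<lambda>p c. R p c e) (bit_len (y e)) (p e))"
proof -
  let ?D = "\<lambda>e. bit_len (y e)" and ?R = "\<lambda>e p c. R p c e"
  let ?st = "\<lambda>i e. (dfs (P e) (?R e) (?D e) ^^ i) ([p e], 0)"
  let ?N = "\<lambda>e. (P e + 4) * (P e + 4) ^ min (?D e) (?D e)"
  have inv: "dfs_inv (P e) (?D e) (?st i e)" for i e
    by (induction i) (use less[of e] in \<open>auto intro: dfs_inv_dfs simp del: dfs.simps\<close>)
  note P2 = PS_rename[OF P, of "\<lambda>i. Suc (Suc i)"] and y2 = PS_rename[OF y, of "\<lambda>i. Suc (Suc i)"]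
  let ?e = "\<lambda>e i. e (Suc (Suc i))"
  have R2: "PSb (\<lambda>e. R (a e) (b e) (?e e))" if "PS a" "PS b" for a b
  proof (rule PS_let2[where h = "\<lambda>x y e. of_bool (R x y (?e e))", OF _ that])
    show "PSb (\<lambda>e. R (e 0) (e 1) (\<lambda>i. e (Suc (Suc (Suc (Suc i))))))"
      using PS_rename[OF R, of "\<lambda>i. if i < 2 then i else i + 2"] by simp
  qed
  have step: "PS (\<lambda>e. dfs_code_step (P (?e e)) (?R (?e e)) (?D (?e e)) (e 1))"
  proof -
    have *: "PS (\<lambda>e. (P (?e e) + 1) ^ min (?D (?e e)) (?D (?e e)))"
      by (intro PS_intros P2 y2)
    then show ?thesis
      unfolding dfs_code_step_def by (intro PS_intros P2 R2 *[unfolded min.idem])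
  qed
  have "PS (\<lambda>e. (\<lambda>i e. dfs_code (P e) (?st i e)) (?N e) e)"
  proof (rule PS_recI[where N = ?N and a = "\<lambda>e. 4 * ((P e + 1) + p e)" and
        g = "\<lambda>i x e. dfs_code_step (P e) (?R e) (?D e) x" and
        q = "\<lambda>e. 8 * ((P e + 1) * (P e + 1) ^ min (?D e) (?D e))"])
    show "PS ?N" "PS (\<lambda>e. 4 * ((P e + 1) + p e))" by (intro PS_intros P y p)+
    show "quasi_bounded (\<lambda>e. 8 * ((P e + 1) * (P e + 1) ^ min (?D e) (?D e)))"
      by (intro PS_bounded PS_intros P y)
    show "rec_nat (4 * ((P e + 1) + p e)) (\<lambda>i. dfs_code_step (P e) (?R e) (?D e)) i = dfs_code (P e) (?st i e)" for e i
    proof (rule rec_nat_eqI)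
      fix i
      show "dfs_code (P e) (?st (Suc i) e) = dfs_code_step (P e) (?R e) (?D e) (dfs_code (P e) (?st i e))"
        using dfs_code_dfs[OF inv] less[of e] by (simp del: dfs.simps)
    qed (simp add: dfs_code_def)
    show "dfs_code (P e) (?st i e) \<le> 8 * ((P e + 1) * (P e + 1) ^ min (?D e) (?D e))" for e i
      using dfs_code_less[OF inv] by simp
  qed (rule step)
  then have "PSb (\<lambda>e. dfs_code (P e) (?st (?N e) e) mod 4 = 2)"
    by (intro PS_intros)
  moreover have "dfs_code (P e) (?st (?N e) e) mod 4 = 2 \<longleftrightarrow> win (P e) (?R e) (?D e) (p e)" for e
    by (subst dfs_final) (simp_all add: dfs_code_mod)
  ultimately show ?thesis by simp
qed

section \<open>Circuits over vectors\<close>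

declare gval.simps [simp del]

lemma gval_Inp: "i < length gs \<Longrightarrow> gs ! i = Inp a \<Longrightarrow> gval k gs i = {a}"
  and gval_Neg: "i < length gs \<Longrightarrow> gs ! i = Neg j \<Longrightarrow> i < j \<Longrightarrow> gval k gs i = univ k - gval k gs j"
  and gval_Bin: "i < length gs \<Longrightarrow> gs ! i = Bin f j l \<Longrightarrow> i < j \<Longrightarrow> i < l \<Longrightarrow>
    gval k gs i = bop_sem f (gval k gs j) (gval k gs l)"
  by (simp_all add: gval.simps)

lemma Infty_in_univ [simp]: "Infty \<in> univ k"
  and Fin_in_univ [simp]: "Fin v \<in> univ k \<longleftrightarrow> length v = k"
  by (auto simp: univ_def)

lemma Fin_in_set_plus: "Fin c \<in> set_plus A B \<longleftrightarrow> (\<exists>a b. Fin a \<in> A \<and> Fin b \<in> B \<and> c = map2 (+) a b)"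
proof
  assume "Fin c \<in> set_plus A B"
  then obtain x y where "Fin c = ext_plus x y" "x \<in> A" "y \<in> B" by (auto simp: set_plus_def)
  then show "\<exists>a b. Fin a \<in> A \<and> Fin b \<in> B \<and> c = map2 (+) a b" by (cases x; cases y) auto
next
  assume "\<exists>a b. Fin a \<in> A \<and> Fin b \<in> B \<and> c = map2 (+) a b"
  then obtain a b where "Fin a \<in> A" "Fin b \<in> B" "Fin c = ext_plus (Fin a) (Fin b)" by auto
  then show "Fin c \<in> set_plus A B" unfolding set_plus_def by blast
qed

lemma Infty_in_set_plus: "Infty \<in> set_plus A B \<longleftrightarrow> Infty \<in> A \<and> B \<noteq> {} \<or> A \<noteq> {} \<and> Infty \<in> B"
proof
  assume "Infty \<in> set_plus A B"
  then obtain x y where "Infty = ext_plus x y" "x \<in> A" "y \<in> B" by (auto simp: set_plus_def)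
  then show "Infty \<in> A \<and> B \<noteq> {} \<or> A \<noteq> {} \<and> Infty \<in> B" by (cases x; cases y) auto
next
  have "Infty = ext_plus x Infty" "Infty = ext_plus Infty x" for x by (cases x; simp)+
  moreover assume "Infty \<in> A \<and> B \<noteq> {} \<or> A \<noteq> {} \<and> Infty \<in> B"
  ultimately show "Infty \<in> set_plus A B" unfolding set_plus_def by blast
qed

text \<open>Writing the minuend as \<open>c + b\<close> absorbs the definedness condition. The
  vector \<open>b\<close> is not limited by \<open>c\<close>, which is the source of the unbounded
  quantifier.\<close>

lemma Fin_in_set_minus:
  assumes "A \<subseteq> univ k" "B \<subseteq> univ k"
  shows "Fin c \<in> set_minus A B \<longleftrightarrow>
    length c = k \<and> (\<exists>b. length b = k \<and> Fin b \<in> B \<and> Fin (map2 (+) c b) \<in> A)"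
proof
  assume "Fin c \<in> set_minus A B"
  then obtain x y where xy: "ext_minus x y = Some (Fin c)" "x \<in> A" "y \<in> B" by (auto simp: set_minus_def)
  then obtain a b where ab: "x = Fin a" "y = Fin b" by (cases x; cases y) auto
  have len: "length a = k" "length b = k" using assms xy ab by auto
  have c: "c = map2 (-) a b" "\<forall>i<k. b ! i \<le> a ! i" using xy ab len by (auto split: if_splits)
  then have "map2 (+) c b = a" using len by (auto simp: list_eq_iff_nth_eq)
  then show "length c = k \<and> (\<exists>b. length b = k \<and> Fin b \<in> B \<and> Fin (map2 (+) c b) \<in> A)"
    using xy ab len c by auto
next
  assume r: "length c = k \<and> (\<exists>b. length b = k \<and> Fin b \<in> B \<and> Fin (map2 (+) c b) \<in> A)"
  then obtain b where b: "length b = k" "Fin b \<in> B" "Fin (map2 (+) c b) \<in> A" by blast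
  have "map2 (-) (map2 (+) c b) b = c" using b r by (auto simp: list_eq_iff_nth_eq)
  then have "ext_minus (Fin (map2 (+) c b)) (Fin b) = Some (Fin c)" using b r by simp
  then show "Fin c \<in> set_minus A B" using b unfolding set_minus_def by blast
qed

lemma Infty_in_set_minus: "Infty \<in> set_minus A B \<longleftrightarrow> Infty \<in> A \<and> (\<exists>b. Fin b \<in> B)"
proof
  assume "Infty \<in> set_minus A B"
  then obtain x y where xy: "ext_minus x y = Some Infty" "x \<in> A" "y \<in> B" by (auto simp: set_minus_def)
  then show "Infty \<in> A \<and> (\<exists>b. Fin b \<in> B)" by (cases x; cases y) (auto split: if_splits)
next
  have "ext_minus Infty (Fin b) = Some Infty" for b by simp
  moreover assume "Infty \<in> A \<and> (\<exists>b. Fin b \<in> B)"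
  ultimately show "Infty \<in> set_minus A B" unfolding set_minus_def by blast
qed

lemma bop_sem_subset_univ:
  assumes "A \<subseteq> univ k" "B \<subseteq> univ k" shows "bop_sem f A B \<subseteq> univ k"
proof
  fix x assume x: "x \<in> bop_sem f A B"
  show "x \<in> univ k"
  proof (cases x)
    case (Fin c)
    have "length c = k"
    proof (cases f)
      case BPlus
      then obtain a b where ab: "Fin a \<in> A" "Fin b \<in> B" "c = map2 (+) a b"
        using x Fin by (auto simp: Fin_in_set_plus)
      then have "length a = k" "length b = k" using assms by auto
      then show ?thesis using ab by simp
    qed (use x assms Fin in \<open>auto simp: Fin_in_set_minus[OF assms]\<close>)
    then show ?thesis using Fin by simp
  qed simp
qed

lemma wf_gates:
  assumes "wf_circuit Ops k gs out" "i < length gs"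
  shows "gs ! i = Inp a \<Longrightarrow> a \<in> univ k"
    and "gs ! i = Neg j \<Longrightarrow> i < j \<and> j < length gs"
    and "gs ! i = Bin f j l \<Longrightarrow> i < j \<and> j < length gs \<and> i < l \<and> l < length gs"
proof -
  have *: "case gs ! i of Inp a \<Rightarrow> a \<in> univ k
      | Neg j \<Rightarrow> OCompl \<in> Ops \<and> i < j \<and> j < length gs
      | Bin f j l \<Rightarrow> bop_oper f \<in> Ops \<and> i < j \<and> j < length gs \<and> i < l \<and> l < length gs"
    using assms unfolding wf_circuit_def by blast
  show "gs ! i = Inp a \<Longrightarrow> a \<in> univ k" using * by simp
  show "gs ! i = Neg j \<Longrightarrow> i < j \<and> j < length gs" using * by simp
  show "gs ! i = Bin f j l \<Longrightarrow> i < j \<and> j < length gs \<and> i < l \<and> l < length gs" using * by simp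
qed

text \<open>Vectors that agree up to truncation at \<open>N\<close>: subtraction quantifies over unboundedly large
  vectors, but no gate distinguishes entries above an exponential threshold.\<close>

definition agree :: "nat \<Rightarrow> nat \<Rightarrow> nat list \<Rightarrow> nat list \<Rightarrow> bool" where
  "agree k N c c' \<longleftrightarrow> length c = k \<and> length c' = k \<and> (\<forall>i<k. c ! i = c' ! i \<or> N \<le> c ! i \<and> N \<le> c' ! i)"

definition truncation_invariant :: "nat \<Rightarrow> nat \<Rightarrow> ext set \<Rightarrow> bool" where
  "truncation_invariant k N S \<longleftrightarrow> (\<forall>c c'. agree k N c c' \<longrightarrow> Fin c \<in> S \<longrightarrow> Fin c' \<in> S)"

lemma agree_sym: "agree k N c c' \<Longrightarrow> agree k N c' c"
  by (auto simp: agree_def)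

lemma agree_mono: "agree k N' c c' \<Longrightarrow> N \<le> N' \<Longrightarrow> agree k N c c'"
  unfolding agree_def by (meson order_trans)

lemma truncation_invariantD:
  "truncation_invariant k N S \<Longrightarrow> agree k N c c' \<Longrightarrow> Fin c \<in> S \<longleftrightarrow> Fin c' \<in> S"
  unfolding truncation_invariant_def using agree_sym by blast

lemma truncation_invariant_mono:
  "truncation_invariant k N S \<Longrightarrow> N \<le> N' \<Longrightarrow> truncation_invariant k N' S"
  unfolding truncation_invariant_def using agree_mono by blast

lemma truncation_invariant_singleton:
  assumes "\<And>v. a = Fin v \<Longrightarrow> \<forall>x\<in>set v. x < N"
  shows "truncation_invariant k N {a}"
  unfolding truncation_invariant_def
proof (intro allI impI)
  fix c c' assume c: "agree k N c c'" "Fin c \<in> {a}"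
  then have small: "\<forall>i<k. c ! i < N" using assms by (auto simp: agree_def)
  have "c' = c"
    using c(1) small unfolding agree_def by (intro nth_equalityI) (auto dest!: spec simp: not_le[symmetric])
  then show "Fin c' \<in> {a}" using c by simp
qed

lemma truncation_invariant_compl:
  assumes "truncation_invariant k N S" shows "truncation_invariant k N (univ k - S)"
  unfolding truncation_invariant_def
proof (intro allI impI)
  fix c c' assume "agree k N c c'" "Fin c \<in> univ k - S"
  moreover from this have "Fin c' \<notin> S" using truncation_invariantD[OF assms] by blast
  ultimately show "Fin c' \<in> univ k - S" by (auto simp: agree_def)
qed

text \<open>If a coordinate of the sum reaches \<open>M + N\<close>, one summand is large there and
  can absorb the whole change: where \<open>a\<close> reaches \<open>M\<close>, the other summand
  keeps \<open>min (b ! i) N\<close>; elsewhere \<open>a\<close> is kept and \<open>b\<close> is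
  adjusted. Hence thresholds add up.\<close>

lemma truncation_invariant_plus:
  assumes sub: "A \<subseteq> univ k" "B \<subseteq> univ k"
    and A: "truncation_invariant k M A" and B: "truncation_invariant k N B"
  shows "truncation_invariant k (M + N) (set_plus A B)"
  unfolding truncation_invariant_def
proof (intro allI impI)
  fix c c' assume agr: "agree k (M + N) c c'" and "Fin c \<in> set_plus A B"
  then obtain a b where ab: "Fin a \<in> A" "Fin b \<in> B" "c = map2 (+) a b" by (auto simp: Fin_in_set_plus)
  then have len: "length a = k" "length b = k" using sub by auto
  have c: "c ! i = a ! i + b ! i" if "i < k" for i using ab len that by simp
  have "\<exists>x y. x + y = c' ! i \<and> (a ! i = x \<or> M \<le> a ! i \<and> M \<le> x) \<and> (b ! i = y \<or> N \<le> b ! i \<and> N \<le> y)"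
    if i: "i < k" for i
  proof -
    consider "c ! i = c' ! i" | "M + N \<le> c ! i" "M + N \<le> c' ! i" "M \<le> a ! i"
      | "M + N \<le> c ! i" "M + N \<le> c' ! i" "a ! i < M"
      using agr i unfolding agree_def by (meson not_le)
    then show ?thesis
    proof cases
      case 1
      then show ?thesis using c[OF i] by auto
    next
      case 2
      then show ?thesis by (intro exI[of _ "c' ! i - min (b ! i) N"] exI[of _ "min (b ! i) N"]) auto
    next
      case 3
      then show ?thesis using c[OF i] by (intro exI[of _ "a ! i"] exI[of _ "c' ! i - a ! i"]) auto
    qed
  qed
  then obtain x y where xy: "\<And>i. i < k \<Longrightarrow> x i + y i = c' ! i \<and> (a ! i = x i \<or> M \<le> a ! i \<and> M \<le> x i) \<and>
      (b ! i = y i \<or> N \<le> b ! i \<and> N \<le> y i)" by metis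
  let ?a = "map x [0..<k]" and ?b = "map y [0..<k]"
  have "agree k M a ?a" "agree k N b ?b" using xy len by (auto simp: agree_def)
  then have "Fin ?a \<in> A" "Fin ?b \<in> B"
    using ab A B truncation_invariantD by blast+
  moreover have "c' = map2 (+) ?a ?b"
    using xy agr by (intro nth_equalityI) (auto simp: agree_def)
  ultimately show "Fin c' \<in> set_plus A B" unfolding Fin_in_set_plus by blast
qed

text \<open>The same subtrahend serves both vectors: adding \<open>b\<close> preserves agreement, so
  the threshold of the minuend is inherited.\<close>

lemma truncation_invariant_minus:
  assumes sub: "A \<subseteq> univ k" "B \<subseteq> univ k" and A: "truncation_invariant k M A"
  shows "truncation_invariant k M (set_minus A B)"
  unfolding truncation_invariant_def
proof (intro allI impI)
  fix c c' assume agr: "agree k M c c'" and "Fin c \<in> set_minus A B"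
  then obtain b where b: "length b = k" "Fin b \<in> B" "Fin (map2 (+) c b) \<in> A"
    by (auto simp: Fin_in_set_minus[OF sub])
  have "agree k M (map2 (+) c b) (map2 (+) c' b)"
    using agr b(1) by (fastforce simp: agree_def)
  then have "Fin (map2 (+) c' b) \<in> A" using truncation_invariantD[OF A] b(3) by blast
  then show "Fin c' \<in> set_minus A B"
    using agr b unfolding Fin_in_set_minus[OF sub] agree_def by blast
qed

text \<open>Predecessors have larger indices and therefore at most half the threshold, so the sum of
  two predecessor thresholds, as required by addition, still fits.\<close>

lemma gval_truncation_invariant:
  assumes wf: "wf_circuit Ops k gs out"
    and M: "\<And>i v. i < length gs \<Longrightarrow> gs ! i = Inp (Fin v) \<Longrightarrow> \<forall>x\<in>set v. x < M"
    and "i < length gs"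
  shows "gval k gs i \<subseteq> univ k \<and> truncation_invariant k (2 ^ (length gs - i) * M) (gval k gs i)"
  using \<open>i < length gs\<close>
proof (induction "length gs - i" arbitrary: i rule: less_induct)
  case less
  let ?N = "\<lambda>i. 2 ^ (length gs - i) * M"
  have next_le: "2 * ?N j \<le> ?N i" if "i < j" "j < length gs" for j
  proof -
    have "(2::nat) ^ Suc (length gs - j) \<le> 2 ^ (length gs - i)"
      by (rule power_increasing) (use that in auto)
    then show ?thesis by simp
  qed
  note wfi = wf_gates[OF wf less.prems]
  show ?case
  proof (cases "gs ! i")
    case (Inp a)
    have "1 * M \<le> ?N i" by (rule mult_le_mono1) simp
    then have M_le: "M \<le> ?N i" by simp
    have "\<forall>x\<in>set v. x < ?N i" if "a = Fin v" for v
    proof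
      fix x assume "x \<in> set v"
      then have "x < M" using M[OF less.prems, of v] Inp that by blast
      then show "x < ?N i" using M_le by (rule less_le_trans)
    qed
    then show ?thesis
      using wfi(1)[OF Inp] truncation_invariant_singleton[of a] by (simp add: gval_Inp[OF less.prems Inp])
  next
    case (Neg j)
    then have j: "i < j" "j < length gs" using wfi(2) by auto
    have "truncation_invariant k (?N j) (gval k gs j)"
      using less.hyps[of j] j less.prems by auto
    moreover have "?N j \<le> ?N i" using next_le[OF j] by linarith
    ultimately have "truncation_invariant k (?N i) (univ k - gval k gs j)"
      by (intro truncation_invariant_compl) (rule truncation_invariant_mono)
    then show ?thesis by (simp add: gval_Neg[OF less.prems Neg j(1)])
  next
    case (Bin f j l)
    then have jl: "i < j" "j < length gs" "i < l" "l < length gs" using wfi(3) by auto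
    let ?A = "gval k gs j" and ?B = "gval k gs l"
    have A: "?A \<subseteq> univ k" "truncation_invariant k (?N j) ?A"
      using less.hyps[of j] jl less.prems by auto
    have B: "?B \<subseteq> univ k" "truncation_invariant k (?N l) ?B"
      using less.hyps[of l] jl less.prems by auto
    have N: "?N j + ?N l \<le> ?N i" "?N j \<le> ?N i" "?N l \<le> ?N i"
      using next_le[of j] next_le[of l] jl by linarith+
    have A': "truncation_invariant k (?N i) ?A" using truncation_invariant_mono[OF A(2) N(2)] .
    have B': "truncation_invariant k (?N i) ?B" using truncation_invariant_mono[OF B(2) N(3)] .
    have "truncation_invariant k (?N i) (bop_sem f ?A ?B)"
    proof (cases f)
      case BPlus
      then show ?thesis
        using truncation_invariant_mono[OF truncation_invariant_plus[OF A(1) B(1) A(2) B(2)] N(1)] by simp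
    next
      case BMinus
      then show ?thesis using truncation_invariant_minus[OF A(1) B(1) A'] by simp
    qed (use A' B' in \<open>auto simp: truncation_invariant_def\<close>)
    then show ?thesis
      using bop_sem_subset_univ[OF A(1) B(1)] by (simp add: gval_Bin[OF less.prems Bin jl(1,3)])
  qed
qed

text \<open>Without a vector among the labels the dimension is not determined by the circuit, but then it
  does not matter.\<close>

lemma gval_dimension_irrelevant:
  assumes wf: "wf_circuit Ops k gs out" "wf_circuit Ops k' gs out"
    and lab: "\<And>i a. i < length gs \<Longrightarrow> gs ! i = Inp a \<Longrightarrow> a = Infty"
    and "i < length gs"
  shows "(Infty \<in> gval k gs i \<longleftrightarrow> Infty \<in> gval k' gs i) \<and>
    (\<forall>v v'. length v = k \<longrightarrow> length v' = k' \<longrightarrow> (Fin v \<in> gval k gs i \<longleftrightarrow> Fin v' \<in> gval k' gs i))"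
  using \<open>i < length gs\<close>
proof (induction "length gs - i" arbitrary: i rule: less_induct)
  case less
  note wfi = wf_gates[OF wf(1) less.prems]
  have sub: "gval K gs j \<subseteq> univ K" if "j < length gs" "wf_circuit Ops K gs out" for j K
  proof -
    \<comment> \<open>Only the inclusion in \<open>univ K\<close> is wanted; without vector labels,
      \<open>M = 0\<close> satisfies the label condition vacuously.\<close>
    have no_Fin: "\<forall>x\<in>set v. x < 0" if "i < length gs" "gs ! i = Inp (Fin v)" for i v
      using lab[OF that] by simp
    show ?thesis
      by (rule gval_truncation_invariant[where M = 0, OF that(2) _ that(1), THEN conjunct1]) (rule no_Fin)
  qed
  show ?case
  proof (cases "gs ! i")
    case (Inp a)
    then show ?thesis using lab[OF less.prems Inp] by (simp add: gval_Inp[OF less.prems Inp])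
  next
    case (Neg j)
    then have j: "i < j" "j < length gs" using wfi(2) by auto
    then show ?thesis using less.hyps[of j] less.prems by (auto simp: gval_Neg[OF less.prems Neg j(1)])
  next
    case (Bin f j l)
    then have jl: "i < j" "j < length gs" "i < l" "l < length gs" using wfi(3) by auto
    let ?A = "gval k gs j" and ?B = "gval k gs l" and ?A' = "gval k' gs j" and ?B' = "gval k' gs l"
    have IH: "Infty \<in> ?A \<longleftrightarrow> Infty \<in> ?A'" "Infty \<in> ?B \<longleftrightarrow> Infty \<in> ?B'"
      "\<And>v v'. length v = k \<Longrightarrow> length v' = k' \<Longrightarrow> Fin v \<in> ?A \<longleftrightarrow> Fin v' \<in> ?A'"
      "\<And>v v'. length v = k \<Longrightarrow> length v' = k' \<Longrightarrow> Fin v \<in> ?B \<longleftrightarrow> Fin v' \<in> ?B'"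
      using less.hyps[of j] less.hyps[of l] jl less.prems by auto
    note s = sub[OF jl(2) wf(1)] sub[OF jl(4) wf(1)] sub[OF jl(2) wf(2)] sub[OF jl(4) wf(2)]
    have len: "Fin v \<in> ?A \<Longrightarrow> length v = k" "Fin v \<in> ?B \<Longrightarrow> length v = k"
      "Fin v \<in> ?A' \<Longrightarrow> length v = k'" "Fin v \<in> ?B' \<Longrightarrow> length v = k'" for v using s by auto
    \<comment> \<open>By induction a gate contains all vectors or none, so the zero vector can
      represent them all; it also splits any vector trivially into two summands.\<close>
    define z z' where "z = replicate k (0::nat)" and "z' = replicate k' (0::nat)"
    have z: "length z = k" "length z' = k'" by (simp_all add: z_def z'_def)
    have fin: "Fin v \<in> ?A \<longleftrightarrow> Fin z \<in> ?A" "Fin v \<in> ?B \<longleftrightarrow> Fin z \<in> ?B" if "length v = k" for v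
      using IH(3,4)[OF that z(2)] IH(3,4)[OF z] by auto
    have fin': "Fin v \<in> ?A' \<longleftrightarrow> Fin z \<in> ?A" "Fin v \<in> ?B' \<longleftrightarrow> Fin z \<in> ?B" if "length v = k'" for v
      using IH(3,4)[OF z(1) that] by auto
    have ne: "?A \<noteq> {} \<longleftrightarrow> Infty \<in> ?A \<or> Fin z \<in> ?A" "?B \<noteq> {} \<longleftrightarrow> Infty \<in> ?B \<or> Fin z \<in> ?B"
      "?A' \<noteq> {} \<longleftrightarrow> Infty \<in> ?A \<or> Fin z \<in> ?A" "?B' \<noteq> {} \<longleftrightarrow> Infty \<in> ?B \<or> Fin z \<in> ?B"
      using fin fin' len IH(1,2) z by (metis all_not_in_conv ext.exhaust)+
    have ex: "(\<exists>b. Fin b \<in> ?B) \<longleftrightarrow> Fin z \<in> ?B" "(\<exists>b. Fin b \<in> ?B') \<longleftrightarrow> Fin z \<in> ?B"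
      using fin fin' len z by metis+
    have inf: "Infty \<in> bop_sem f ?A ?B \<longleftrightarrow> Infty \<in> bop_sem f ?A' ?B'"
      by (cases f) (simp_all add: IH(1,2) Infty_in_set_plus Infty_in_set_minus ne ex)
    have "Fin v \<in> bop_sem f ?A ?B \<longleftrightarrow> Fin v' \<in> bop_sem f ?A' ?B'" if v: "length v = k" "length v' = k'" for v v'
    proof (cases f)
      case BPlus
      have split: "v = map2 (+) v z" "v' = map2 (+) v' z'"
        using v by (auto simp: z_def z'_def intro: nth_equalityI)
      have "Fin v \<in> set_plus ?A ?B \<longleftrightarrow> Fin z \<in> ?A \<and> Fin z \<in> ?B"
        unfolding Fin_in_set_plus using fin len split(1) v(1) z by metis
      moreover have "Fin v' \<in> set_plus ?A' ?B' \<longleftrightarrow> Fin z \<in> ?A \<and> Fin z \<in> ?B"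
        unfolding Fin_in_set_plus using fin' len split(2) v(2) z by metis
      ultimately show ?thesis by (simp add: BPlus)
    next
      case BMinus
      have "Fin v \<in> set_minus ?A ?B \<longleftrightarrow> Fin z \<in> ?A \<and> Fin z \<in> ?B"
      proof -
        have "Fin (map2 (+) v b) \<in> ?A \<longleftrightarrow> Fin z \<in> ?A" if "length b = k" for b
          using fin(1)[of "map2 (+) v b"] v that by simp
        then show ?thesis unfolding Fin_in_set_minus[OF s(1,2)] using fin(2) v(1) z(1) by blast
      qed
      moreover have "Fin v' \<in> set_minus ?A' ?B' \<longleftrightarrow> Fin z \<in> ?A \<and> Fin z \<in> ?B"
      proof -
        have "Fin (map2 (+) v' b) \<in> ?A' \<longleftrightarrow> Fin z \<in> ?A" if "length b = k'" for b
          using fin'(1)[of "map2 (+) v' b"] v that by simp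
        then show ?thesis unfolding Fin_in_set_minus[OF s(3,4)] using fin'(2) v(2) z(2) by blast
      qed
      ultimately show ?thesis by (simp add: BMinus)
    qed (use IH(3,4)[OF v] in auto)
    then show ?thesis
      using inf by (simp add: gval_Bin[OF less.prems Bin jl(1,3)])
  qed
qed

section \<open>Membership as a game\<close>

definition box :: "nat \<Rightarrow> nat \<Rightarrow> ext set" where
  "box k N = {Fin v | v. length v = k \<and> (\<forall>x\<in>set v. x \<le> N)} \<union> {Infty}"

text \<open>Summands of a vector in the box stay in the box. A minuend \<open>c + b\<close> may
  leave it, so its truncation is used as the claim instead.\<close>

fun decomp :: "nat \<Rightarrow> bop \<Rightarrow> ext \<Rightarrow> ext \<Rightarrow> ext \<Rightarrow> bool" where
  "decomp N BPlus x u v \<longleftrightarrow> ext_plus u v = x"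
| "decomp N BMinus Infty Infty (Fin b) \<longleftrightarrow> True"
| "decomp N BMinus (Fin c) (Fin a) (Fin b) \<longleftrightarrow> a = map (min N) (map2 (+) c b)"
| "decomp N f x u v \<longleftrightarrow> False"

lemma agree_truncate: "length c = k \<Longrightarrow> agree k N c (map (min N) c)"
  by (auto simp: agree_def)

lemma Fin_in_box: "Fin v \<in> box k N \<longleftrightarrow> length v = k \<and> (\<forall>x\<in>set v. x \<le> N)"
  and Infty_in_box [simp]: "Infty \<in> box k N"
  by (auto simp: box_def)

lemma truncate_in_box: "length v = k \<Longrightarrow> Fin (map (min N) v) \<in> box k N"
  by (auto simp: Fin_in_box)

lemma in_set_plus_iff_decomp:
  assumes sub: "A \<subseteq> univ k" "B \<subseteq> univ k"
    and A: "truncation_invariant k N A" and B: "truncation_invariant k N B" and x: "x \<in> box k N"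
  shows "x \<in> set_plus A B \<longleftrightarrow> (\<exists>u\<in>box k N. \<exists>v\<in>box k N. decomp N BPlus x u v \<and> u \<in> A \<and> v \<in> B)"
proof
  assume mem: "x \<in> set_plus A B"
  \<comment> \<open>For infinity as a sum, the second summand is any element of its set; truncation
    moves it into the box.\<close>
  have tr: "\<exists>v\<in>box k N. v \<in> S" if S: "S \<noteq> {}" "S \<subseteq> univ k" "truncation_invariant k N S" for S
  proof -
    obtain v where v: "v \<in> S" using S(1) by blast
    show ?thesis
    proof (cases v)
      case (Fin c)
      then have "length c = k" using v S by auto
      then show ?thesis
        using v Fin truncation_invariantD[OF S(3) agree_truncate, of c] truncate_in_box[of c k] by blast
    qed (use v in \<open>auto intro: bexI[of _ Infty]\<close>)
  qed
  show "\<exists>u\<in>box k N. \<exists>v\<in>box k N. decomp N BPlus x u v \<and> u \<in> A \<and> v \<in> B"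
  proof (cases x)
    case (Fin c)
    then obtain a b where ab: "Fin a \<in> A" "Fin b \<in> B" "c = map2 (+) a b"
      using mem by (auto simp: Fin_in_set_plus)
    have len: "length a = k" "length b = k" using ab sub by auto
    have "a ! i + b ! i \<le> N" if "i < k" for i
    proof -
      have "c ! i \<in> set c" using len that ab(3) by (intro nth_mem) simp
      then have "c ! i \<le> N" using x by (simp add: Fin Fin_in_box)
      then show ?thesis using len that ab(3) by simp
    qed
    then have "a ! i \<le> N" "b ! i \<le> N" if "i < k" for i using that add_leD1 add_leD2 by blast+
    then have "Fin a \<in> box k N" "Fin b \<in> box k N" using len by (auto simp: Fin_in_box in_set_conv_nth)
    then show ?thesis using ab Fin by (intro bexI[of _ "Fin a"] bexI[of _ "Fin b"]) auto
  next
    case Infty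
    have inf: "ext_plus y Infty = Infty" for y by (cases y) auto
    from mem consider "Infty \<in> A" "B \<noteq> {}" | "A \<noteq> {}" "Infty \<in> B"
      unfolding Infty Infty_in_set_plus by blast
    then show ?thesis
    proof cases
      case 1
      then obtain v where "v \<in> box k N" "v \<in> B" using tr[OF _ sub(2) B] by blast
      then show ?thesis using 1 Infty by (intro bexI[of _ Infty] bexI[of _ v]) auto
    next
      case 2
      then obtain u where "u \<in> box k N" "u \<in> A" using tr[OF _ sub(1) A] by blast
      then show ?thesis using 2 Infty inf by (intro bexI[of _ u] bexI[of _ Infty]) auto
    qed
  qed
qed (auto simp: set_plus_def)

lemma in_set_minus_iff_decomp:
  assumes sub: "A \<subseteq> univ k" "B \<subseteq> univ k"
    and A: "truncation_invariant k N A" and B: "truncation_invariant k N B" and x: "x \<in> box k N"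
  shows "x \<in> set_minus A B \<longleftrightarrow> (\<exists>u\<in>box k N. \<exists>v\<in>box k N. decomp N BMinus x u v \<and> u \<in> A \<and> v \<in> B)"
proof (cases x)
  case Infty
  show ?thesis
  proof
    assume "x \<in> set_minus A B"
    then obtain b where b: "Infty \<in> A" "Fin b \<in> B" by (auto simp: Infty Infty_in_set_minus)
    then have len: "length b = k" using sub by auto
    then have "Fin (map (min N) b) \<in> B" "Fin (map (min N) b) \<in> box k N"
      using b(2) truncation_invariantD[OF B agree_truncate[OF len]] truncate_in_box[OF len] by blast+
    then show "\<exists>u\<in>box k N. \<exists>v\<in>box k N. decomp N BMinus x u v \<and> u \<in> A \<and> v \<in> B"
      using b Infty by (intro bexI[of _ Infty] bexI[of _ "Fin (map (min N) b)"]) auto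
  next
    assume "\<exists>u\<in>box k N. \<exists>v\<in>box k N. decomp N BMinus x u v \<and> u \<in> A \<and> v \<in> B"
    then obtain u v where "decomp N BMinus Infty u v" "u \<in> A" "v \<in> B" by (auto simp: Infty)
    then show "x \<in> set_minus A B" unfolding Infty Infty_in_set_minus by (cases u; cases v) auto
  qed
next
  case (Fin c)
  then have c: "length c = k" using x by (simp add: Fin_in_box)
  have sat: "Fin (map (min N) (map2 (+) c b)) \<in> A \<longleftrightarrow> Fin (map2 (+) c b) \<in> A" if "length b = k" for b
    using truncation_invariantD[OF A agree_truncate[of "map2 (+) c b"]] that c by simp
  have "x \<in> set_minus A B \<longleftrightarrow> (\<exists>b. length b = k \<and> Fin b \<in> B \<and> Fin (map2 (+) c b) \<in> A)"
    using c by (simp add: Fin Fin_in_set_minus[OF sub])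
  also have "\<dots> \<longleftrightarrow> (\<exists>b. Fin b \<in> box k N \<and> Fin b \<in> B \<and> Fin (map (min N) (map2 (+) c b)) \<in> A)"
  proof
    assume "\<exists>b. length b = k \<and> Fin b \<in> B \<and> Fin (map2 (+) c b) \<in> A"
    then obtain b where b: "length b = k" "Fin b \<in> B" "Fin (map2 (+) c b) \<in> A" by blast
    let ?b = "map (min N) b"
    \<comment> \<open>Where truncation changes \<open>b\<close>, both sums are at least
      \<open>N\<close>.\<close>
    have "agree k N (map2 (+) c b) (map2 (+) c ?b)" using b(1) c by (auto simp: agree_def)
    then have "Fin (map2 (+) c ?b) \<in> A" using truncation_invariantD[OF A] b(3) by blast
    moreover have "Fin ?b \<in> B" using truncation_invariantD[OF B agree_truncate[OF b(1)]] b(2) by blast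
    ultimately show "\<exists>b. Fin b \<in> box k N \<and> Fin b \<in> B \<and> Fin (map (min N) (map2 (+) c b)) \<in> A"
      using truncate_in_box[OF b(1)] sat[of ?b] b(1) by (intro exI[of _ ?b]) simp
  qed (use sat in \<open>auto simp: Fin_in_box\<close>)
  also have "\<dots> \<longleftrightarrow> (\<exists>u\<in>box k N. \<exists>v\<in>box k N. decomp N BMinus x u v \<and> u \<in> A \<and> v \<in> B)"
  proof
    assume "\<exists>b. Fin b \<in> box k N \<and> Fin b \<in> B \<and> Fin (map (min N) (map2 (+) c b)) \<in> A"
    then obtain b where b: "Fin b \<in> box k N" "Fin b \<in> B" "Fin (map (min N) (map2 (+) c b)) \<in> A" by blast
    then have "Fin (map (min N) (map2 (+) c b)) \<in> box k N"
      using c by (intro truncate_in_box) (simp add: Fin_in_box)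
    then show "\<exists>u\<in>box k N. \<exists>v\<in>box k N. decomp N BMinus x u v \<and> u \<in> A \<and> v \<in> B"
      using b Fin by (intro bexI[of _ "Fin (map (min N) (map2 (+) c b))"] bexI[of _ "Fin b"]) auto
  next
    assume "\<exists>u\<in>box k N. \<exists>v\<in>box k N. decomp N BMinus x u v \<and> u \<in> A \<and> v \<in> B"
    then obtain u v where "u \<in> A" "v \<in> B" "v \<in> box k N" "decomp N BMinus (Fin c) u v" using Fin by auto
    then show "\<exists>b. Fin b \<in> box k N \<and> Fin b \<in> B \<and> Fin (map (min N) (map2 (+) c b)) \<in> A"
      by (cases u; cases v) auto
  qed
  finally show ?thesis .
qed

section \<open>Arithmetic coding of the game\<close>

text \<open>For an input of length \<open>n\<close>, the parameter \<open>m\<close> is \<open>2 ^ n - 1\<close>. Labels and thresholds are below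
  \<^term>\<open>base m\<close>, the base for vectors; \<^term>\<open>bound m\<close> exceeds all codes of vectors and is the base for
  the components of positions and for arrays. Code \<open>0\<close> is infinity.\<close>

definition base :: "nat \<Rightarrow> nat" where
  "base m = (m + 1) * (m + 1) + 1"

definition bound :: "nat \<Rightarrow> nat" where
  "bound m = base m ^ min (bit_len m) (bit_len m) * base m"

text \<open>The cap serves computability only: vector indices and gate numbers that matter are at
  most \<open>bit_len m\<close>.\<close>

definition digit :: "nat \<Rightarrow> nat \<Rightarrow> nat \<Rightarrow> nat \<Rightarrow> nat" where
  "digit m B i x = x div B ^ min i (bit_len m) mod B"

definition entry :: "nat \<Rightarrow> nat \<Rightarrow> nat \<Rightarrow> nat" where
  "entry m i x = digit m (base m) i (x - 1)"

definition decode :: "nat \<Rightarrow> nat \<Rightarrow> nat \<Rightarrow> ext" where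
  "decode m k x = (if x = 0 then Infty else Fin (map (\<lambda>i. entry m i x) [0..<k]))"

lemma ex_digits:
  assumes "\<forall>i<n. f i < (B::nat)"
  shows "\<exists>x<B ^ n. \<forall>i<n. x div B ^ i mod B = f i"
  using assms
proof (induction n arbitrary: f)
  case (Suc n)
  have "\<forall>i<n. f (Suc i) < B" using Suc.prems by simp
  from Suc.IH[OF this] obtain x where x: "x < B ^ n" "\<forall>i<n. x div B ^ i mod B = f (Suc i)" by blast
  have f0: "f 0 < B" using Suc.prems by simp
  have "Suc x * B \<le> B ^ n * B" using x(1) by (intro mult_le_mono1) simp
  then have "f 0 + B * x < B ^ Suc n" using f0 by (simp add: mult.commute)
  moreover have "(f 0 + B * x) div B ^ i mod B = f i" if "i < Suc n" for i
  proof (cases i)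
    case (Suc j)
    then show ?thesis using x(2) that f0 by (simp add: div_mult2_eq)
  qed (use f0 in simp)
  ultimately show ?case by blast
qed simp

lemma base_ge: "2 \<le> base m"
  by (simp add: base_def)

lemma bound_eq: "bound m = base m ^ Suc (bit_len m)"
  by (simp add: bound_def mult.commute)

lemma bound_gt: "bit_len m < bound m" "0 < bound m"
proof -
  have "bit_len m < 2 ^ bit_len m" by simp
  also have "\<dots> \<le> base m ^ bit_len m" by (rule power_mono[OF base_ge]) simp
  also have "\<dots> \<le> bound m" unfolding bound_eq by (rule power_increasing) (use base_ge[of m] in auto)
  finally show "bit_len m < bound m" "0 < bound m" by auto
qed

lemma decode_in_box: "decode m k x \<in> box k (base m - 1)"
proof -
  have "entry m i x \<le> base m - 1" for i
  proof -
    have "entry m i x < base m"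
      unfolding entry_def digit_def by (rule mod_less_divisor) (use base_ge[of m] in simp)
    then show ?thesis by linarith
  qed
  then show ?thesis by (auto simp: decode_def Fin_in_box)
qed

lemma decode_in_univ: "decode m k x \<in> univ k"
  by (simp add: decode_def)

lemma ex_decode:
  assumes "k \<le> bit_len m" "y \<in> box k (base m - 1)"
  shows "\<exists>x<bound m. decode m k x = y"
proof (cases y)
  case Infty
  then show ?thesis using bound_gt by (intro exI[of _ 0]) (simp add: decode_def)
next
  case (Fin v)
  then have v: "length v = k" "\<forall>x\<in>set v. x \<le> base m - 1" using assms by (auto simp: Fin_in_box)
  have "\<forall>i<k. v ! i < base m"
  proof (intro allI impI)
    fix i assume "i < k"
    then have "v ! i \<le> base m - 1" using v nth_mem by blast
    then show "v ! i < base m" using base_ge[of m] by linarith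
  qed
  from ex_digits[OF this] obtain x where x: "x < base m ^ k" "\<forall>i<k. x div base m ^ i mod base m = v ! i" by blast
  \<comment> \<open>The additional factor in \<open>bound m\<close> leaves room for the shift by one
    that frees code 0 for infinity.\<close>
  have "base m ^ k < bound m" unfolding bound_eq
    by (rule power_strict_increasing) (use assms base_ge[of m] in auto)
  then have "Suc x < bound m" using x(1) by simp
  moreover have "decode m k (Suc x) = y"
    using x(2) v assms(1) Fin by (auto simp: decode_def entry_def digit_def min_def intro!: nth_equalityI)
  ultimately show ?thesis by blast
qed

text \<open>Codes are not unique, since digits from \<open>k\<close> on are ignored by
  \<open>decode\<close>; so entries are compared instead of numbers.\<close>

definition code_eq :: "nat \<Rightarrow> nat \<Rightarrow> nat \<Rightarrow> nat \<Rightarrow> bool" where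
  "code_eq m k x y \<longleftrightarrow> (x = 0 \<longleftrightarrow> y = 0) \<and> (\<forall>i<k. entry m i x = entry m i y)"

definition code_plus :: "nat \<Rightarrow> nat \<Rightarrow> nat \<Rightarrow> nat \<Rightarrow> nat \<Rightarrow> bool" where
  "code_plus m k x u v \<longleftrightarrow> x = 0 \<and> (u = 0 \<or> v = 0) \<or>
     x \<noteq> 0 \<and> u \<noteq> 0 \<and> v \<noteq> 0 \<and> (\<forall>i<k. entry m i x = entry m i u + entry m i v)"

definition code_minus :: "nat \<Rightarrow> nat \<Rightarrow> nat \<Rightarrow> nat \<Rightarrow> nat \<Rightarrow> bool" where
  "code_minus m k x u v \<longleftrightarrow> x = 0 \<and> u = 0 \<and> v \<noteq> 0 \<or>
     x \<noteq> 0 \<and> u \<noteq> 0 \<and> v \<noteq> 0 \<and> (\<forall>i<k. entry m i u = min (base m - 1) (entry m i x + entry m i v))"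

lemma code_eq_iff: "code_eq m k x y \<longleftrightarrow> decode m k x = decode m k y"
  by (auto simp: code_eq_def decode_def entry_def)

lemma map2_map: "map2 f (map g xs) (map h xs) = map (\<lambda>x. f (g x) (h x)) xs"
  by (induction xs) auto

lemma code_plus_iff: "code_plus m k x u v \<longleftrightarrow> decomp N BPlus (decode m k x) (decode m k u) (decode m k v)"
  by (auto simp: code_plus_def decode_def map2_map)

lemma code_minus_iff:
  "code_minus m k x u v \<longleftrightarrow> decomp (base m - 1) BMinus (decode m k x) (decode m k u) (decode m k v)"
  by (auto simp: code_minus_def decode_def map2_map)

text \<open>A position is a number with components \<open>kind\<close>, \<open>gate1\<close>, \<open>gate2\<close>, \<open>code1\<close>, \<open>code2\<close>. The player to
  move claims, in kind 0, that \<open>code1\<close> is in the set of \<open>gate1\<close> and, in kind 1, that \<open>code1\<close> is not in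
  the set of \<open>gate1\<close> or \<open>code2\<close> is not in the set of \<open>gate2\<close>; in kind 2 the player has lost.\<close>

definition "kind p = p mod (4::nat)"
definition "gate1 m p = p div 4 mod bound m"
definition "gate2 m p = p div 4 div bound m mod bound m"
definition "code1 m p = p div 4 div bound m div bound m mod bound m"
definition "code2 m p = p div 4 div bound m div bound m div bound m mod bound m"
definition "positions m = 4 * (bound m * bound m * bound m * bound m)"

lemma ex_position:
  assumes "\<kappa> < 4" "j < bound m" "l < bound m" "u < bound m" "v < bound m"
  shows "\<exists>p<positions m. kind p = \<kappa> \<and> gate1 m p = j \<and> gate2 m p = l \<and> code1 m p = u \<and> code2 m p = v"
proof (intro exI conjI)
  let ?H = "bound m"
  let ?p = "\<kappa> + 4 * (j + ?H * (l + ?H * (u + ?H * v)))"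
  have step: "a + B * x < B * C" if "a < B" "x < C" for a B x C :: nat
  proof -
    have "B * Suc x \<le> B * C" using that(2) by (intro mult_le_mono2) simp
    then show ?thesis using that(1) by simp
  qed
  have "?p < 4 * (?H * (?H * (?H * ?H)))"
    by (intro step assms)
  then show "?p < positions m" by (simp add: positions_def mult_ac)
qed (use assms in \<open>simp_all add: kind_def gate1_def gate2_def code1_def code2_def
    del: distrib_left_numeral\<close>)

text \<open>Replaces a move, which is a number, by gates and truncated vectors, so that the game can
  be analysed without codes.\<close>

lemma ex_position_iff:
  assumes "k \<le> bit_len m" "\<kappa> < 4"
  shows "(\<exists>c<positions m. kind c = \<kappa> \<and> \<Phi> (gate1 m c) (gate2 m c) (decode m k (code1 m c)) (decode m k (code2 m c))) \<longleftrightarrow>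
    (\<exists>j<bound m. \<exists>l<bound m. \<exists>u\<in>box k (base m - 1). \<exists>v\<in>box k (base m - 1). \<Phi> j l u v)"
proof
  assume "\<exists>c<positions m. kind c = \<kappa> \<and> \<Phi> (gate1 m c) (gate2 m c) (decode m k (code1 m c)) (decode m k (code2 m c))"
  moreover have "gate1 m c < bound m" "gate2 m c < bound m" for c
    using bound_gt by (simp_all add: gate1_def gate2_def)
  ultimately show "\<exists>j<bound m. \<exists>l<bound m. \<exists>u\<in>box k (base m - 1). \<exists>v\<in>box k (base m - 1). \<Phi> j l u v"
    using decode_in_box by blast
next
  assume "\<exists>j<bound m. \<exists>l<bound m. \<exists>u\<in>box k (base m - 1). \<exists>v\<in>box k (base m - 1). \<Phi> j l u v"
  then obtain j l u v where *: "j < bound m" "l < bound m" "u \<in> box k (base m - 1)"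
    "v \<in> box k (base m - 1)" "\<Phi> j l u v" by blast
  obtain x where x: "x < bound m" "decode m k x = u" using ex_decode[OF assms(1) *(3)] by blast
  obtain y where y: "y < bound m" "decode m k y = v" using ex_decode[OF assms(1) *(4)] by blast
  obtain p where "p < positions m" "kind p = \<kappa>" "gate1 m p = j" "gate2 m p = l" "code1 m p = x" "code2 m p = y"
    using ex_position[OF assms(2) *(1,2) x(1) y(1)] by blast
  then show "\<exists>c<positions m. kind c = \<kappa> \<and> \<Phi> (gate1 m c) (gate2 m c) (decode m k (code1 m c)) (decode m k (code2 m c))"
    using * x y by blast
qed

section \<open>Circuits in arrays and the rules of the game\<close>

text \<open>Types 2 to 5 are \<open>bop_code\<close> plus 2. Types from 6 on would also read as
  \<open>BMinus\<close> and are excluded by \<open>valid\<close>.\<close>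

definition make_gate :: "nat \<Rightarrow> nat \<Rightarrow> nat \<Rightarrow> nat \<Rightarrow> nat \<Rightarrow> nat \<Rightarrow> gate" where
  "make_gate m k ty j l x =
    (if ty = 0 then Inp (decode m k x)
     else if ty = 1 then Neg j
     else Bin (if ty = 2 then BUn else if ty = 3 then BInt else if ty = 4 then BPlus else BMinus) j l)"

text \<open>The arrays \<open>TY\<close>, \<open>J\<close>, \<open>L\<close> and \<open>X\<close> contain the types, first and second predecessors, and labels of
  the gates.\<close>

definition decode_gate :: "nat \<Rightarrow> nat \<Rightarrow> nat \<Rightarrow> nat \<Rightarrow> nat \<Rightarrow> nat \<Rightarrow> nat \<Rightarrow> gate" where
  "decode_gate m k TY J L X g = make_gate m k (digit m (bound m) g TY) (digit m (bound m) g J)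
     (digit m (bound m) g L) (digit m (bound m) g X)"

text \<open>A true claim at an input gate is cashed in by moving to kind 2, where the opponent is
  stuck. At a complement gate the opponent has to defend the same element at the
  predecessor.\<close>

definition legal :: "nat \<Rightarrow> nat \<Rightarrow> nat \<Rightarrow> nat \<Rightarrow> nat \<Rightarrow> nat \<Rightarrow> nat \<Rightarrow> nat \<Rightarrow> bool" where
  "legal m k TY J L X p c \<longleftrightarrow>
    kind p = 0 \<and> digit m (bound m) (gate1 m p) TY = 0 \<and>
      code_eq m k (code1 m p) (digit m (bound m) (gate1 m p) X) \<and> kind c = 2 \<or>
    kind p = 0 \<and> digit m (bound m) (gate1 m p) TY = 1 \<and>
      kind c = 0 \<and> gate1 m c = digit m (bound m) (gate1 m p) J \<and> code_eq m k (code1 m c) (code1 m p) \<or>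
    kind p = 0 \<and> digit m (bound m) (gate1 m p) TY = 2 \<and>
      kind c = 1 \<and> gate1 m c = gate2 m c \<and>
      (gate1 m c = digit m (bound m) (gate1 m p) J \<or> gate1 m c = digit m (bound m) (gate1 m p) L) \<and>
      code_eq m k (code1 m c) (code1 m p) \<and> code_eq m k (code2 m c) (code1 m p) \<or>
    kind p = 0 \<and> 2 < digit m (bound m) (gate1 m p) TY \<and>
      kind c = 1 \<and> gate1 m c = digit m (bound m) (gate1 m p) J \<and> gate2 m c = digit m (bound m) (gate1 m p) L \<and>
      (digit m (bound m) (gate1 m p) TY = 3 \<and>
         code_eq m k (code1 m c) (code1 m p) \<and> code_eq m k (code2 m c) (code1 m p) \<or>
       digit m (bound m) (gate1 m p) TY = 4 \<and> code_plus m k (code1 m p) (code1 m c) (code2 m c) \<or>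
       4 < digit m (bound m) (gate1 m p) TY \<and> code_minus m k (code1 m p) (code1 m c) (code2 m c)) \<or>
    kind p = 1 \<and> kind c = 0 \<and>
      (gate1 m c = gate1 m p \<and> code_eq m k (code1 m c) (code1 m p) \<or>
       gate1 m c = gate2 m p \<and> code_eq m k (code1 m c) (code2 m p))"

text \<open>A union is played by claiming membership in the chosen predecessor twice, so that every
  binary gate leads to a position of kind 1.\<close>

fun split_move :: "nat \<Rightarrow> bop \<Rightarrow> nat \<Rightarrow> nat \<Rightarrow> ext \<Rightarrow> nat \<Rightarrow> nat \<Rightarrow> ext \<Rightarrow> ext \<Rightarrow> bool" where
  "split_move N BUn j l x j' l' u v \<longleftrightarrow> j' = l' \<and> (j' = j \<or> j' = l) \<and> u = x \<and> v = x"
| "split_move N BInt j l x j' l' u v \<longleftrightarrow> j' = j \<and> l' = l \<and> u = x \<and> v = x"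
| "split_move N f j l x j' l' u v \<longleftrightarrow> j' = j \<and> l' = l \<and> decomp N f x u v"

lemma legal_kind0:
  assumes "kind p = 0"
  shows "legal m k TY J L X p c \<longleftrightarrow> (case decode_gate m k TY J L X (gate1 m p) of
      Inp a \<Rightarrow> decode m k (code1 m p) = a \<and> kind c = 2
    | Neg j \<Rightarrow> kind c = 0 \<and> gate1 m c = j \<and> decode m k (code1 m c) = decode m k (code1 m p)
    | Bin f j l \<Rightarrow> kind c = 1 \<and> split_move (base m - 1) f j l (decode m k (code1 m p)) (gate1 m c) (gate2 m c)
        (decode m k (code1 m c)) (decode m k (code2 m c)))"
  unfolding legal_def decode_gate_def make_gate_def code_eq_iff code_plus_iff[where N = "base m - 1"] code_minus_iff
  using assms by auto

lemma legal_kind1: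
  assumes "kind p = 1"
  shows "legal m k TY J L X p c \<longleftrightarrow> kind c = 0 \<and>
    (gate1 m c = gate1 m p \<and> decode m k (code1 m c) = decode m k (code1 m p) \<or>
     gate1 m c = gate2 m p \<and> decode m k (code1 m c) = decode m k (code2 m p))"
  unfolding legal_def code_eq_iff using assms by auto

lemma legal_kind2: "kind p = 2 \<Longrightarrow> \<not> legal m k TY J L X p c"
  by (simp add: legal_def)

lemma in_bop_sem_iff_split_move:
  assumes "A j \<subseteq> univ k" "A l \<subseteq> univ k"
    and "truncation_invariant k N (A j)" "truncation_invariant k N (A l)" and "x \<in> box k N" "j < H" "l < H"
  shows "x \<in> bop_sem f (A j) (A l) \<longleftrightarrow>
    (\<exists>j'<H. \<exists>l'<H. \<exists>u\<in>box k N. \<exists>v\<in>box k N. split_move N f j l x j' l' u v \<and> u \<in> A j' \<and> v \<in> A l')"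
proof (cases f)
  case BPlus
  then show ?thesis using in_set_plus_iff_decomp[OF assms(1-5)] assms(6,7) by auto
next
  case BMinus
  then show ?thesis using in_set_minus_iff_decomp[OF assms(1-5)] assms(6,7) by auto
qed (use assms(5-7) in auto)

text \<open>Descending by one gate takes at most two moves, a decomposition and the choice of a
  claim, and the input gate takes one more; hence the condition on \<open>d\<close>. The induction
  follows the gate numbers, which grow towards the inputs.\<close>

lemma win_iff_gval:
  fixes m k G TY J L X :: nat
  defines "gs \<equiv> map (decode_gate m k TY J L X) [0..<G]" and "W \<equiv> win (positions m) (legal m k TY J L X)"
  assumes m: "m + 1 = 2 ^ n" and k: "k \<le> n" and G: "G \<le> n" and wf: "wf_circuit Ops k gs out"
    and lab: "\<And>i v. i < G \<Longrightarrow> gs ! i = Inp (Fin v) \<Longrightarrow> \<forall>x\<in>set v. x \<le> m"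
    and "kind p = 0" "gate1 m p < G" "2 * (G - gate1 m p) < d"
  shows "W d p \<longleftrightarrow> decode m k (code1 m p) \<in> gval k gs (gate1 m p)"
  using assms(8-)
proof (induction "G - gate1 m p" arbitrary: p d rule: less_induct)
  case less
  let ?g = "gate1 m p" and ?x = "decode m k (code1 m p)" and ?N = "base m - 1"
  have n: "bit_len m = n" using m bit_len_mask[of n] by (metis add_diff_cancel_right')
  have len: "length gs = G" by (simp add: gs_def)
  have gs: "gs ! i = decode_gate m k TY J L X i" if "i < G" for i using that by (simp add: gs_def)
  have GH: "G < bound m" using bound_gt[of m] G n by simp
  have kb: "k \<le> bit_len m" using k n by simp
  have inv: "gval k gs i \<subseteq> univ k" "truncation_invariant k ?N (gval k gs i)" if i: "i < G" for i
  proof -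
    have "gval k gs i \<subseteq> univ k \<and> truncation_invariant k (2 ^ (length gs - i) * (m + 1)) (gval k gs i)"
      by (rule gval_truncation_invariant[OF wf]) (use i lab len in \<open>auto simp: less_Suc_eq_le\<close>)
    \<comment> \<open>The origin of \<open>base m\<close>: at most \<open>n\<close> doublings of the
      label bound \<open>m + 1\<close> give at most \<open>(m + 1) * (m + 1)\<close>, which is
      \<open>base m - 1\<close>.\<close>
    moreover have "(2::nat) ^ (length gs - i) \<le> m + 1"
      unfolding m len by (rule power_increasing) (use G in auto)
    then have "2 ^ (length gs - i) * (m + 1) \<le> ?N"
      unfolding base_def by (simp only: add_diff_cancel_right' mult_le_mono1)
    ultimately show "gval k gs i \<subseteq> univ k" "truncation_invariant k ?N (gval k gs i)"
      using truncation_invariant_mono by blast+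
  qed
  have kind2: "\<not> W d' c" if "kind c = 2" for d' c
    using legal_kind2[OF that] by (cases d') (auto simp: W_def)
  have kind0: "W d' c \<longleftrightarrow> decode m k (code1 m c) \<in> gval k gs (gate1 m c)"
    if "kind c = 0" "?g < gate1 m c" "gate1 m c < G" "2 * (G - gate1 m c) < d'" for c d'
    using less.hyps[of c d'] that less.prems by auto
  \<comment> \<open>The mover attacks one of the two claims, so the position is lost exactly if both
    are true.\<close>
  have kind1: "\<not> W d' c \<longleftrightarrow> decode m k (code1 m c) \<in> gval k gs (gate1 m c) \<and> decode m k (code2 m c) \<in> gval k gs (gate2 m c)"
    if c: "kind c = 1" "?g < gate1 m c" "gate1 m c < G" "?g < gate2 m c" "gate2 m c < G"
      and d': "2 * (G - ?g) \<le> d'" for c d'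
  proof -
    obtain d'' where d'': "d' = Suc d''" using d' less.prems by (cases d') auto
    have d1: "2 * (G - gate1 m c) < d''" "2 * (G - gate2 m c) < d''" using d' d'' c by auto
    have "W d' c \<longleftrightarrow> (\<exists>q<positions m. kind q = 0 \<and>
        (gate1 m q = gate1 m c \<and> decode m k (code1 m q) = decode m k (code1 m c) \<or>
         gate1 m q = gate2 m c \<and> decode m k (code1 m q) = decode m k (code2 m c)) \<and> \<not> W d'' q)"
      unfolding d'' W_def win.simps legal_kind1[OF c(1)] by blast
    also have "\<dots> \<longleftrightarrow> (\<exists>q<positions m. kind q = 0 \<and>
        (gate1 m q = gate1 m c \<and> decode m k (code1 m q) = decode m k (code1 m c) \<or>
         gate1 m q = gate2 m c \<and> decode m k (code1 m q) = decode m k (code2 m c)) \<and>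
        decode m k (code1 m q) \<notin> gval k gs (gate1 m q))"
      using kind0[of _ d''] c d1 by metis
    also have "\<dots> \<longleftrightarrow> (\<exists>j<bound m. \<exists>l<bound m. \<exists>u\<in>box k ?N. \<exists>v\<in>box k ?N.
        (j = gate1 m c \<and> u = decode m k (code1 m c) \<or> j = gate2 m c \<and> u = decode m k (code2 m c)) \<and> u \<notin> gval k gs j)"
      by (rule ex_position_iff[OF kb]) simp
    also have "\<dots> \<longleftrightarrow> \<not> (decode m k (code1 m c) \<in> gval k gs (gate1 m c) \<and> decode m k (code2 m c) \<in> gval k gs (gate2 m c))"
    proof -
      have "gate1 m c < bound m" "gate2 m c < bound m" using c GH by auto
      then show ?thesis using decode_in_box[of m k] by blast
    qed
    finally show ?thesis by blast
  qed
  obtain d' where d': "d = Suc d'" "2 * (G - ?g) \<le> d'" using less.prems by (cases d) auto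
  note wfg = wf_gates[OF wf, unfolded len, OF less.prems(2)]
  have g: "?g < length gs" using less.prems len by simp
  have W: "W d p \<longleftrightarrow> (\<exists>c<positions m. legal m k TY J L X p c \<and> \<not> W d' c)"
    by (simp add: W_def d'(1))
  note leg = legal_kind0[OF less.prems(1), of m k TY J L X, folded gs[OF less.prems(2)]]
  show ?case
  proof (cases "gs ! ?g")
    case (Inp a)
    have "W d p \<longleftrightarrow> ?x = a"
    proof
      assume "?x = a"
      \<comment> \<open>The number 2 is itself a position of kind 2.\<close>
      then have "legal m k TY J L X p 2" unfolding leg Inp by (simp add: kind_def)
      moreover have "2 < positions m"
      proof -
        have "0 < bound m * bound m * bound m * bound m" using bound_gt(2)[of m] by simp
        then show ?thesis unfolding positions_def by linarith
      qed
      moreover have "\<not> W d' 2" by (rule kind2) (simp add: kind_def)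
      ultimately show "W d p" unfolding W by blast
    next
      assume "W d p"
      then obtain c where "legal m k TY J L X p c" unfolding W by blast
      then show "?x = a" unfolding leg Inp by simp
    qed
    then show ?thesis by (simp add: gval_Inp[OF g Inp])
  next
    case (Neg j)
    then have j: "?g < j" "j < G" using wfg(2) by auto
    have dj: "2 * (G - j) < d'" using d'(2) j by linarith
    have "W d p \<longleftrightarrow> (\<exists>c<positions m. kind c = 0 \<and> (gate1 m c = j \<and> decode m k (code1 m c) = ?x \<and> ?x \<notin> gval k gs j))"
      unfolding W leg Neg gate.case using kind0[of _ d'] j dj by metis
    also have "\<dots> \<longleftrightarrow> (\<exists>j'<bound m. \<exists>l<bound m. \<exists>u\<in>box k ?N. \<exists>v\<in>box k ?N. j' = j \<and> u = ?x \<and> ?x \<notin> gval k gs j)"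
      by (rule ex_position_iff[OF kb]) simp
    also have "\<dots> \<longleftrightarrow> ?x \<notin> gval k gs j"
      using j GH bound_gt(2)[of m] decode_in_box[of m k] by (meson less_trans)
    finally show ?thesis by (simp add: gval_Neg[OF g Neg j(1)] decode_in_univ)
  next
    case (Bin f j l)
    then have jl: "?g < j" "j < G" "?g < l" "l < G" using wfg(3) by auto
    have sm: "j' \<in> {j, l} \<and> l' \<in> {j, l}" if "split_move N f j l x j' l' u v" for N x j' l' u v
      using that by (cases f) auto
    let ?m = "\<lambda>c. split_move ?N f j l ?x (gate1 m c) (gate2 m c) (decode m k (code1 m c)) (decode m k (code2 m c))"
    have range: "?g < gate1 m c \<and> gate1 m c < G \<and> ?g < gate2 m c \<and> gate2 m c < G" if "?m c" for c
      using sm[OF that] jl by auto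
    have "W d p \<longleftrightarrow> (\<exists>c<positions m. kind c = 1 \<and> ?m c \<and> \<not> W d' c)"
      unfolding W leg Bin gate.case by blast
    also have "\<dots> \<longleftrightarrow> (\<exists>c<positions m. kind c = 1 \<and> (?m c \<and> decode m k (code1 m c) \<in> gval k gs (gate1 m c) \<and>
        decode m k (code2 m c) \<in> gval k gs (gate2 m c)))"
    proof -
      have "kind c = 1 \<and> ?m c \<and> \<not> W d' c \<longleftrightarrow> kind c = 1 \<and> (?m c \<and> decode m k (code1 m c) \<in> gval k gs (gate1 m c) \<and>
        decode m k (code2 m c) \<in> gval k gs (gate2 m c))" for c
        using kind1[of c d'] d'(2) range[of c] by blast
      then show ?thesis by simp
    qed
    also have "\<dots> \<longleftrightarrow> (\<exists>j'<bound m. \<exists>l'<bound m. \<exists>u\<in>box k ?N. \<exists>v\<in>box k ?N.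
        split_move ?N f j l ?x j' l' u v \<and> u \<in> gval k gs j' \<and> v \<in> gval k gs l')"
      by (rule ex_position_iff[OF kb]) simp
    also have "\<dots> \<longleftrightarrow> ?x \<in> bop_sem f (gval k gs j) (gval k gs l)"
      by (rule in_bop_sem_iff_split_move[symmetric])
        (use inv jl GH decode_in_box in auto)
    finally show ?thesis by (simp add: gval_Bin[OF g Bin jl(1,3)])
  qed
qed

section \<open>Arithmetic coding of instances\<close>

definition enc_tokens :: "nat list \<Rightarrow> bool list" where
  "enc_tokens ts = concat (map enc_nat ts)"

lemma enc_tokens_simps [simp]:
  "enc_tokens [] = []" "enc_tokens (z # ts) = enc_nat z @ enc_tokens ts"
  "enc_tokens (ts @ us) = enc_tokens ts @ enc_tokens us"
  by (simp_all add: enc_tokens_def)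

lemma enc_tokens_concat_map: "enc_tokens (concat (map f xs)) = concat (map (\<lambda>x. enc_tokens (f x)) xs)"
  by (induction xs) simp_all

lemma enc_tokens_map: "enc_tokens (map f xs) = concat (map (\<lambda>x. enc_nat (f x)) xs)"
  by (simp add: enc_tokens_def comp_def)

lemma length_concat_map_upt: "length (concat (map f [0..<N])) = (\<Sum>i<N. length (f i))"
  by (induction N) simp_all

lemma num_concat_map_upt:
  "num (concat (map f [0..<N])) = (\<Sum>i<N. 2 ^ (\<Sum>j<i. length (f j)) * num (f i))"
  by (induction N) (simp_all add: num_append length_concat_map_upt)

text \<open>The power of two as an offset in a word. The cap has no effect on words of length at
  most \<open>bit_len m\<close>, the only ones compared.\<close>

definition pow2 :: "nat \<Rightarrow> nat \<Rightarrow> nat" where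
  "pow2 m e = 2 ^ min e (bit_len m)"

lemma num_append_pow2:
  "length (v @ w) \<le> bit_len m \<Longrightarrow> num (v @ w) = num v + pow2 m (length v) * num w"
  by (simp add: num_append pow2_def min_def)

lemma num_concat_map_upt_pow2:
  assumes "length (concat (map f [0..<N])) \<le> bit_len m"
  shows "num (concat (map f [0..<N])) = (\<Sum>i<N. pow2 m (\<Sum>j<i. length (f j)) * num (f i))"
  unfolding num_concat_map_upt
proof (rule sum.cong[OF refl])
  fix i assume "i \<in> {..<N}"
  then have "(\<Sum>j<i. length (f j)) \<le> (\<Sum>j<N. length (f j))" by (intro sum_mono2) auto
  then show "2 ^ (\<Sum>j<i. length (f j)) * num (f i) = pow2 m (\<Sum>j<i. length (f j)) * num (f i)"
    using assms by (simp add: pow2_def min_def length_concat_map_upt)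
qed

definition enc_len :: "nat \<Rightarrow> nat" where
  "enc_len z = 2 * bit_len z + 2"

text \<open>Each binary digit of \<open>z\<close> becomes a pair of bits with value 1 or 3 at offset
  \<open>2 * i\<close>, hence the powers of 4. The terminator consists of zeros and contributes
  nothing.\<close>

definition enc_num :: "nat \<Rightarrow> nat" where
  "enc_num z = (\<Sum>i<bit_len z. 4 ^ min i (bit_len z) * (1 + 2 * (z div 2 ^ min i (bit_len z) mod 2)))"

lemma nth_bin: "i < bit_len z \<Longrightarrow> bin z ! i \<longleftrightarrow> odd (z div 2 ^ i)"
proof (induction z arbitrary: i rule: less_induct)
  case (less z)
  have "z \<noteq> 0" using less.prems by (cases "z = 0") (simp_all add: bit_len_def)
  moreover from this have "bit_len z = Suc (bit_len (z div 2))" by (simp add: bit_len_def bin_pos)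
  ultimately show ?case
    using less.IH[of "z div 2"] less.prems by (cases i) (simp_all add: bin_pos div_mult2_eq)
qed

lemma enc_nat_eq: "enc_nat z = concat (map (\<lambda>i. [True, bin z ! i]) [0..<bit_len z]) @ [False, False]"
proof -
  have "map (\<lambda>x. [True, x]) (bin z) = map (\<lambda>i. [True, bin z ! i]) [0..<bit_len z]"
    by (rule nth_equalityI) (simp_all add: bit_len_def)
  then show ?thesis by (simp add: enc_nat_def)
qed

lemma length_enc_nat: "length (enc_nat z) = enc_len z"
  by (simp add: enc_nat_eq length_concat_map_upt enc_len_def)

lemma num_enc_nat: "num (enc_nat z) = enc_num z"
proof -
  have "num (enc_nat z) = (\<Sum>i<bit_len z. 2 ^ (2 * i) * num [True, bin z ! i])"
    by (simp add: enc_nat_eq num_append num_concat_map_upt mult_2)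
  also have "\<dots> = enc_num z"
    unfolding enc_num_def
  proof (rule sum.cong[OF refl])
    fix i assume i: "i \<in> {..<bit_len z}"
    have "of_bool (bin z ! i) = z div 2 ^ i mod 2"
      using nth_bin[of i z] i by (auto simp: odd_iff_mod_2_eq_one even_iff_mod_2_eq_zero)
    then show "2 ^ (2 * i) * num [True, bin z ! i] =
        4 ^ min i (bit_len z) * (1 + 2 * (z div 2 ^ min i (bit_len z) mod 2))"
      using i by (simp add: power_mult min_def)
  qed
  finally show ?thesis .
qed

lemma two_mult_length_le_enc_tokens: "2 * length ts \<le> length (enc_tokens ts)"
  by (induction ts) (simp_all add: length_enc_nat enc_len_def)

lemma enc_len_le_enc_tokens: "z \<in> set ts \<Longrightarrow> enc_len z \<le> length (enc_tokens ts)"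
  by (induction ts) (auto simp: length_enc_nat)

lemma enc_instance_eq: "enc_instance gs out b =
    enc_nat (length gs) @ enc_nat out @ enc_tokens (concat (map tok_gate gs)) @ enc_tokens (tok_ext b)"
  unfolding enc_instance_def by (simp add: enc_tokens_def[symmetric])

definition ext_len :: "nat \<Rightarrow> nat \<Rightarrow> nat \<Rightarrow> nat" where
  "ext_len m k x = (if x = 0 then enc_len 0
     else enc_len 1 + (enc_len k + (\<Sum>i<k. enc_len (entry m i x))))"

definition ext_num :: "nat \<Rightarrow> nat \<Rightarrow> nat \<Rightarrow> nat" where
  "ext_num m k x = (if x = 0 then enc_num 0
     else enc_num 1 + pow2 m (enc_len 1) * (enc_num k + pow2 m (enc_len k) *
       (\<Sum>i<k. pow2 m (\<Sum>j<i. enc_len (entry m j x)) * enc_num (entry m i x))))"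

lemma enc_tok_ext_decode: "enc_tokens (tok_ext (decode m k x)) = (if x = 0 then enc_nat 0
    else enc_nat 1 @ enc_nat k @ concat (map (\<lambda>i. enc_nat (entry m i x)) [0..<k]))"
  by (simp add: decode_def enc_tokens_map)

lemma length_enc_ext: "length (enc_tokens (tok_ext (decode m k x))) = ext_len m k x"
  by (simp add: enc_tok_ext_decode ext_len_def length_enc_nat length_concat_map_upt)

lemma num_enc_ext:
  assumes "ext_len m k x \<le> bit_len m"
  shows "num (enc_tokens (tok_ext (decode m k x))) = ext_num m k x"
proof (cases "x = 0")
  case False
  let ?c = "concat (map (\<lambda>i. enc_nat (entry m i x)) [0..<k])"
  have len: "length (enc_nat 1 @ enc_nat k @ ?c) \<le> bit_len m"
    using assms length_enc_ext[of m k x] False by (simp add: enc_tok_ext_decode)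
  then have "length (enc_nat k @ ?c) \<le> bit_len m" "length ?c \<le> bit_len m" by auto
  then show ?thesis
    using False len num_append_pow2[of "enc_nat 1" "enc_nat k @ ?c" m] num_append_pow2[of "enc_nat k" ?c m]
      num_concat_map_upt_pow2[of "\<lambda>i. enc_nat (entry m i x)" k m]
    by (simp add: enc_tok_ext_decode ext_num_def length_enc_nat num_enc_nat)
qed (simp add: enc_tok_ext_decode ext_num_def num_enc_nat)

definition gate_len :: "nat \<Rightarrow> nat \<Rightarrow> nat \<Rightarrow> nat \<Rightarrow> nat \<Rightarrow> nat \<Rightarrow> nat \<Rightarrow> nat" where
  "gate_len m k TY J L X g =
    (if digit m (bound m) g TY = 0 then enc_len 0 + ext_len m k (digit m (bound m) g X)
     else if digit m (bound m) g TY = 1 then enc_len 1 + enc_len (digit m (bound m) g J)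
     else enc_len 2 + (enc_len (digit m (bound m) g TY - 2) +
       (enc_len (digit m (bound m) g J) + enc_len (digit m (bound m) g L))))"

definition gate_num :: "nat \<Rightarrow> nat \<Rightarrow> nat \<Rightarrow> nat \<Rightarrow> nat \<Rightarrow> nat \<Rightarrow> nat \<Rightarrow> nat" where
  "gate_num m k TY J L X g =
    (if digit m (bound m) g TY = 0
     then enc_num 0 + pow2 m (enc_len 0) * ext_num m k (digit m (bound m) g X)
     else if digit m (bound m) g TY = 1
     then enc_num 1 + pow2 m (enc_len 1) * enc_num (digit m (bound m) g J)
     else enc_num 2 + pow2 m (enc_len 2) *
       (enc_num (digit m (bound m) g TY - 2) + pow2 m (enc_len (digit m (bound m) g TY - 2)) *
         (enc_num (digit m (bound m) g J) + pow2 m (enc_len (digit m (bound m) g J)) *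
           enc_num (digit m (bound m) g L))))"

lemma enc_tok_gate_decode:
  assumes "digit m (bound m) g TY < 6"
  shows "enc_tokens (tok_gate (decode_gate m k TY J L X g)) =
    (if digit m (bound m) g TY = 0 then enc_nat 0 @ enc_tokens (tok_ext (decode m k (digit m (bound m) g X)))
     else if digit m (bound m) g TY = 1 then enc_nat 1 @ enc_nat (digit m (bound m) g J)
     else enc_nat 2 @ enc_nat (digit m (bound m) g TY - 2) @
       enc_nat (digit m (bound m) g J) @ enc_nat (digit m (bound m) g L))"
proof -
  have "digit m (bound m) g TY \<in> {0, 1, 2, 3, 4, 5}" using assms by auto
  then show ?thesis by (auto simp: decode_gate_def make_gate_def)
qed

lemma length_enc_gate:
  assumes "digit m (bound m) g TY < 6"
  shows "length (enc_tokens (tok_gate (decode_gate m k TY J L X g))) = gate_len m k TY J L X g"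
  by (simp add: enc_tok_gate_decode[OF assms] gate_len_def length_enc_nat length_enc_ext)

lemma num_enc_gate:
  assumes ty: "digit m (bound m) g TY < 6" and len: "gate_len m k TY J L X g \<le> bit_len m"
  shows "num (enc_tokens (tok_gate (decode_gate m k TY J L X g))) = gate_num m k TY J L X g"
proof -
  let ?t = "digit m (bound m) g TY" and ?j = "enc_nat (digit m (bound m) g J)"
    and ?l = "enc_nat (digit m (bound m) g L)" and ?x = "digit m (bound m) g X"
  consider "?t = 0" | "?t = 1" | "?t \<noteq> 0" "?t \<noteq> 1" by blast
  then show ?thesis
  proof cases
    case 1
    then show ?thesis
      using len num_append_pow2[of "enc_nat 0" "enc_tokens (tok_ext (decode m k ?x))" m] num_enc_ext[of m k ?x]
      by (simp add: enc_tok_gate_decode[OF ty] gate_num_def gate_len_def num_enc_nat length_enc_nat length_enc_ext)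
  next
    case 2
    then show ?thesis
      using len num_append_pow2[of "enc_nat 1" ?j m]
      by (simp add: enc_tok_gate_decode[OF ty] gate_num_def gate_len_def num_enc_nat length_enc_nat)
  next
    case 3
    then show ?thesis
      using len num_append_pow2[of "enc_nat 2" "enc_nat (?t - 2) @ ?j @ ?l" m]
        num_append_pow2[of "enc_nat (?t - 2)" "?j @ ?l" m] num_append_pow2[of ?j ?l m]
      by (simp add: enc_tok_gate_decode[OF ty] gate_num_def gate_len_def num_enc_nat length_enc_nat)
  qed
qed

definition instance_len :: "nat \<Rightarrow> nat \<Rightarrow> nat \<Rightarrow> nat \<Rightarrow> nat \<Rightarrow> nat \<Rightarrow> nat \<Rightarrow> nat \<Rightarrow> nat \<Rightarrow> nat" where
  "instance_len m k TY J L X G out b = enc_len G + (enc_len out +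
    ((\<Sum>g<G. gate_len m k TY J L X g) + ext_len m k b))"

definition instance_num :: "nat \<Rightarrow> nat \<Rightarrow> nat \<Rightarrow> nat \<Rightarrow> nat \<Rightarrow> nat \<Rightarrow> nat \<Rightarrow> nat \<Rightarrow> nat \<Rightarrow> nat" where
  "instance_num m k TY J L X G out b = enc_num G + pow2 m (enc_len G) * (enc_num out + pow2 m (enc_len out) *
    ((\<Sum>g<G. pow2 m (\<Sum>h<g. gate_len m k TY J L X h) * gate_num m k TY J L X g) +
     pow2 m (\<Sum>g<G. gate_len m k TY J L X g) * ext_num m k b))"

text \<open>A word is determined by its length and its number, so parsing becomes two equations. The
  formula for the number is correct only once the length is known to fit, because its powers are
  capped.\<close>

lemma enc_instance_decode_iff:
  assumes ty: "\<forall>g<G. digit m (bound m) g TY < 6" and n: "bit_len m = length w"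
  shows "enc_instance (map (decode_gate m k TY J L X) [0..<G]) out (decode m k b) = w \<longleftrightarrow>
    instance_len m k TY J L X G out b = length w \<and> instance_num m k TY J L X G out b = num w"
proof -
  let ?f = "\<lambda>g. enc_tokens (tok_gate (decode_gate m k TY J L X g))"
  let ?c = "concat (map ?f [0..<G])" and ?b = "enc_tokens (tok_ext (decode m k b))"
  have eq: "enc_instance (map (decode_gate m k TY J L X) [0..<G]) out (decode m k b) =
      enc_nat G @ enc_nat out @ ?c @ ?b" (is "?I = _")
    by (simp add: enc_instance_eq enc_tokens_concat_map comp_def)
  have lenc: "length ?c = (\<Sum>g<G. gate_len m k TY J L X g)"
    unfolding length_concat_map_upt by (rule sum.cong) (use ty length_enc_gate in auto)
  have len: "length ?I = instance_len m k TY J L X G out b"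
    unfolding eq instance_len_def by (simp add: length_enc_nat lenc length_enc_ext)
  have num: "num ?I = instance_num m k TY J L X G out b" if le: "length ?I \<le> bit_len m"
  proof -
    have le1: "length (enc_nat G @ enc_nat out @ ?c @ ?b) \<le> bit_len m" using le unfolding eq .
    then have le2: "length (enc_nat out @ ?c @ ?b) \<le> bit_len m" "length (?c @ ?b) \<le> bit_len m"
      "length ?c \<le> bit_len m" "length ?b \<le> bit_len m" by auto
    have "num ?c = (\<Sum>g<G. pow2 m (\<Sum>h<g. length (?f h)) * num (?f g))"
      by (rule num_concat_map_upt_pow2[OF le2(3)])
    also have "\<dots> = (\<Sum>g<G. pow2 m (\<Sum>h<g. gate_len m k TY J L X h) * gate_num m k TY J L X g)"
    proof (rule sum.cong[OF refl])
      fix g assume g: "g \<in> {..<G}"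
      have "(\<Sum>h<g. length (?f h)) = (\<Sum>h<g. gate_len m k TY J L X h)"
        by (rule sum.cong) (use ty g length_enc_gate in auto)
      moreover have "gate_len m k TY J L X g \<le> (\<Sum>g<G. gate_len m k TY J L X g)"
        by (rule member_le_sum) (use g in auto)
      then have "num (?f g) = gate_num m k TY J L X g"
        using ty g le2(3) unfolding lenc by (intro num_enc_gate) auto
      ultimately show "pow2 m (\<Sum>h<g. length (?f h)) * num (?f g) =
          pow2 m (\<Sum>h<g. gate_len m k TY J L X h) * gate_num m k TY J L X g" by simp
    qed
    finally have numc: "num ?c = \<dots>" .
    have numb: "num ?b = ext_num m k b" using le2(4) by (intro num_enc_ext) (simp add: length_enc_ext)
    show ?thesis
      unfolding eq num_append_pow2[OF le1] num_append_pow2[OF le2(1)] num_append_pow2[OF le2(2)]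
        numc numb lenc instance_num_def num_enc_nat length_enc_nat ..
  qed
  show ?thesis
    using num_inject[of ?I w] len num n by auto
qed

section \<open>The decision procedure\<close>

definition valid :: "nat \<Rightarrow> nat \<Rightarrow> nat \<Rightarrow> nat \<Rightarrow> nat \<Rightarrow> bool" where
  "valid m TY J L G \<longleftrightarrow> (\<forall>g<G. digit m (bound m) g TY < 6 \<and> (digit m (bound m) g TY = 0 \<or>
     g < digit m (bound m) g J \<and> digit m (bound m) g J < G \<and> (digit m (bound m) g TY = 1 \<or>
     g < digit m (bound m) g L \<and> digit m (bound m) g L < G)))"

definition arrays :: "nat \<Rightarrow> nat" where
  "arrays m = bound m ^ min (bit_len m) (bit_len m)"

text \<open>The position \<open>p\<close> supplies output gate and candidate element. The length of
  the fourth power of \<open>m + 1\<close> exceeds \<open>4 * n\<close>, enough for two moves per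
  gate. Reduction modulo \<open>positions m\<close> does not change \<open>p\<close>, but makes it a
  position for all values of the variables, as \<open>PS_win\<close> requires.\<close>

definition accept :: "nat \<Rightarrow> nat \<Rightarrow> bool" where
  "accept m W \<longleftrightarrow> (\<exists>k<Suc (bit_len m). 0 < k \<and> (\<exists>G<Suc (bit_len m). \<exists>p<positions m. kind p = 0 \<and> gate1 m p < G \<and>
     (\<exists>TY<arrays m. \<exists>J<arrays m. \<exists>L<arrays m. \<exists>X<arrays m. valid m TY J L G \<and>
        instance_len m k TY J L X G (gate1 m p) (code1 m p) = bit_len m \<and>
        instance_num m k TY J L X G (gate1 m p) (code1 m p) = W \<and>
        win (positions m) (\<lambda>p c. legal m k TY J L X p c) (bit_len ((m + 1) * (m + 1) * (m + 1) * (m + 1)))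
          (p mod positions m))))"

section \<open>Computability of the acceptance predicate\<close>

lemma PS_base: "PS a \<Longrightarrow> PS (\<lambda>e. base (a e))"
  unfolding base_def by (intro PS_intros)

lemma PS_bound: "PS a \<Longrightarrow> PS (\<lambda>e. bound (a e))"
  unfolding bound_def by (intro PS_intros PS_base)

lemma PS_positions: "PS a \<Longrightarrow> PS (\<lambda>e. positions (a e))"
  unfolding positions_def by (intro PS_intros PS_bound)

lemma PS_arrays: "PS a \<Longrightarrow> PS (\<lambda>e. arrays (a e))"
  unfolding arrays_def by (intro PS_intros PS_bound)

lemma PS_digit: "PS a \<Longrightarrow> PS b \<Longrightarrow> PS c \<Longrightarrow> PS d \<Longrightarrow> PS (\<lambda>e. digit (a e) (b e) (c e) (d e))"
  unfolding digit_def by (intro PS_intros)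

lemma PS_entry: "PS a \<Longrightarrow> PS b \<Longrightarrow> PS c \<Longrightarrow> PS (\<lambda>e. entry (a e) (b e) (c e))"
  unfolding entry_def by (intro PS_intros PS_digit PS_base)

lemma PS_kind: "PS a \<Longrightarrow> PS (\<lambda>e. kind (a e))"
  unfolding kind_def by (intro PS_intros)

lemma PS_gate1: "PS a \<Longrightarrow> PS b \<Longrightarrow> PS (\<lambda>e. gate1 (a e) (b e))"
  and PS_gate2: "PS a \<Longrightarrow> PS b \<Longrightarrow> PS (\<lambda>e. gate2 (a e) (b e))"
  and PS_code1: "PS a \<Longrightarrow> PS b \<Longrightarrow> PS (\<lambda>e. code1 (a e) (b e))"
  and PS_code2: "PS a \<Longrightarrow> PS b \<Longrightarrow> PS (\<lambda>e. code2 (a e) (b e))"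
  unfolding gate1_def gate2_def code1_def code2_def by (intro PS_intros PS_bound; assumption)+

text \<open>The arguments are first replaced by variables, because under the bounded quantifier they
  would have to be shifted. The same pattern recurs wherever a definition binds a variable.\<close>

lemma PS_code_eq: "PS a \<Longrightarrow> PS b \<Longrightarrow> PS c \<Longrightarrow> PS d \<Longrightarrow> PSb (\<lambda>e. code_eq (a e) (b e) (c e) (d e))"
proof (rule PS_comp4[where f = "\<lambda>m k x y. of_bool (code_eq m k x y)"])
  have "PSb (\<lambda>e. (e 2 = 0 \<longrightarrow> e 3 = 0) \<and> (e 3 = 0 \<longrightarrow> e 2 = 0) \<and> (\<forall>i<e 1. entry (e 0) i (e 2) = entry (e 0) i (e 3)))"
    by (intro PS_intros PS_entry)
  then show "PSb (\<lambda>e. code_eq (e 0) (e 1) (e 2) (e 3))"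
    by (simp only: code_eq_def iff_conv_conj_imp conj_assoc)
qed

lemma PS_code_plus:
  "PS a \<Longrightarrow> PS b \<Longrightarrow> PS c \<Longrightarrow> PS d \<Longrightarrow> PS d' \<Longrightarrow> PSb (\<lambda>e. code_plus (a e) (b e) (c e) (d e) (d' e))"
proof (rule PS_comp5[where f = "\<lambda>m k x u v. of_bool (code_plus m k x u v)"])
  show "PSb (\<lambda>e. code_plus (e 0) (e 1) (e 2) (e 3) (e 4))"
    unfolding code_plus_def by (intro PS_intros PS_entry)
qed

lemma PS_code_minus:
  "PS a \<Longrightarrow> PS b \<Longrightarrow> PS c \<Longrightarrow> PS d \<Longrightarrow> PS d' \<Longrightarrow> PSb (\<lambda>e. code_minus (a e) (b e) (c e) (d e) (d' e))"
proof (rule PS_comp5[where f = "\<lambda>m k x u v. of_bool (code_minus m k x u v)"])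
  show "PSb (\<lambda>e. code_minus (e 0) (e 1) (e 2) (e 3) (e 4))"
    unfolding code_minus_def by (intro PS_intros PS_entry PS_base)
qed

lemmas PS_code_intros = PS_intros PS_base PS_bound PS_positions PS_arrays PS_digit PS_entry PS_kind
  PS_gate1 PS_gate2 PS_code1 PS_code2 PS_code_eq PS_code_plus PS_code_minus

lemma PS_legal:
  "PS a \<Longrightarrow> PS b \<Longrightarrow> PS c \<Longrightarrow> PS d \<Longrightarrow> PS a' \<Longrightarrow> PS b' \<Longrightarrow> PS c' \<Longrightarrow> PS d' \<Longrightarrow>
    PSb (\<lambda>e. legal (a e) (b e) (c e) (d e) (a' e) (b' e) (c' e) (d' e))"
  unfolding legal_def by (intro PS_code_intros)

lemma PS_enc_len: "PS a \<Longrightarrow> PS (\<lambda>e. enc_len (a e))"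
  unfolding enc_len_def by (intro PS_intros)

lemma PS_enc_num: "PS a \<Longrightarrow> PS (\<lambda>e. enc_num (a e))"
proof (rule PS_comp1[where f = enc_num])
  show "PS (\<lambda>e. enc_num (e 0))" unfolding enc_num_def by (intro PS_intros)
qed

lemma PS_pow2: "PS a \<Longrightarrow> PS b \<Longrightarrow> PS (\<lambda>e. pow2 (a e) (b e))"
  unfolding pow2_def by (intro PS_intros)

lemma PS_ext_len: "PS a \<Longrightarrow> PS b \<Longrightarrow> PS c \<Longrightarrow> PS (\<lambda>e. ext_len (a e) (b e) (c e))"
proof (rule PS_comp3[where f = ext_len])
  show "PS (\<lambda>e. ext_len (e 0) (e 1) (e 2))"
    unfolding ext_len_def by (intro PS_code_intros PS_enc_len)
qed

lemma PS_ext_num: "PS a \<Longrightarrow> PS b \<Longrightarrow> PS c \<Longrightarrow> PS (\<lambda>e. ext_num (a e) (b e) (c e))"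
proof (rule PS_comp3[where f = ext_num])
  show "PS (\<lambda>e. ext_num (e 0) (e 1) (e 2))"
    unfolding ext_num_def by (intro PS_code_intros PS_enc_len PS_enc_num PS_pow2)
qed

lemma PS_gate_len:
  "PS a \<Longrightarrow> PS b \<Longrightarrow> PS c \<Longrightarrow> PS d \<Longrightarrow> PS a' \<Longrightarrow> PS b' \<Longrightarrow> PS c' \<Longrightarrow>
    PS (\<lambda>e. gate_len (a e) (b e) (c e) (d e) (a' e) (b' e) (c' e))"
  unfolding gate_len_def by (intro PS_code_intros PS_enc_len PS_ext_len)

lemma PS_gate_num:
  "PS a \<Longrightarrow> PS b \<Longrightarrow> PS c \<Longrightarrow> PS d \<Longrightarrow> PS a' \<Longrightarrow> PS b' \<Longrightarrow> PS c' \<Longrightarrow>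
    PS (\<lambda>e. gate_num (a e) (b e) (c e) (d e) (a' e) (b' e) (c' e))"
  unfolding gate_num_def by (intro PS_code_intros PS_enc_len PS_enc_num PS_pow2 PS_ext_num)

lemma positions_pos: "0 < positions m"
  using bound_gt(2)[of m] by (simp add: positions_def)

lemma PS_accept: "PS a \<Longrightarrow> PS b \<Longrightarrow> PSb (\<lambda>e. accept (a e) (b e))"
proof (rule PS_comp2[where f = "\<lambda>m w. of_bool (accept m w)"])
  show "PSb (\<lambda>e. accept (e 0) (e 1))"
    unfolding accept_def valid_def instance_len_def instance_num_def
    by (intro PS_code_intros PS_win PS_legal PS_gate_len PS_gate_num PS_ext_len PS_ext_num PS_enc_len
        PS_enc_num PS_pow2 mod_less_divisor positions_pos)
qed

section \<open>Correctness of the acceptance predicate\<close>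

lemma wf_decode:
  assumes "valid m TY J L G" "out < G"
  shows "wf_circuit {OUn, OInt, OCompl, OPlus, OMinus} k (map (decode_gate m k TY J L X) [0..<G]) out"
proof -
  let ?g = "decode_gate m k TY J L X"
  have ops: "bop_oper f \<in> {OUn, OInt, OCompl, OPlus, OMinus}" for f by (cases f) auto
  have pred: "case ?g i of Inp a \<Rightarrow> a \<in> univ k
      | Neg j \<Rightarrow> i < j \<and> j < G | Bin f j l \<Rightarrow> i < j \<and> j < G \<and> i < l \<and> l < G" if "i < G" for i
    using assms(1)[unfolded valid_def, rule_format, OF that]
    by (auto simp: decode_gate_def make_gate_def decode_in_univ)
  show ?thesis
    unfolding wf_circuit_def
  proof (intro conjI allI impI)
    fix i assume "i < length (map ?g [0..<G])"
    then have "i < G" by simp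
    then show "case map ?g [0..<G] ! i of Inp a \<Rightarrow> a \<in> univ k
      | Neg j \<Rightarrow> OCompl \<in> {OUn, OInt, OCompl, OPlus, OMinus} \<and> i < j \<and> j < length (map ?g [0..<G])
      | Bin f j l \<Rightarrow> bop_oper f \<in> {OUn, OInt, OCompl, OPlus, OMinus} \<and>
          i < j \<and> j < length (map ?g [0..<G]) \<and> i < l \<and> l < length (map ?g [0..<G])"
      using pred[of i] ops by (cases "?g i") simp_all
  qed (use assms(2) in simp)
qed

text \<open>Each token occupies at least two bits and at least its own binary length, so the word
  length bounds both the number of entries and their lengths.\<close>

lemma label_le_if_enc_instance:
  assumes w: "enc_instance gs out b = w" and m: "m + 1 = 2 ^ length w"
    and i: "i < length gs" "gs ! i = Inp (Fin v)"
  shows "\<forall>x\<in>set v. x \<le> m" "length v \<le> length w"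
proof -
  have mem: "gs ! i \<in> set gs" using i(1) by (rule nth_mem)
  have "length x \<le> length (concat xs)" if "x \<in> set xs" for x :: "nat list" and xs
    using that by (induction xs) auto
  then have "length (tok_gate (gs ! i)) \<le> length (concat (map tok_gate gs))" using mem by simp
  also have "\<dots> \<le> length (enc_tokens (concat (map tok_gate gs)))"
    using two_mult_length_le_enc_tokens[of "concat (map tok_gate gs)"] by linarith
  also have "\<dots> \<le> length w" unfolding w[symmetric] enc_instance_eq by simp
  finally show "length v \<le> length w" by (simp add: i(2))
  show "\<forall>x\<in>set v. x \<le> m"
  proof
    fix x assume "x \<in> set v"
    then have "x \<in> set (tok_gate (gs ! i))" by (simp only: i(2)) simp
    then have "x \<in> set (concat (map tok_gate gs))" using mem by auto
    then have "enc_len x \<le> length w"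
      using enc_len_le_enc_tokens[of x "concat (map tok_gate gs)"] unfolding w[symmetric] enc_instance_eq by simp
    then have "bit_len x \<le> length w" by (simp add: enc_len_def)
    then have "(2::nat) ^ bit_len x \<le> 2 ^ length w" by (intro power_increasing) auto
    then show "x \<le> m" using less_power_bit_len[of x] m by linarith
  qed
qed

lemma depth_bound:
  assumes "m + 1 = 2 ^ n" "G \<le> n" "g < G"
  shows "2 * (G - g) < bit_len ((m + 1) * (m + 1) * (m + 1) * (m + 1))"
proof -
  have "(m + 1) * (m + 1) * (m + 1) * (m + 1) = 2 ^ (n + n + n + n)"
    unfolding assms(1) power_add ..
  then have "n + n + n + n < bit_len ((m + 1) * (m + 1) * (m + 1) * (m + 1))"
    using power_le_iff_bit_len[of "n + n + n + n", THEN iffD1, OF order_refl] by simp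
  then show ?thesis using assms by linarith
qed

lemma accept_imp_MC:
  assumes n: "bit_len m = length w" "m + 1 = 2 ^ length w" and acc: "accept m (num w)"
  shows "w \<in> MC {OUn, OInt, OCompl, OPlus, OMinus}"
proof -
  obtain k G p TY J L X where k: "k \<le> length w" "0 < k" and G: "G \<le> length w"
    and p: "p < positions m" "kind p = 0" "gate1 m p < G" and valid: "valid m TY J L G"
    and enc: "instance_len m k TY J L X G (gate1 m p) (code1 m p) = length w"
      "instance_num m k TY J L X G (gate1 m p) (code1 m p) = num w"
    and win: "win (positions m) (legal m k TY J L X) (bit_len ((m + 1) * (m + 1) * (m + 1) * (m + 1))) p"
    using acc unfolding accept_def n(1) by (auto simp: less_Suc_eq_le)
  let ?gs = "map (decode_gate m k TY J L X) [0..<G]" and ?b = "decode m k (code1 m p)"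
  have "\<forall>g<G. digit m (bound m) g TY < 6" using valid by (simp add: valid_def)
  from enc_instance_decode_iff[OF this n(1)] enc have w: "enc_instance ?gs (gate1 m p) ?b = w" by blast
  have wf: "wf_circuit {OUn, OInt, OCompl, OPlus, OMinus} k ?gs (gate1 m p)"
    by (rule wf_decode[OF valid p(3)])
  have "?b \<in> gval k ?gs (gate1 m p)"
  proof (rule win_iff_gval[THEN iffD1, OF n(2) k(1) G wf _ p(2,3) depth_bound[OF n(2) G p(3)] win])
    fix i v assume i: "i < G" "?gs ! i = Inp (Fin v)"
    show "\<forall>x\<in>set v. x \<le> m"
      by (rule label_le_if_enc_instance(1)[OF w n(2) _ i(2)]) (use i(1) in simp)
  qed
  moreover have "1 \<le> k" using k(2) by simp
  ultimately show ?thesis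
    unfolding MC_def using w[symmetric] wf decode_in_univ[of m k "code1 m p"] by blast
qed

text \<open>The dimension shows in the encoding only as the length of a vector, which is then at
  most the length of the word. If there is no vector at all, dimension 1 does as well.\<close>

lemma MC_dimension_le:
  assumes "w \<in> MC Ops" and m: "m + 1 = 2 ^ length w"
  obtains gs out b k where "enc_instance gs out b = w" "1 \<le> k" "k \<le> length w"
    "wf_circuit Ops k gs out" "b \<in> box k m" "b \<in> gval k gs out"
proof -
  obtain gs out b k where w: "enc_instance gs out b = w" and k: "1 \<le> k" "wf_circuit Ops k gs out"
    "b \<in> univ k" "b \<in> gval k gs out"
    using assms(1) unfolding MC_def by auto
  have b_le: "b \<in> box k m \<and> k \<le> length w" if "b = Fin v" for v
  proof -
    have "x \<le> m" if "x \<in> set v" for x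
    proof -
      have "x \<in> set (tok_ext b)" using that \<open>b = Fin v\<close> by simp
      then have "enc_len x \<le> length w"
        using enc_len_le_enc_tokens[of x "tok_ext b"] unfolding w[symmetric] enc_instance_eq by simp
      then have "(2::nat) ^ bit_len x \<le> 2 ^ length w"
        by (intro power_increasing) (auto simp: enc_len_def)
      then show ?thesis using less_power_bit_len[of x] m by linarith
    qed
    moreover have "length v \<le> length (enc_tokens (tok_ext b))"
      using two_mult_length_le_enc_tokens[of "tok_ext b"] that by simp
    then have "length v \<le> length w" unfolding w[symmetric] enc_instance_eq by simp
    ultimately show ?thesis using k(3) that by (auto simp: Fin_in_box)
  qed
  show ?thesis
  proof (cases "(\<exists>v. b = Fin v) \<or> (\<exists>i v. i < length gs \<and> gs ! i = Inp (Fin v))")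
    case True
    have "k \<le> length w"
      using True
    proof
      assume "\<exists>i v. i < length gs \<and> gs ! i = Inp (Fin v)"
      then obtain i v where i: "i < length gs" "gs ! i = Inp (Fin v)" by blast
      then show ?thesis
        using label_le_if_enc_instance(2)[OF w m i] wf_gates(1)[OF k(2) i] by simp
    qed (use b_le in blast)
    moreover have "b \<in> box k m" using b_le by (cases b) auto
    ultimately show ?thesis using that w k by blast
  next
    case False
    then have b: "b = Infty" by (cases b) auto
    have lab: "a = Infty" if "i < length gs" "gs ! i = Inp a" for i a
      using that False by (cases a) auto
    have wf1: "wf_circuit Ops 1 gs out"
      unfolding wf_circuit_def
    proof (intro conjI allI impI)
      fix i assume i: "i < length gs"
      show "case gs ! i of Inp a \<Rightarrow> a \<in> univ 1 | Neg j \<Rightarrow> OCompl \<in> Ops \<and> i < j \<and> j < length gs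
        | Bin f j l \<Rightarrow> bop_oper f \<in> Ops \<and> i < j \<and> j < length gs \<and> i < l \<and> l < length gs"
        using k(2) lab[OF i] i by (cases "gs ! i") (auto simp: wf_circuit_def)
    qed (use k(2) in \<open>simp add: wf_circuit_def\<close>)
    have "out < length gs" using k(2) by (simp add: wf_circuit_def)
    from gval_dimension_irrelevant[OF k(2) wf1 lab this] have "b \<in> gval 1 gs out"
      using k(4) b by simp
    moreover have "1 \<le> length w" unfolding w[symmetric] enc_instance_eq
      by (simp add: length_enc_nat enc_len_def)
    ultimately show ?thesis using that[OF w _ _ wf1] b by simp
  qed
qed

lemma ex_make_gate:
  assumes "k \<le> bit_len m" "G \<le> bound m"
    and "case \<gamma> of Inp a \<Rightarrow> a \<in> box k (base m - 1) | Neg j \<Rightarrow> j < G | Bin f j l \<Rightarrow> j < G \<and> l < G"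
  shows "\<exists>t j l x. t < 6 \<and> j < bound m \<and> l < bound m \<and> x < bound m \<and> make_gate m k t j l x = \<gamma>"
proof (cases \<gamma>)
  case (Inp a)
  then obtain x where "x < bound m" "decode m k x = a" using ex_decode[OF assms(1)] assms(3) by auto
  then show ?thesis using Inp bound_gt(2)[of m]
    by (intro exI[of _ 0] exI[of _ x]) (simp add: make_gate_def)
next
  case (Neg j)
  then show ?thesis using assms(2,3) bound_gt(2)[of m]
    by (intro exI[of _ 1] exI[of _ j] exI[of _ 0]) (simp add: make_gate_def)
next
  case (Bin f j l)
  have "bop_code f + 2 < 6" "make_gate m k (bop_code f + 2) j l 0 = \<gamma>"
    by (cases f; simp add: make_gate_def Bin)+
  moreover have "j < bound m" "l < bound m" using Bin assms(2,3) by auto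
  ultimately show ?thesis using bound_gt(2)[of m] by blast
qed

lemma ex_array:
  assumes "\<And>g. g < G \<Longrightarrow> f g < bound m" "G \<le> bit_len m"
  shows "\<exists>A<arrays m. \<forall>g<G. digit m (bound m) g A = f g"
proof -
  have "\<forall>g<bit_len m. (if g < G then f g else 0) < bound m" using assms bound_gt(2)[of m] by simp
  from ex_digits[OF this] obtain A where "A < bound m ^ bit_len m"
    "\<forall>g<bit_len m. A div bound m ^ g mod bound m = (if g < G then f g else 0)" by blast
  then show ?thesis using assms(2) by (intro exI[of _ A]) (auto simp: arrays_def digit_def min_def)
qed

lemma MC_imp_accept:
  assumes n: "bit_len m = length w" "m + 1 = 2 ^ length w"
    and mc: "w \<in> MC {OUn, OInt, OCompl, OPlus, OMinus}"
  shows "accept m (num w)"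
proof -
  obtain gs out b k where w: "enc_instance gs out b = w" and k: "1 \<le> k" "k \<le> length w"
    and wf: "wf_circuit {OUn, OInt, OCompl, OPlus, OMinus} k gs out"
    and b: "b \<in> box k m" "b \<in> gval k gs out"
    by (rule MC_dimension_le[OF mc n(2)])
  define G where "G = length gs"
  have out: "out < G" using wf by (simp add: wf_circuit_def G_def)
  have km: "k \<le> bit_len m" using k n by simp
  have G: "G \<le> length w"
  proof -
    have tokens: "length xs \<le> length (concat (map tok_gate xs))" for xs
    proof (induction xs)
      case (Cons x xs)
      then show ?case by (cases x) auto
    qed simp
    then have "G \<le> length (enc_tokens (concat (map tok_gate gs)))"
      using two_mult_length_le_enc_tokens[of "concat (map tok_gate gs)"] tokens[of gs]
      unfolding G_def by linarith
    then show ?thesis unfolding w[symmetric] enc_instance_eq by simp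
  qed
  then have GH: "G < bound m" using bound_gt(1)[of m] n by simp
  have m_le: "m \<le> base m - 1" by (simp add: base_def)
  have box_mono: "x \<in> box k (base m - 1)" if "x \<in> box k m" for x
    using that m_le by (auto simp: box_def intro: order_trans)
  have "\<exists>t j l x. t < 6 \<and> j < bound m \<and> l < bound m \<and> x < bound m \<and> make_gate m k t j l x = gs ! g"
    if g: "g < G" for g
  proof (rule ex_make_gate[OF km less_imp_le[OF GH]])
    have g': "g < length gs" using g by (simp add: G_def)
    show "case gs ! g of Inp a \<Rightarrow> a \<in> box k (base m - 1) | Neg j \<Rightarrow> j < G | Bin f j l \<Rightarrow> j < G \<and> l < G"
    proof (cases "gs ! g")
      case (Inp a)
      have "a \<in> box k m"
      proof (cases a)
        case (Fin v)
        then show ?thesis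
          using label_le_if_enc_instance(1)[OF w n(2) g'] wf_gates(1)[OF wf g' Inp] Inp
          by (simp add: Fin_in_box)
      qed simp
      then show ?thesis using Inp box_mono by simp
    qed (use wf_gates(2,3)[OF wf g'] in \<open>auto simp: G_def\<close>)
  qed
  then obtain t j l x where code: "\<And>g. g < G \<Longrightarrow> t g < 6 \<and> j g < bound m \<and> l g < bound m \<and> x g < bound m \<and>
      make_gate m k (t g) (j g) (l g) (x g) = gs ! g"
    by metis
  \<comment> \<open>Types are digits in base \<open>bound m\<close>, which has to exceed 5. The word
    is nonempty because \<open>1 \<le> k\<close>, so \<open>base m\<close> is at least 5 and
    \<open>bound m\<close> at least its square.\<close>
  have six: "t g < bound m" if "g < G" for g
  proof -
    have "1 \<le> bit_len m" using n k by simp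
    have "1 \<le> m" using \<open>1 \<le> bit_len m\<close> bit_len_le_self[of m] by simp
    then have "5 \<le> base m" using mult_le_mono[of 2 "m + 1" 2 "m + 1"] by (simp add: base_def)
    then have "5 * 5 \<le> base m * base m" by (rule mult_le_mono) fact
    also have "\<dots> = base m ^ 2" by (simp add: power2_eq_square)
    also have "\<dots> \<le> bound m" unfolding bound_eq
      by (rule power_increasing) (use \<open>1 \<le> bit_len m\<close> base_ge[of m] in auto)
    finally have "25 \<le> bound m" by simp
    then show ?thesis using code[OF that] by linarith
  qed
  have Gn: "G \<le> bit_len m" using G n by simp
  obtain TY where TY: "TY < arrays m" "\<forall>g<G. digit m (bound m) g TY = t g"
    using ex_array[of G t m, OF six Gn] by blast
  obtain J where J: "J < arrays m" "\<forall>g<G. digit m (bound m) g J = j g"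
    using ex_array[of G j m] code Gn by blast
  obtain L where L: "L < arrays m" "\<forall>g<G. digit m (bound m) g L = l g"
    using ex_array[of G l m] code Gn by blast
  obtain X where X: "X < arrays m" "\<forall>g<G. digit m (bound m) g X = x g"
    using ex_array[of G x m] code Gn by blast
  have gs: "map (decode_gate m k TY J L X) [0..<G] = gs"
    using code TY J L X by (intro nth_equalityI) (auto simp: decode_gate_def G_def)
  obtain y where y: "y < bound m" "decode m k y = b" using ex_decode[OF km box_mono[OF b(1)]] by blast
  have "out < bound m" using out GH by linarith
  then obtain p where p: "p < positions m" "kind p = 0" "gate1 m p = out" "code1 m p = y"
    using ex_position[of 0 out m 0 y 0] y(1) bound_gt(2)[of m] by auto
  have valid: "valid m TY J L G"
    unfolding valid_def
  proof (intro allI impI)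
    fix g assume g: "g < G"
    then have g': "g < length gs" by (simp add: G_def)
    have mk: "gs ! g = make_gate m k (t g) (j g) (l g) (x g)" using code[OF g] by simp
    have "t g = 0 \<or> g < j g \<and> j g < G \<and> (t g = 1 \<or> g < l g \<and> l g < G)"
    proof -
      consider "t g = 0" | "t g = 1" "gs ! g = Neg (j g)" | f where "gs ! g = Bin f (j g) (l g)"
        using mk by (auto simp: make_gate_def split: if_splits)
      then show ?thesis using wf_gates(2,3)[OF wf g'] by cases (auto simp: G_def)
    qed
    then show "digit m (bound m) g TY < 6 \<and> (digit m (bound m) g TY = 0 \<or>
       g < digit m (bound m) g J \<and> digit m (bound m) g J < G \<and> (digit m (bound m) g TY = 1 \<or>
       g < digit m (bound m) g L \<and> digit m (bound m) g L < G))"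
      using code[OF g] TY J L g by simp
  qed
  have "\<forall>g<G. digit m (bound m) g TY < 6" using TY code by simp
  from enc_instance_decode_iff[OF this n(1), of k J L X out y]
  have enc: "instance_len m k TY J L X G (gate1 m p) (code1 m p) = bit_len m"
    "instance_num m k TY J L X G (gate1 m p) (code1 m p) = num w"
    using w gs y p n by auto
  have "win (positions m) (legal m k TY J L X) (bit_len ((m + 1) * (m + 1) * (m + 1) * (m + 1))) p"
  proof (rule win_iff_gval[THEN iffD2, OF n(2) k(2) G])
    show "wf_circuit {OUn, OInt, OCompl, OPlus, OMinus} k (map (decode_gate m k TY J L X) [0..<G]) out"
      using wf gs by simp
    show "\<forall>x\<in>set v. x \<le> m" if "i < G" "map (decode_gate m k TY J L X) [0..<G] ! i = Inp (Fin v)" for i v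
      using label_le_if_enc_instance(1)[OF w n(2)] that unfolding gs by (simp add: G_def)
    show "kind p = 0" "gate1 m p < G" using p out by auto
    then show "2 * (G - gate1 m p) < bit_len ((m + 1) * (m + 1) * (m + 1) * (m + 1))"
      by (intro depth_bound[OF n(2) G])
    show "decode m k (code1 m p) \<in> gval k (map (decode_gate m k TY J L X) [0..<G]) (gate1 m p)"
      using b p y unfolding gs by simp
  qed
  then have win: "win (positions m) (legal m k TY J L X) (bit_len ((m + 1) * (m + 1) * (m + 1) * (m + 1)))
      (p mod positions m)" using p(1) by simp
  have lt: "k < Suc (bit_len m)" "0 < k" "G < Suc (bit_len m)" "gate1 m p < G"
    using k km Gn p out by linarith+
  show ?thesis
    unfolding accept_def
    by (rule exI[of _ k], intro conjI, (fact lt)+, rule exI[of _ G], intro conjI, fact lt,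
        rule exI[of _ p], intro conjI, (fact p lt)+, rule exI[of _ TY], intro conjI, fact TY,
        rule exI[of _ J], intro conjI, fact J, rule exI[of _ L], intro conjI, fact L,
        rule exI[of _ X], intro conjI; fact X valid enc win)
qed

theorem theorem6:
  shows "MC {OUn, OInt, OCompl, OPlus, OMinus} \<in> PSPACE"
proof -
  \<comment> \<open>Word and complement have disjoint bits, so the sum of their numbers consists of
    \<open>length w\<close> ones and has binary length \<open>length w\<close>.\<close>
  have "PSb (\<lambda>e. accept (e 0 + e 1) (e 1))" by (intro PS_accept PS_intros)
  then have "{w. accept (num (map Not w) + num w) (num w)} \<in> PSPACE" by (rule PS_imp_PSPACE)
  moreover have "accept (num (map Not w) + num w) (num w) \<longleftrightarrow> w \<in> MC {OUn, OInt, OCompl, OPlus, OMinus}" for w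
  proof -
    have m: "num (map Not w) + num w + 1 = 2 ^ length w" by (rule num_map_Not)
    then have "bit_len (num (map Not w) + num w) = length w"
      using bit_len_mask[of "length w"] by (metis add_diff_cancel_right')
    then show ?thesis using accept_imp_MC MC_imp_accept m by blast
  qed
  ultimately show ?thesis by simp
qed

end
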